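(* Assume that there is no $j\in I\setminus\{i_+,i_-\}$ with both $j\cdot i_+\neq0$ and $j\cdot i_-\neq0$. Then for any $e\in\{\pm1\}$ and all $i\in\widehat I$ the operators $T'_{i,e}$ (respectively $T''_{i,e}$) on $\mathbf U_{I,\widehat I}/\mathcal J_{I,\widehat I}$ and on $\mathbf U_{\widehat I}$ are compatible under $\Phi$, that is, $\Phi\circ T'_{i,e}=T'_{i,e}\circ\Phi$ and $\Phi\circ T''_{i,e}=T''_{i,e}\circ\Phi$.
   Context: A Cartan datum $(I,\cdot)$ is a finite set $I$ with a $\mathbb Z$-valued symmetric bilinear form $\cdot$ on $\mathbb Z[I]$ such that $i\cdot i\in\{2,4,6,\dots\}$ and $2\frac{i\cdot j}{i\cdot i}\in\{0,-1,-2,\dots\}$ for $i\neq j$ in $I$. Fix $i_+,i_-\in I$ with $i_+\cdot i_+=i_-\cdot i_-=-2\,i_+\cdot i_-$. Put $i_0=i_++i_-$, $\widehat I=(I\setminus\{i_+,i_-\})\cup\{i_0\}$; with the restricted form $(\widehat I,\cdot)$ is a Cartan datum (the edge contraction). A root datum of type $(I,\cdot)$: finitely generated free abelian groups $Y,X$, a perfect pairing $\langle\,,\rangle:Y\times X\to\mathbb Z$, embeddings $I\hookrightarrow Y$, $i\mapsto i$, $I\hookrightarrow X$, $i\mapsto i'$, with $\langle i,j'\rangle=2\frac{i\cdot j}{i\cdot i}$. Fix one; the same $Y,X$ with $i_0\mapsto i_++i_-\in Y$, $i_0'=i_+'+i_-'$ is a root datum of type $(\widehat I,\cdot)$. Let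 $v$ be an indeterminate, $v_i=v^{i\cdot i/2}$, $[n]_i=\frac{v_i^n-v_i^{-n}}{v_i-v_i^{-1}}$, $x_i^{(n)}=x_i^n/[n]_i^!$. $\mathbf U_I$ is the $\mathbb Q(v)$-algebra with generators $E_i,F_i$ ($i\in I$), $K_\mu$ ($\mu\in Y$) and relations $K_0=1$, $K_\mu K_{\mu'}=K_{\mu+\mu'}$, $K_\mu E_i=v^{\langle\mu,i'\rangle}E_iK_\mu$, $K_\mu F_i=v^{-\langle\mu,i'\rangle}F_iK_\mu$, $E_iF_j-F_jE_i=\delta_{ij}\frac{\tilde K_i-\tilde K_i^{-1}}{v_i-v_i^{-1}}$ with $\tilde K_i=K_{\frac{i\cdot i}{2}i}$ (so $\tilde K_{ei}=\tilde K_i^e$), and $\sum_{r+s=1-\langle i,j'\rangle}(-1)^rx_i^{(s)}x_jx_i^{(r)}=0$ for $x=E,F$, $i\neq j$. $\mathbf U_{\widehat I}$ is the analogue for $\widehat I$; generators $\widehat E_i,\widehat F_i,\widehat K_\mu$. $\mathbf U_{I,\widehat I}$ is the subalgebra of $\mathbf U_I$ generated by $E_i,F_i$ ($i\in\widehat I\setminus\{i_0\}$), $K_\mu$ ($\mu\in Y$), $E_{i_+}E_{i_-}$, $E_{i_-}E_{i_+}$, $F_{i_-}F_{i_+}$, $F_{i_+}F_{i_-}$; $\mathcal J_{I,\widehat I}$ is its two-sided ideal generated by $E_{i_-}E_{i_+}$ and $F_{i_+}F_{i_-}$. $\Phi:\mathbf U_{\widehat I}\to\mathbf U_{I,\widehat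 I}/\mathcal J_{I,\widehat I}$ is the surjective algebra homomorphism with $\widehat E_i\mapsto E_i$, $\widehat F_i\mapsto F_i$ ($i\neq i_0$), $\widehat K_\mu\mapsto K_\mu$, $\widehat E_{i_0}\mapsto E_{i_+}E_{i_-}$, $\widehat F_{i_0}\mapsto F_{i_-}F_{i_+}$ (classes modulo $\mathcal J_{I,\widehat I}$). Lusztig's symmetries (for $\mathbf U_I$, $i\in I$; same formulas for $\mathbf U_{\widehat I}$, $i\in\widehat I$): with $s_i(\mu)=\mu-\langle\mu,i'\rangle i$, $T'_{i,e}(K_\mu)=T''_{i,e}(K_\mu)=K_{s_i(\mu)}$; $T'_{i,e}(E_i)=-\tilde K_{ei}F_i$, $T'_{i,e}(F_i)=-E_i\tilde K_{-ei}$, $T''_{i,e}(E_i)=-F_i\tilde K_{ei}$, $T''_{i,e}(F_i)=-\tilde K_{-ei}E_i$; and for $j\neq i$, with sums over $r+s=-\langle i,j'\rangle$, $T'_{i,e}(E_j)=\sum(-1)^rv_i^{er}E_i^{(r)}E_jE_i^{(s)}$, $T'_{i,e}(F_j)=\sum(-1)^rv_i^{-er}F_i^{(s)}F_jF_i^{(r)}$, $T''_{i,e}(E_j)=\sum(-1)^rv_i^{-er}E_i^{(s)}E_jE_i^{(r)}$, $T''_{i,e}(F_j)=\sum(-1)^rv_i^{er}F_i^{(r)}F_jF_i^{(s)}$. Operators on $\mathbf U_{I,\widehat I}/\mathcal J_{I,\widehat I}$: for $j\in\widehat I\setminus\{i_0\}$, $T'_{j,e},T''_{j,e}$ are induced from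 those of $\mathbf U_I$. For $i_0$: $\tilde T'_{i_0,e}=T'_{i_+,e}T'_{i_-,e}T'_{i_+,e}$ and $\tilde T''_{i_0,e}=T''_{i_+,e}T''_{i_-,e}T''_{i_+,e}$ preserve $\mathbf U_{I,\widehat I}$ and $\mathcal J_{I,\widehat I}$ and so act on the quotient; $T'_{i_0,e}=\chi'_{i_0,e}\tilde T'_{i_0,e}$ and $T''_{i_0,e}=\chi''_{i_0,e}\tilde T''_{i_0,e}$, where $\chi'_{i_0,e},\chi''_{i_0,e}$ are the automorphisms of the quotient induced by the following automorphisms of $\mathbf U_{I,\widehat I}$, both fixing all $K_\mu$. $\chi'_{i_0,e}$ multiplies $E_{i_+}E_{i_-}$ and $E_{i_-}E_{i_+}$ by $-v_{i_0}^{-e}$, multiplies $F_{i_-}F_{i_+}$ and $F_{i_+}F_{i_-}$ by $-v_{i_0}^{e}$, and for $j\in\widehat I\setminus\{i_0\}$: if $\langle i_-,j'\rangle=0$ then $E_j\mapsto(-v_{i_0}^{-e})^{\langle i_0,j'\rangle}E_j$, $F_j\mapsto(-v_{i_0}^{-e})^{-\langle i_0,j'\rangle}F_j$; otherwise $E_j,F_j$ are fixed. $\chi''_{i_0,e}$ multiplies $E_{i_+}E_{i_-},E_{i_-}E_{i_+}$ by $-v_{i_0}^{e}$ and $F_{i_-}F_{i_+},F_{i_+}F_{i_-}$ by $-v_{i_0}^{-e}$, and: if $\langle i_+,j'\rangle=0$ then $E_j\mapsto(-v_{i_0}^{e})^{\langle i_0,j'\rangle}E_j$, $F_j\mapsto(-v_{i_0}^{e})^{-\langle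 i_0,j'\rangle}F_j$; otherwise $E_j,F_j$ are fixed. *)

theory Defs
  imports
    Complex_Main
    "HOL-Library.Poly_Mapping"
    "HOL-Computational_Algebra.Polynomial"
    "HOL-Computational_Algebra.Fraction_Field"
    "HOL-Algebra.Module"
    "HOL-Algebra.QuotRing"
    "HOL-Algebra.Generated_Rings"
begin

section \<open>Root data\<close>

definition zmul :: "int \<Rightarrow> 'a::ab_group_add \<Rightarrow> 'a" where
  "zmul n y = (\<Sum>k<nat n. y) - (\<Sum>k<nat (- n). y)"

definition fg_free :: "'a::ab_group_add itself \<Rightarrow> bool" where
  "fg_free _ \<longleftrightarrow> (\<exists>B::'a set. finite B \<and>
     (\<forall>y. \<exists>!c. (\<forall>b. b \<notin> B \<longrightarrow> c b = 0) \<and> y = (\<Sum>b\<in>B. zmul (c b) b)))"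

text \<open>The symmetric bilinear form on \<open>\<int>[I]\<close> is given by its values on the basis \<open>I = idx D\<close>.
  The lattices \<open>Y\<close> and \<open>X\<close> are the types \<open>'y\<close> and \<open>'x\<close>; the maps \<open>coroot D\<close> and \<open>root D\<close> are
  \<open>i \<mapsto> i \<in> Y\<close> and \<open>i \<mapsto> i' \<in> X\<close>. Only their values on \<open>idx D\<close> matter.\<close>

record ('i, 'y, 'x) root_datum =
  idx :: "'i set"
  form :: "'i \<Rightarrow> 'i \<Rightarrow> int"
  pairing :: "'y \<Rightarrow> 'x \<Rightarrow> int"
  coroot :: "'i \<Rightarrow> 'y"
  root :: "'i \<Rightarrow> 'x"

definition cartan_datum :: "'i set \<Rightarrow> ('i \<Rightarrow> 'i \<Rightarrow> int) \<Rightarrow> bool" where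
  "cartan_datum I c \<longleftrightarrow> finite I \<and>
     (\<forall>i\<in>I. \<forall>j\<in>I. c i j = c j i) \<and>
     (\<forall>i\<in>I. even (c i i) \<and> c i i > 0) \<and>
     (\<forall>i\<in>I. \<forall>j\<in>I. i \<noteq> j \<longrightarrow> c i i dvd 2 * c i j \<and> 2 * c i j div c i i \<le> 0)"

definition perfect_pairing :: "('y::ab_group_add \<Rightarrow> 'x::ab_group_add \<Rightarrow> int) \<Rightarrow> bool" where
  "perfect_pairing p \<longleftrightarrow>
     (\<forall>y. additive (p y)) \<and> (\<forall>x. additive (\<lambda>y. p y x)) \<and>
     (\<forall>f. additive f \<longrightarrow> (\<exists>!y. \<forall>x. f x = p y x)) \<and>
     (\<forall>f. additive f \<longrightarrow> (\<exists>!x. \<forall>y. f y = p y x))"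

definition is_root_datum :: "('i, 'y::ab_group_add, 'x::ab_group_add) root_datum \<Rightarrow> bool" where
  "is_root_datum D \<longleftrightarrow>
     cartan_datum (idx D) (form D) \<and>
     fg_free TYPE('y) \<and> fg_free TYPE('x) \<and> perfect_pairing (pairing D) \<and>
     inj_on (coroot D) (idx D) \<and> inj_on (root D) (idx D) \<and>
     (\<forall>i\<in>idx D. \<forall>j\<in>idx D.
        pairing D (coroot D i) (root D j) = 2 * form D i j div form D i i)"

abbreviation cart :: "('i, 'y, 'x) root_datum \<Rightarrow> 'i \<Rightarrow> 'i \<Rightarrow> int" where
  "cart D i j \<equiv> pairing D (coroot D i) (root D j)"

text \<open>Edge contraction. The index \<open>None\<close> stands for \<open>i\<^sub>0 = i\<^sub>+ + i\<^sub>-\<close> and \<open>Some j\<close> for an unchanged \<open>j\<close>.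
  An index is a sum of elements of \<open>I\<close>, listed by \<open>parts\<close>; the form, coroots and roots are
  obtained by additivity.\<close>

fun parts :: "'i \<Rightarrow> 'i \<Rightarrow> 'i option \<Rightarrow> 'i set" where
  "parts ip im None = {ip, im}"
| "parts ip im (Some j) = {j}"

definition contract ::
    "('i, 'y::ab_group_add, 'x::ab_group_add) root_datum \<Rightarrow> 'i \<Rightarrow> 'i \<Rightarrow> ('i option, 'y, 'x) root_datum"
  where
  "contract D ip im =
     \<lparr>idx = insert None (Some ` (idx D - {ip, im})),
      form = (\<lambda>x y. \<Sum>a\<in>parts ip im x. \<Sum>b\<in>parts ip im y. form D a b),
      pairing = pairing D,
      coroot = (\<lambda>x. \<Sum>a\<in>parts ip im x. coroot D a),
      root = (\<lambda>x. \<Sum>a\<in>parts ip im x. root D a)\<rparr>"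


section \<open>Quantum integers over \<open>\<rat>(v)\<close>\<close>

type_synonym qv = "rat poly fract"

definition vv :: qv where
  "vv = Fraction_Field.Fract [:0, 1:] 1"

definition vi :: "('i, 'y, 'x) root_datum \<Rightarrow> 'i \<Rightarrow> qv" where
  "vi D i = vv powi (form D i i div 2)"

definition qint :: "qv \<Rightarrow> nat \<Rightarrow> qv" where
  "qint q n = (q powi (int n) - q powi (- int n)) / (q - inverse q)"

definition qfact :: "qv \<Rightarrow> nat \<Rightarrow> qv" where
  "qfact q n = (\<Prod>k=1..n. qint q k)"


section \<open>Free algebras\<close>

text \<open>The free algebra on \<open>'g\<close> is the monoid algebra of the free monoid of words, written additively
  so that \<open>poly_mapping\<close> supplies the convolution product.\<close>

datatype 'g word = Word (letters: "'g list")

instantiation word :: (type) monoid_add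
begin

definition zero_word :: "'g word" where
  "zero_word = Word []"

definition plus_word :: "'g word \<Rightarrow> 'g word \<Rightarrow> 'g word" where
  "plus_word u w = Word (letters u @ letters w)"

instance
  by standard (simp_all add: zero_word_def plus_word_def)

end

datatype ('i, 'y) gen = GE 'i | GF 'i | GK 'y

type_synonym ('i, 'y) free = "('i, 'y) gen word \<Rightarrow>\<^sub>0 qv"

definition sc :: "qv \<Rightarrow> ('i, 'y) free" where
  "sc c = Poly_Mapping.single 0 c"

definition gE :: "'i \<Rightarrow> ('i, 'y) free" where
  "gE i = Poly_Mapping.single (Word [GE i]) 1"

definition gF :: "'i \<Rightarrow> ('i, 'y) free" where
  "gF i = Poly_Mapping.single (Word [GF i]) 1"

definition gK :: "'y \<Rightarrow> ('i, 'y) free" where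
  "gK \<mu> = Poly_Mapping.single (Word [GK \<mu>]) 1"

definition gens :: "'i set \<Rightarrow> ('i, 'y) gen set" where
  "gens I = GE ` I \<union> GF ` I \<union> range GK"

text \<open>The library record \<open>module\<close> (a ring with a scalar multiplication) serves to describe
  not necessarily commutative \<open>\<rat>(v)\<close>-algebras.\<close>

definition free_alg :: "'i set \<Rightarrow> (qv, ('i, 'y) free) module" where
  "free_alg I =
     \<lparr>carrier = {p. \<forall>w\<in>Poly_Mapping.keys p. set (letters w) \<subseteq> gens I},
      monoid.mult = (*), one = 1, zero = 0, add = (+),
      smult = (\<lambda>c p. sc c * p)\<rparr>"

definition quot_alg :: "('k, 'a) module \<Rightarrow> 'a set \<Rightarrow> ('k, 'a set) module" where
  "quot_alg A J =
     \<lparr>carrier = carrier (A Quot J), monoid.mult = monoid.mult (A Quot J),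
      one = monoid.one (A Quot J), zero = ring.zero (A Quot J), add = ring.add (A Quot J),
      smult = (\<lambda>c C. \<Union>x\<in>C. J +>\<^bsub>A\<^esub> (c \<odot>\<^bsub>A\<^esub> x))\<rparr>"

definition subalg_gen :: "('k, 'a) module \<Rightarrow> 'a set \<Rightarrow> ('k, 'a) module" where
  "subalg_gen A S =
     A\<lparr>carrier := generate_ring A (range (\<lambda>c. c \<odot>\<^bsub>A\<^esub> \<one>\<^bsub>A\<^esub>) \<union> S)\<rparr>"

definition alg_hom :: "('k, 'a) module \<Rightarrow> ('k, 'b) module \<Rightarrow> ('a \<Rightarrow> 'b) set" where
  "alg_hom A B = {f. f \<in> ring_hom A B \<and>
     (\<forall>c. \<forall>x\<in>carrier A. f (c \<odot>\<^bsub>A\<^esub> x) = c \<odot>\<^bsub>B\<^esub> f x)}"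

text \<open>The map induced on a quotient by \<open>f\<close>; the image below is a singleton whenever \<open>f\<close> descends.\<close>

definition induced :: "('k, 'a) module \<Rightarrow> 'a set \<Rightarrow> ('a \<Rightarrow> 'a) \<Rightarrow> 'a set \<Rightarrow> 'a set" where
  "induced A J f C = the_elem ((\<lambda>x. J +>\<^bsub>A\<^esub> f x) ` C)"


section \<open>The quantum group\<close>

definition Kt :: "('i, 'y::ab_group_add, 'x) root_datum \<Rightarrow> int \<Rightarrow> 'i \<Rightarrow> ('i, 'y) free" where
  "Kt D e i = gK (zmul (e * (form D i i div 2)) (coroot D i))"

definition dpow :: "('i, 'y, 'x) root_datum \<Rightarrow> 'i \<Rightarrow> ('i, 'y) free \<Rightarrow> nat \<Rightarrow> ('i, 'y) free" where
  "dpow D i x n = sc (inverse (qfact (vi D i) n)) * x ^ n"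

text \<open>\<open>lsum D i q x y n\<close> is the sum of \<open>(-1)\<^sup>r q\<^sup>r x\<^sup>(\<^sup>r\<^sup>) y x\<^sup>(\<^sup>s\<^sup>)\<close> over \<open>r + s = n\<close>, and
  \<open>rsum D i q x y n\<close> that of \<open>(-1)\<^sup>r q\<^sup>r x\<^sup>(\<^sup>s\<^sup>) y x\<^sup>(\<^sup>r\<^sup>)\<close>; divided powers are with respect to \<open>v\<^sub>i\<close>.\<close>

definition lsum ::
    "('i, 'y, 'x) root_datum \<Rightarrow> 'i \<Rightarrow> qv \<Rightarrow> ('i, 'y) free \<Rightarrow> ('i, 'y) free \<Rightarrow> nat \<Rightarrow> ('i, 'y) free" where
  "lsum D i q x y n = (\<Sum>r\<le>n. sc ((-1) ^ r * q ^ r) * dpow D i x r * y * dpow D i x (n - r))"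

definition rsum ::
    "('i, 'y, 'x) root_datum \<Rightarrow> 'i \<Rightarrow> qv \<Rightarrow> ('i, 'y) free \<Rightarrow> ('i, 'y) free \<Rightarrow> nat \<Rightarrow> ('i, 'y) free" where
  "rsum D i q x y n = (\<Sum>r\<le>n. sc ((-1) ^ r * q ^ r) * dpow D i x (n - r) * y * dpow D i x r)"

definition U_rels :: "('i, 'y::ab_group_add, 'x) root_datum \<Rightarrow> ('i, 'y) free set" where
  "U_rels D =
     {gK 0 - 1}
     \<union> {gK \<mu> * gK \<nu> - gK (\<mu> + \<nu>) | \<mu> \<nu>. True}
     \<union> {gK \<mu> * gE i - sc (vv powi pairing D \<mu> (root D i)) * gE i * gK \<mu> | \<mu> i. i \<in> idx D}
     \<union> {gK \<mu> * gF i - sc (vv powi (- pairing D \<mu> (root D i))) * gF i * gK \<mu> | \<mu> i. i \<in> idx D}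
     \<union> {gE i * gF j - gF j * gE i
          - (if i = j then sc (inverse (vi D i - inverse (vi D i))) * (Kt D 1 i - Kt D (-1) i) else 0)
        | i j. i \<in> idx D \<and> j \<in> idx D}
     \<union> {rsum D i 1 (gE i) (gE j) (nat (1 - cart D i j)) | i j. i \<in> idx D \<and> j \<in> idx D \<and> i \<noteq> j}
     \<union> {rsum D i 1 (gF i) (gF j) (nat (1 - cart D i j)) | i j. i \<in> idx D \<and> j \<in> idx D \<and> i \<noteq> j}"

definition U_ideal :: "('i, 'y::ab_group_add, 'x) root_datum \<Rightarrow> ('i, 'y) free set" where
  "U_ideal D = Idl\<^bsub>free_alg (idx D)\<^esub> (U_rels D)"

definition U :: "('i, 'y::ab_group_add, 'x) root_datum \<Rightarrow> (qv, ('i, 'y) free set) module" where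
  "U D = quot_alg (free_alg (idx D)) (U_ideal D)"

definition cls :: "('i, 'y::ab_group_add, 'x) root_datum \<Rightarrow> ('i, 'y) free \<Rightarrow> ('i, 'y) free set" where
  "cls D p = U_ideal D +>\<^bsub>free_alg (idx D)\<^esub> p"


section \<open>Lusztig's symmetries\<close>

definition refl :: "('i, 'y::ab_group_add, 'x) root_datum \<Rightarrow> 'i \<Rightarrow> 'y \<Rightarrow> 'y" where
  "refl D i \<mu> = \<mu> - zmul (pairing D \<mu> (root D i)) (coroot D i)"

text \<open>\<open>is_T1 D e i T\<close> says that \<open>T\<close> is \<open>T'\<^sub>i\<^sub>,\<^sub>e\<close>, and \<open>is_T2 D e i T\<close> that it is \<open>T''\<^sub>i\<^sub>,\<^sub>e\<close>. The
  conditions fix \<open>T\<close> on the carrier of \<open>U D\<close>, which is generated by the listed elements.\<close>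

definition is_T1 ::
    "('i, 'y::ab_group_add, 'x) root_datum \<Rightarrow> int \<Rightarrow> 'i
      \<Rightarrow> (('i, 'y) free set \<Rightarrow> ('i, 'y) free set) \<Rightarrow> bool" where
  "is_T1 D e i T \<longleftrightarrow> T \<in> alg_hom (U D) (U D) \<and>
     (\<forall>\<mu>. T (cls D (gK \<mu>)) = cls D (gK (refl D i \<mu>))) \<and>
     T (cls D (gE i)) = cls D (- (Kt D e i * gF i)) \<and>
     T (cls D (gF i)) = cls D (- (gE i * Kt D (- e) i)) \<and>
     (\<forall>j\<in>idx D - {i}.
        T (cls D (gE j)) = cls D (lsum D i (vi D i powi e) (gE i) (gE j) (nat (- cart D i j))) \<and>
        T (cls D (gF j)) = cls D (rsum D i (vi D i powi (- e)) (gF i) (gF j) (nat (- cart D i j))))"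

definition is_T2 ::
    "('i, 'y::ab_group_add, 'x) root_datum \<Rightarrow> int \<Rightarrow> 'i
      \<Rightarrow> (('i, 'y) free set \<Rightarrow> ('i, 'y) free set) \<Rightarrow> bool" where
  "is_T2 D e i T \<longleftrightarrow> T \<in> alg_hom (U D) (U D) \<and>
     (\<forall>\<mu>. T (cls D (gK \<mu>)) = cls D (gK (refl D i \<mu>))) \<and>
     T (cls D (gE i)) = cls D (- (gF i * Kt D e i)) \<and>
     T (cls D (gF i)) = cls D (- (Kt D (- e) i * gE i)) \<and>
     (\<forall>j\<in>idx D - {i}.
        T (cls D (gE j)) = cls D (rsum D i (vi D i powi (- e)) (gE i) (gE j) (nat (- cart D i j))) \<and>
        T (cls D (gF j)) = cls D (lsum D i (vi D i powi e) (gF i) (gF j) (nat (- cart D i j))))"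


section \<open>The subquotient attached to the contracted edge\<close>

definition U_sub ::
    "('i, 'y::ab_group_add, 'x) root_datum \<Rightarrow> 'i \<Rightarrow> 'i \<Rightarrow> (qv, ('i, 'y) free set) module" where
  "U_sub D ip im = subalg_gen (U D)
     (cls D ` (gE ` (idx D - {ip, im}) \<union> gF ` (idx D - {ip, im}) \<union> range gK
        \<union> {gE ip * gE im, gE im * gE ip, gF im * gF ip, gF ip * gF im}))"

definition J_ideal ::
    "('i, 'y::ab_group_add, 'x) root_datum \<Rightarrow> 'i \<Rightarrow> 'i \<Rightarrow> ('i, 'y) free set set" where
  "J_ideal D ip im = Idl\<^bsub>U_sub D ip im\<^esub> {cls D (gE im * gE ip), cls D (gF ip * gF im)}"

definition U_quot ::
    "('i, 'y::ab_group_add, 'x) root_datum \<Rightarrow> 'i \<Rightarrow> 'i \<Rightarrow> (qv, ('i, 'y) free set set) module" where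
  "U_quot D ip im = quot_alg (U_sub D ip im) (J_ideal D ip im)"

text \<open>The class modulo \<open>J_ideal\<close>; only meaningful when \<open>cls D p\<close> lies in \<open>U_sub\<close>.\<close>

definition qcls ::
    "('i, 'y::ab_group_add, 'x) root_datum \<Rightarrow> 'i \<Rightarrow> 'i \<Rightarrow> ('i, 'y) free \<Rightarrow> ('i, 'y) free set set" where
  "qcls D ip im p = J_ideal D ip im +>\<^bsub>U_sub D ip im\<^esub> cls D p"

definition is_Phi ::
    "('i, 'y::ab_group_add, 'x::ab_group_add) root_datum \<Rightarrow> 'i \<Rightarrow> 'i
      \<Rightarrow> (('i option, 'y) free set \<Rightarrow> ('i, 'y) free set set) \<Rightarrow> bool" where
  "is_Phi D ip im \<Phi> \<longleftrightarrow> (let H = contract D ip im in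
     \<Phi> \<in> alg_hom (U H) (U_quot D ip im) \<and>
     (\<forall>j\<in>idx D - {ip, im}.
        \<Phi> (cls H (gE (Some j))) = qcls D ip im (gE j) \<and>
        \<Phi> (cls H (gF (Some j))) = qcls D ip im (gF j)) \<and>
     (\<forall>\<mu>. \<Phi> (cls H (gK \<mu>)) = qcls D ip im (gK \<mu>)) \<and>
     \<Phi> (cls H (gE None)) = qcls D ip im (gE ip * gE im) \<and>
     \<Phi> (cls H (gF None)) = qcls D ip im (gF im * gF ip))"

text \<open>The common shape of \<open>\<chi>'\<close> and \<open>\<chi>''\<close>: with \<open>q = -v\<^sub>0\<^sup>\<mp>\<^sup>e\<close> one has \<open>q\<^sup>-\<^sup>1 = -v\<^sub>0\<^sup>\<plusminus>\<^sup>e\<close>; the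
  vertex \<open>k\<close> decides which \<open>E\<^sub>j, F\<^sub>j\<close> are rescaled.\<close>

definition is_chi ::
    "('i, 'y::ab_group_add, 'x::ab_group_add) root_datum \<Rightarrow> 'i \<Rightarrow> 'i \<Rightarrow> 'i \<Rightarrow> qv
      \<Rightarrow> (('i, 'y) free set \<Rightarrow> ('i, 'y) free set) \<Rightarrow> bool" where
  "is_chi D ip im k q \<chi> \<longleftrightarrow>
     \<chi> \<in> alg_hom (U_sub D ip im) (U_sub D ip im) \<and>
     (\<forall>\<mu>. \<chi> (cls D (gK \<mu>)) = cls D (gK \<mu>)) \<and>
     \<chi> (cls D (gE ip * gE im)) = cls D (sc q * (gE ip * gE im)) \<and>
     \<chi> (cls D (gE im * gE ip)) = cls D (sc q * (gE im * gE ip)) \<and>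
     \<chi> (cls D (gF im * gF ip)) = cls D (sc (inverse q) * (gF im * gF ip)) \<and>
     \<chi> (cls D (gF ip * gF im)) = cls D (sc (inverse q) * (gF ip * gF im)) \<and>
     (\<forall>j\<in>idx D - {ip, im}.
        let m = (if cart D k j = 0
                 then pairing D (coroot (contract D ip im) None) (root D j) else 0)
        in \<chi> (cls D (gE j)) = cls D (sc (q powi m) * gE j) \<and>
           \<chi> (cls D (gF j)) = cls D (sc (q powi (- m)) * gF j))"

definition is_chi1 ::
    "('i, 'y::ab_group_add, 'x::ab_group_add) root_datum \<Rightarrow> 'i \<Rightarrow> 'i \<Rightarrow> int
      \<Rightarrow> (('i, 'y) free set \<Rightarrow> ('i, 'y) free set) \<Rightarrow> bool" where
  "is_chi1 D ip im e = is_chi D ip im im (- (vi (contract D ip im) None powi (- e)))"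

definition is_chi2 ::
    "('i, 'y::ab_group_add, 'x::ab_group_add) root_datum \<Rightarrow> 'i \<Rightarrow> 'i \<Rightarrow> int
      \<Rightarrow> (('i, 'y) free set \<Rightarrow> ('i, 'y) free set) \<Rightarrow> bool" where
  "is_chi2 D ip im e = is_chi D ip im ip (- (vi (contract D ip im) None powi e))"

text \<open>The operators on the subquotient obtained from a family \<open>T\<close> of operators on \<open>U D\<close> and from
  the rescaling \<open>\<chi>\<close>.\<close>

fun quot_op ::
    "('i, 'y::ab_group_add, 'x::ab_group_add) root_datum \<Rightarrow> 'i \<Rightarrow> 'i
      \<Rightarrow> ('i \<Rightarrow> ('i, 'y) free set \<Rightarrow> ('i, 'y) free set) \<Rightarrow> (('i, 'y) free set \<Rightarrow> ('i, 'y) free set)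
      \<Rightarrow> 'i option \<Rightarrow> ('i, 'y) free set set \<Rightarrow> ('i, 'y) free set set" where
  "quot_op D ip im T \<chi> (Some j) = induced (U_sub D ip im) (J_ideal D ip im) (T j)"
| "quot_op D ip im T \<chi> None =
     induced (U_sub D ip im) (J_ideal D ip im) \<chi>
     \<circ> induced (U_sub D ip im) (J_ideal D ip im) (T ip \<circ> T im \<circ> T ip)"

end

theory Submission
  imports Defs
begin

text \<open>
  Both composites in the theorem are algebra homomorphisms on the quantum group of the contracted datum,
  so they agree once they agree on the generators. Write \<open>a\<close>, \<open>b\<close> for the two ends of the edge
  and \<open>E\<^sub>i\<close>, \<open>F\<^sub>i\<close>, \<open>K\<^sub>\<mu>\<close> for the generators.

  For a vertex \<open>j\<close> away from the edge, \<open>j\<close> is orthogonal to \<open>a\<close> or to \<open>b\<close>, so \<open>E\<^sub>j\<close> commutes with one of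
  the factors of \<open>E\<^sub>aE\<^sub>b\<close>. The operator at \<open>j\<close> sends the other factor to an adjoint sum in powers of
  \<open>E\<^sub>j\<close>, and the commuting factor can be moved inside that sum. The result is the adjoint sum applied to
  \<open>E\<^sub>aE\<^sub>b\<close> as a single letter, which is the formula for the contracted datum
  (\<open>T_pair_up\<close>, \<open>T_pair_down\<close>). The same formula for the product \<open>E\<^sub>bE\<^sub>a\<close> shows that the ideal is preserved.

  At the contracted vertex the operator is a triple composite \<open>T\<^sub>aT\<^sub>bT\<^sub>a\<close>, followed by a rescaling. The rank two identity
  \<open>T\<^sub>aT\<^sub>b(E\<^sub>a) = E\<^sub>b\<close> (\<open>edge_up\<close>, \<open>edge_down\<close>) makes it exchange \<open>E\<^sub>a\<close> with \<open>F\<^sub>b\<close> and \<open>E\<^sub>b\<close> with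
  \<open>F\<^sub>a\<close> up to sign and torus elements, which settles the generators attached to the contracted vertex.
  Let \<open>j\<close> be a vertex orthogonal to \<open>b\<close>, let \<open>p = v\<^sub>a\<close> raised to the power \<open>e\<close>, and let
  \<open>X = T\<^sub>b(E\<^sub>a) = E\<^sub>aE\<^sub>b - p E\<^sub>bE\<^sub>a\<close>. Then \<open>T\<^sub>bT\<^sub>a(E\<^sub>j)\<close> is the adjoint sum of \<open>X\<close> on \<open>E\<^sub>j\<close>, and since
  \<open>T\<^sub>a(X) = E\<^sub>b\<close>, applying \<open>T\<^sub>a\<close> gives the adjoint sum of \<open>E\<^sub>b\<close> on the adjoint sum of \<open>E\<^sub>a\<close> on \<open>E\<^sub>j\<close>.
  The main computation, \<open>tad_tad\<close>, says that this is again the adjoint sum of \<open>X\<close> on \<open>E\<^sub>j\<close>.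
  If \<open>j\<close> is orthogonal to \<open>a\<close> instead, \<open>T\<^sub>aT\<^sub>bT\<^sub>a(E\<^sub>j)\<close> is directly the adjoint sum of
  \<open>E\<^sub>bE\<^sub>a - p E\<^sub>aE\<^sub>b\<close>. Modulo the ideal, \<open>E\<^sub>bE\<^sub>a\<close> vanishes and a multiple of \<open>E\<^sub>aE\<^sub>b\<close> remains; the
  rescaling removes the scalars that are left over.

  Exchanging \<open>E\<close> with \<open>F\<close> and \<open>K\<^sub>\<mu>\<close> with its inverse turns the operators \<open>T'\<close> into the operators \<open>T''\<close>
  with the same \<open>e\<close>, and it turns the contracted product \<open>E\<^sub>aE\<^sub>b\<close> into \<open>F\<^sub>aF\<^sub>b\<close>, so the ends of the edge
  have to be exchanged as well. Every statement is therefore proved for a flag \<open>s\<close> that selects which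
  generators play the part of \<open>E\<close>, and the theorem is the conjunction of the cases \<open>s = True\<close> and
  \<open>s = False\<close> of \<open>compatible\<close>.

  All computations take place in the free algebra, where equations between noncommutative polynomials can be
  simplified directly; the relation \<open>rel\<close> records that two polynomials have the same image in an algebra.
\<close>

section \<open>Quantum integers at a parameter of infinite order\<close>

text \<open>This is what makes the positive quantum integers at \<open>q\<close> invertible.\<close>

definition aperiodic :: "qv \<Rightarrow> bool" where
  "aperiodic q \<longleftrightarrow> q \<noteq> 0 \<and> (\<forall>n>0. q ^ n \<noteq> 1)"

lemma aperiodic_powi:
  assumes "aperiodic q" "d \<noteq> 0" shows "aperiodic (q powi d)"
proof -
  have q: "q \<noteq> 0" using assms by (simp add: aperiodic_def)
  have "(q powi d) ^ n \<noteq> 1" if "n > 0" for n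
  proof
    assume *: "(q powi d) ^ n = 1"
    have "q ^ (nat \<bar>d\<bar> * n) = 1"
    proof (cases "d \<ge> 0")
      case True
      then show ?thesis using * by (simp add: power_int_def power_mult)
    next
      case False
      then show ?thesis using * q by (simp add: power_int_def power_mult power_inverse)
    qed
    then show False using assms that by (simp add: aperiodic_def)
  qed
  then show ?thesis using q by (simp add: aperiodic_def)
qed

lemma vv_power: "vv ^ n = Fraction_Field.Fract ([:0, 1:] ^ n) 1"
  by (induction n) (simp_all add: vv_def One_fract_def)

lemma aperiodic_vv: "aperiodic vv"
proof -
  have "vv ^ n \<noteq> 1" if "n > 0" for n
  proof
    assume "vv ^ n = 1"
    then have "[:0, 1:] ^ n = (1 :: rat poly)"
      by (simp add: vv_power One_fract_def eq_fract)
    then have "degree ([:0, 1::rat:] ^ n) = 0" by simp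
    then show False using that by (simp add: degree_power_eq)
  qed
  moreover have "vv \<noteq> 0" by (simp add: vv_def Zero_fract_def eq_fract)
  ultimately show ?thesis by (simp add: aperiodic_def)
qed

lemma aperiodic_nonzero: "aperiodic q \<Longrightarrow> q \<noteq> 0"
  by (simp add: aperiodic_def)

lemma aperiodic_diff:
  assumes "aperiodic q" "n > 0" shows "q ^ n - inverse (q ^ n) \<noteq> 0"
proof
  assume "q ^ n - inverse (q ^ n) = 0"
  then have "q ^ n * q ^ n = 1"
    using aperiodic_nonzero[OF assms(1)] by (simp add: field_simps)
  then have "q ^ (n + n) = 1" by (simp add: power_add)
  then show False using assms by (auto simp: aperiodic_def)
qed

lemma qint_eq: "qint q n = (q ^ n - inverse (q ^ n)) / (q - inverse q)"
  by (simp add: qint_def power_int_minus)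

lemma qint_nonzero:
  assumes "aperiodic q" "n > 0" shows "qint q n \<noteq> 0"
  using aperiodic_diff[OF assms] aperiodic_diff[OF assms(1), of 1] by (simp add: qint_eq)

text \<open>The addition formula for quantum integers. Splitting \<open>m\<close> as \<open>r + (m - r)\<close> in this way is the source of the
  Pascal-type recursions for the coefficients of adjoint sums.\<close>

lemma qint_split:
  assumes "aperiodic q" "r \<le> m"
  shows "qint q m = q ^ (m - r) * qint q r + inverse (q ^ r) * qint q (m - r)"
proof -
  obtain k where m: "m = r + k" using assms(2) by (metis le_add_diff_inverse)
  have *: "q - inverse q \<noteq> 0" using aperiodic_diff[OF assms(1), of 1] by simp
  show ?thesis using aperiodic_nonzero[OF assms(1)] 
    by (simp add: m qint_eq power_add add_divide_distrib[symmetric] right_diff_distrib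
        diff_divide_distrib)
qed

lemma qint_one: "aperiodic q \<Longrightarrow> qint q (Suc 0) = 1"
  using aperiodic_diff[of q 1] by (simp add: qint_eq)

lemma qint_two: "aperiodic q \<Longrightarrow> qint q (Suc (Suc 0)) = q + inverse q"
  using qint_split[of q 1 2] by (simp add: qint_one numeral_2_eq_2)

lemma qint_inverse: "qint (inverse q) n = qint q n"
proof -
  show ?thesis unfolding qint_eq inverse_inverse_eq power_inverse by (metis minus_diff_eq minus_divide_divide)
qed

lemma qfact_0 [simp]: "qfact q 0 = 1"
  by (simp add: qfact_def)

lemma qfact_Suc: "qfact q (Suc n) = qint q (Suc n) * qfact q n"
  by (simp add: qfact_def prod.nat_ivl_Suc' mult.commute)

lemma qfact_nonzero: "aperiodic q \<Longrightarrow> qfact q n \<noteq> 0"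
  by (simp add: qfact_def qint_nonzero)

lemma qfact_inverse: "qfact (inverse q) n = qfact q n"
  by (simp add: qfact_def qint_inverse)

text \<open>Up to the factor \<open>qfact q m\<close> this is the vanishing of an alternating sum of Gauss binomial coefficients. After
  multiplication by \<open>qint q m\<close>, written as in \<open>qint_split\<close>, the sum telescopes.\<close>

lemma gauss_alternating_sum:
  assumes q: "aperiodic q" and m: "m > 0"
  shows "(\<Sum>r\<le>m. (- (q powi (1 - int m))) ^ r / (qfact q r * qfact q (m - r))) = 0" (is "?S = 0")
proof -
  obtain k where k: "m = Suc k" using m by (cases m) auto
  have q0: "q \<noteq> 0" using q by (rule aperiodic_nonzero)
  let ?c = "inverse (q ^ k)"
  have c: "q powi (1 - int m) = ?c" by (simp add: k power_int_minus)
  let ?g = "\<lambda>r. (- ?c) ^ r * inverse (q ^ r) / (qfact q r * qfact q (k - r))"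
  have fs: "qfact q n \<noteq> 0" "qint q (Suc n) \<noteq> 0" for n using q by (simp_all add: qfact_nonzero qint_nonzero)
  have cancelA: "a * u * (b / (u * f * g)) = a * b / (f * g)" 
    and cancelB: "a * u * (b / (f * (u * g))) = b * a / (f * g)" if "u \<noteq> 0" for a b f g u :: qv
    using that by simp_all
  have 1: "qint q m * ((- ?c) ^ r / (qfact q r * qfact q (m - r))) =
     (if r = 0 then 0 else - ?g (r - 1)) + (if r = m then 0 else ?g r)" if "r \<le> m" for r
  proof -
    have A: "q ^ (m - r) * qint q r * ((- ?c) ^ r / (qfact q r * qfact q (m - r))) =
      (if r = 0 then 0 else - ?g (r - 1))"
    proof (cases r)
      case 0 then show ?thesis by (simp add: qint_eq)
    next
      case (Suc l)
      have "k = (k - l) + l" using that k Suc by simp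
      then have "q ^ k = q ^ (k - l) * q ^ l" by (metis power_add)
      then have "q ^ (k - l) * ?c = inverse (q ^ l)" using q0 by (simp add: field_simps)
      then have "q ^ (k - l) * (- ?c) ^ Suc l = - ((- ?c) ^ l * inverse (q ^ l))" by simp
      then have "q ^ (k - l) * (- ?c) ^ Suc l / (qfact q l * qfact q (k - l)) = - ?g l" by simp
      then show ?thesis using cancelA[OF fs(2)[of l]] unfolding Suc k qfact_Suc by simp
    qed
    have B: "inverse (q ^ r) * qint q (m - r) * ((- ?c) ^ r / (qfact q r * qfact q (m - r))) =
      (if r = m then 0 else ?g r)"
    proof (cases "r = m")
      case True then show ?thesis by (simp add: qint_eq)
    next
      case False
      then have mr: "m - r = Suc (k - r)" using that k by simp
      show ?thesis unfolding mr qfact_Suc cancelB[OF fs(2)] using False by simp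
    qed
    show ?thesis unfolding A[symmetric] B[symmetric] qint_split[OF q that] by (simp add: algebra_simps)
  qed
  have "qint q m * ?S = (\<Sum>r\<le>m. (if r = 0 then 0 else - ?g (r - 1)) + (if r = m then 0 else ?g r))"
    unfolding sum_distrib_left c by (rule sum.cong) (use 1 in auto)
  also have "\<dots> = (\<Sum>r\<le>Suc k. if r = 0 then 0 else - ?g (r - 1)) + (\<Sum>r\<le>Suc k. if r = Suc k then 0 else ?g r)"
    by (simp add: sum.distrib k)
  also have "(\<Sum>r\<le>Suc k. if r = 0 then 0 else - ?g (r - 1)) = (\<Sum>r\<le>k. - ?g r)"
    by (subst sum.atMost_Suc_shift) simp
  also have "(\<Sum>r\<le>Suc k. if r = Suc k then 0 else ?g r) = (\<Sum>r\<le>k. ?g r)"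
    by (subst sum.atMost_Suc) (auto intro!: sum.cong)
  also have "(\<Sum>r\<le>k. - ?g r) + (\<Sum>r\<le>k. ?g r) = 0"
    by (simp add: sum_negf)
  finally show ?thesis using qint_nonzero[OF q m] by simp
qed

section \<open>Scalars and adjoint sums in the free algebra\<close>

text \<open>Scalars as an operator on polynomials. Collecting them on the left by \<open>star_simps\<close> terminates, which moving the
  central elements \<open>sc c\<close> around as ordinary factors does not.\<close>

definition star :: "qv \<Rightarrow> ('i, 'y) free \<Rightarrow> ('i, 'y) free"  (infixr \<open>\<star>\<close> 75) where
  "c \<star> p = sc c * p"

lemma sc_mult: "sc c * sc d = (sc (c * d) :: ('i, 'y) free)"
  by (simp add: sc_def mult_single)

text \<open>A scalar is a multiple of the empty word, which is the unit of the monoid of words.\<close>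

lemma sc_central: "p * sc c = sc c * (p :: ('i, 'y) free)"
proof (induction p rule: update_induct)
  case const
  then show ?case by simp
next
  case (update f a b)
  have "Poly_Mapping.update a b f = f + Poly_Mapping.single a b"
    by (rule poly_mapping_eqI) (use update in \<open>auto simp: lookup_update lookup_add lookup_single in_keys_iff when_def\<close>)
  then show ?case using update
    by (simp add: algebra_simps) (simp add: sc_def mult_single mult.commute)
qed

lemma star_mult_left: "(c \<star> p) * q = c \<star> (p * q)"
  by (simp add: star_def mult.assoc)

lemma star_mult_right: "p * (c \<star> q) = c \<star> (p * q)"
  by (metis star_def mult.assoc sc_central)

lemma star_star: "c \<star> d \<star> p = (c * d) \<star> p"
  by (simp add: star_def mult.assoc[symmetric] sc_mult)

lemma star_add: "c \<star> (p + q) = c \<star> p + c \<star> q"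
  and star_diff: "c \<star> (p - q) = c \<star> p - c \<star> q"
  by (simp_all add: star_def algebra_simps)

lemma add_star: "(c + d) \<star> p = c \<star> p + d \<star> p"
  and diff_star: "(c - d) \<star> p = c \<star> p - d \<star> p"
  by (simp_all add: star_def sc_def single_add single_diff algebra_simps)

lemma minus_star: "(- c) \<star> p = - (c \<star> p)"
  and star_minus: "c \<star> (- p) = - (c \<star> p)"
  by (simp_all add: star_def sc_def single_uminus)

lemma one_star [simp]: "1 \<star> p = p" and zero_star [simp]: "0 \<star> p = 0" and star_zero [simp]: "c \<star> 0 = 0"
  by (simp_all add: star_def sc_def)

lemma star_sum: "c \<star> (\<Sum>x\<in>S. g x) = (\<Sum>x\<in>S. c \<star> g x)"
  by (simp add: star_def sum_distrib_left)

lemma sum_star: "(\<Sum>x\<in>S. g x) \<star> p = (\<Sum>x\<in>S. g x \<star> p)"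
  by (induction S rule: infinite_finite_induct) (simp_all add: add_star)

lemma star_power: "(c \<star> p) ^ n = c ^ n \<star> p ^ n"
  by (induction n) (simp_all add: star_mult_left star_mult_right star_star mult.commute)

lemma sc_mult_star: "sc c * p = c \<star> p"
  by (simp add: star_def)

lemmas star_simps = star_mult_left star_mult_right star_star

text \<open>The adjoint sum with its divided powers collected into one coefficient. For a suitable \<open>c\<close> it is the \<open>n\<close>-th divided
  power of a \<open>q\<close>-commutator with \<open>x\<close>, applied to \<open>y\<close>. Both \<open>lsum\<close> and, by reversal of the order of
  summation, \<open>rsum\<close> are multiples of it, so that one calculus serves for both.\<close>

definition tad :: "qv \<Rightarrow> qv \<Rightarrow> ('i, 'y) free \<Rightarrow> ('i, 'y) free \<Rightarrow> nat \<Rightarrow> ('i, 'y) free" where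
  "tad q c x y n = (\<Sum>r\<le>n. ((- c) ^ r / (qfact q r * qfact q (n - r))) \<star> (x ^ r * y * x ^ (n - r)))"

lemma lsum_eq_tad: "lsum D i c x y n = tad (vi D i) c x y n"
  unfolding lsum_def tad_def dpow_def sc_mult_star
  by (intro sum.cong refl)
    (simp add: star_simps divide_inverse power_minus[of c] mult_ac)

lemma rsum_eq_tad:
  assumes "c \<noteq> 0"
  shows "rsum D i c x y n = (- c) ^ n \<star> tad (vi D i) (inverse c) x y n"
proof -
  have "rsum D i c x y n = (\<Sum>r\<le>n. sc ((-1) ^ (n - r) * c ^ (n - r)) * dpow D i x r * y * dpow D i x (n - r))"
    unfolding rsum_def by (subst sum.nat_diff_reindex[symmetric, of _ "Suc n", unfolded lessThan_Suc_atMost])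
      (auto intro!: sum.cong simp: lessThan_Suc_atMost)
  also have "\<dots> = (- c) ^ n \<star> tad (vi D i) (inverse c) x y n"
    unfolding tad_def dpow_def sc_mult_star star_sum
  proof (intro sum.cong refl)
    fix r assume "r \<in> {..n}"
    then have "(- c) ^ n = (- c) ^ (n - r) * (- c) ^ r" by (simp flip: power_add)
    then have "(- c) ^ n * (- inverse c) ^ r = (- c) ^ (n - r)"
      using assms by (simp add: power_mult_distrib[symmetric] mult.assoc)
    then have coeff: "(- 1) ^ (n - r) * c ^ (n - r) = (- c) ^ n * (- inverse c) ^ r"
      by (metis power_minus)
    have "(a \<star> b \<star> u) * y * (d \<star> w) = (a * (b * d)) \<star> (u * y * w)" for a b d and u w :: "('a, 'b) free"
      by (simp add: star_simps mult_ac)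
    then show "(((- 1) ^ (n - r) * c ^ (n - r)) \<star> inverse (qfact (vi D i) r) \<star> x ^ r) * y *
         (inverse (qfact (vi D i) (n - r)) \<star> x ^ (n - r)) =
         (- c) ^ n \<star> ((- inverse c) ^ r / (qfact (vi D i) r * qfact (vi D i) (n - r))) \<star> (x ^ r * y * x ^ (n - r))"
      unfolding coeff star_star by (simp add: divide_inverse mult.assoc)
  qed
  finally show ?thesis .
qed

lemma tad_inverse: "tad (inverse q) c x y n = tad q c x y n"
  by (simp add: tad_def qfact_inverse)

lemma tad_star_left: "tad q c (d \<star> x) y n = d ^ n \<star> tad q c x y n"
  unfolding tad_def star_sum
  by (intro sum.cong refl)
    (auto simp: star_power star_simps mult_ac power_add[symmetric])

lemma tad_star_right: "tad q c x (d \<star> y) n = d \<star> tad q c x y n"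
  unfolding tad_def star_sum by (intro sum.cong refl) (simp add: star_simps mult_ac)

lemma tad_0 [simp]: "tad q c x y 0 = y"
  by (simp add: tad_def)

lemma tad_zero [simp]: "tad q c x 0 n = 0"
  by (simp add: tad_def)

lemma tad_1: "aperiodic q \<Longrightarrow> tad q c x y (Suc 0) = y * x - c \<star> (x * y)"
  by (simp add: tad_def qfact_Suc qint_one minus_star)

section \<open>Algebras over \<open>\<rat>(v)\<close>, their subalgebras and quotients\<close>

text \<open>The laws that link scalars with sums and products suffice for scalars to be treated as central elements, and they pass to
  quotients by ideals and to generated subalgebras.\<close>

definition qalg :: "(qv, 'a) module \<Rightarrow> bool" where
  "qalg A \<longleftrightarrow> ring A \<and>
     (\<forall>c. \<forall>x\<in>carrier A. c \<odot>\<^bsub>A\<^esub> x \<in> carrier A) \<and>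
     (\<forall>c. \<forall>x\<in>carrier A. \<forall>y\<in>carrier A. c \<odot>\<^bsub>A\<^esub> (x \<oplus>\<^bsub>A\<^esub> y) = c \<odot>\<^bsub>A\<^esub> x \<oplus>\<^bsub>A\<^esub> c \<odot>\<^bsub>A\<^esub> y) \<and>
     (\<forall>c. \<forall>x\<in>carrier A. \<forall>y\<in>carrier A. (c \<odot>\<^bsub>A\<^esub> x) \<otimes>\<^bsub>A\<^esub> y = c \<odot>\<^bsub>A\<^esub> (x \<otimes>\<^bsub>A\<^esub> y)) \<and>
     (\<forall>c. \<forall>x\<in>carrier A. \<forall>y\<in>carrier A. x \<otimes>\<^bsub>A\<^esub> (c \<odot>\<^bsub>A\<^esub> y) = c \<odot>\<^bsub>A\<^esub> (x \<otimes>\<^bsub>A\<^esub> y))"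

lemma qalg_ring: "qalg A \<Longrightarrow> ring A"
  by (simp add: qalg_def)

lemma qalg_smult_closed: "qalg A \<Longrightarrow> x \<in> carrier A \<Longrightarrow> c \<odot>\<^bsub>A\<^esub> x \<in> carrier A"
  by (simp add: qalg_def)

lemma qalg_smult_eq:
  assumes "qalg A" "x \<in> carrier A"
  shows "c \<odot>\<^bsub>A\<^esub> x = (c \<odot>\<^bsub>A\<^esub> \<one>\<^bsub>A\<^esub>) \<otimes>\<^bsub>A\<^esub> x"
proof -
  interpret ring A using assms(1) by (rule qalg_ring)
  show ?thesis using assms by (simp add: qalg_def)
qed

lemma qalg_ideal_smult:
  assumes A: "qalg A" and J: "ideal J A" and x: "x \<in> J"
  shows "c \<odot>\<^bsub>A\<^esub> x \<in> J"
proof -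
  interpret ideal J A by fact
  have "c \<odot>\<^bsub>A\<^esub> \<one>\<^bsub>A\<^esub> \<in> carrier A" using A by (simp add: qalg_smult_closed)
  then show ?thesis using qalg_smult_eq[OF A Icarr[OF x]] I_l_closed[OF x] by simp
qed

lemma qalg_smult_mult:
  assumes "qalg A" "x \<in> carrier A" "y \<in> carrier A"
  shows "(c \<odot>\<^bsub>A\<^esub> x) \<otimes>\<^bsub>A\<^esub> y = c \<odot>\<^bsub>A\<^esub> (x \<otimes>\<^bsub>A\<^esub> y)" "x \<otimes>\<^bsub>A\<^esub> (c \<odot>\<^bsub>A\<^esub> y) = c \<odot>\<^bsub>A\<^esub> (x \<otimes>\<^bsub>A\<^esub> y)"
    "c \<odot>\<^bsub>A\<^esub> (x \<oplus>\<^bsub>A\<^esub> y) = c \<odot>\<^bsub>A\<^esub> x \<oplus>\<^bsub>A\<^esub> c \<odot>\<^bsub>A\<^esub> y"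
  using assms unfolding qalg_def by blast+

lemma alg_homI:
  assumes "\<And>x. x \<in> carrier A \<Longrightarrow> f x \<in> carrier B"
    and "\<And>x y. x \<in> carrier A \<Longrightarrow> y \<in> carrier A \<Longrightarrow> f (x \<otimes>\<^bsub>A\<^esub> y) = f x \<otimes>\<^bsub>B\<^esub> f y"
    and "\<And>x y. x \<in> carrier A \<Longrightarrow> y \<in> carrier A \<Longrightarrow> f (x \<oplus>\<^bsub>A\<^esub> y) = f x \<oplus>\<^bsub>B\<^esub> f y"
    and "f \<one>\<^bsub>A\<^esub> = \<one>\<^bsub>B\<^esub>"
    and "\<And>c x. x \<in> carrier A \<Longrightarrow> f (c \<odot>\<^bsub>A\<^esub> x) = c \<odot>\<^bsub>B\<^esub> f x"
  shows "f \<in> alg_hom A B"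
  unfolding alg_hom_def using assms by (simp add: ring_hom_memI)

lemma alg_homD:
  assumes "f \<in> alg_hom A B" "x \<in> carrier A"
  shows "f x \<in> carrier B" "f (c \<odot>\<^bsub>A\<^esub> x) = c \<odot>\<^bsub>B\<^esub> f x"
    "y \<in> carrier A \<Longrightarrow> f (x \<otimes>\<^bsub>A\<^esub> y) = f x \<otimes>\<^bsub>B\<^esub> f y"
    "y \<in> carrier A \<Longrightarrow> f (x \<oplus>\<^bsub>A\<^esub> y) = f x \<oplus>\<^bsub>B\<^esub> f y"
  using assms by (simp_all add: alg_hom_def ring_hom_def Pi_iff)

lemma alg_hom_one: "f \<in> alg_hom A B \<Longrightarrow> f \<one>\<^bsub>A\<^esub> = \<one>\<^bsub>B\<^esub>"
  by (simp add: alg_hom_def ring_hom_def)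

lemma quot_alg_simps:
  "carrier (quot_alg A J) = a_rcosets\<^bsub>A\<^esub> J" "\<one>\<^bsub>quot_alg A J\<^esub> = J +>\<^bsub>A\<^esub> \<one>\<^bsub>A\<^esub>"
  "\<zero>\<^bsub>quot_alg A J\<^esub> = J" 
  by (simp_all add: quot_alg_def FactRing_def)

text \<open>Transfers the ring laws between records that differ only in their additional fields, as the record of a quotient
  algebra and that of the underlying quotient ring do.\<close>

lemma ring_congruent:
  fixes R :: "('a, 'b) ring_scheme" and S :: "('a, 'c) ring_scheme"
  assumes R: "ring R" and "carrier S = carrier R" "mult S = mult R" "one S = one R" "zero S = zero R" "add S = add R"
  shows "ring S"
proof -
  interpret R: ring R by fact
  have "Group.monoid S" by (rule monoidI) (simp_all add: assms R.m_assoc)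
  moreover have "abelian_group S"
  proof (rule abelian_groupI)
    show "\<exists>y\<in>carrier S. y \<oplus>\<^bsub>S\<^esub> x = \<zero>\<^bsub>S\<^esub>" if "x \<in> carrier S" for x
      using that R.l_neg[of x] R.a_inv_closed[of x] assms(2-) by (intro bexI[of _ "\<ominus>\<^bsub>R\<^esub> x"]) simp_all
  qed (simp_all add: assms(2-) R.a_ac)
  ultimately show ?thesis by (intro ringI) (auto simp: assms R.l_distr R.r_distr)
qed

lemma ring_quot_alg:
  assumes "ideal J A" shows "ring (quot_alg A J)"
proof -
  interpret ideal J A by fact
  have "ring (A Quot J)" by (rule quotient_is_ring)
  then show ?thesis
    by (rule ring_congruent) (simp_all add: quot_alg_def)
qed

lemma carrier_quot_alg: "carrier (quot_alg A J) = (\<lambda>x. J +>\<^bsub>A\<^esub> x) ` carrier A"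
  unfolding quot_alg_simps by (auto simp: A_RCOSETS_def')

lemma quot_alg_add:
  assumes "ideal J A" "x \<in> carrier A" "y \<in> carrier A"
  shows "(J +>\<^bsub>A\<^esub> x) \<oplus>\<^bsub>quot_alg A J\<^esub> (J +>\<^bsub>A\<^esub> y) = J +>\<^bsub>A\<^esub> (x \<oplus>\<^bsub>A\<^esub> y)"
  using ideal.a_rcos_sum[OF assms] by (simp add: quot_alg_def FactRing_def)

lemma quot_alg_mult:
  assumes "ideal J A" "x \<in> carrier A" "y \<in> carrier A"
  shows "(J +>\<^bsub>A\<^esub> x) \<otimes>\<^bsub>quot_alg A J\<^esub> (J +>\<^bsub>A\<^esub> y) = J +>\<^bsub>A\<^esub> (x \<otimes>\<^bsub>A\<^esub> y)"
  using ideal.rcoset_mult_add[OF assms] by (simp add: quot_alg_def FactRing_def)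

lemma coset_eq_iff:
  assumes "ideal J A" "x \<in> carrier A" "y \<in> carrier A"
  shows "J +>\<^bsub>A\<^esub> x = J +>\<^bsub>A\<^esub> y \<longleftrightarrow> x \<ominus>\<^bsub>A\<^esub> y \<in> J"
proof -
  interpret ideal J A by fact
  show ?thesis using assms quotient_eq_iff_same_a_r_cos[OF assms] by simp
qed

lemma coset_memD:
  assumes "ideal J A" "x \<in> carrier A" "y \<in> J +>\<^bsub>A\<^esub> x"
  shows "y \<in> carrier A" "J +>\<^bsub>A\<^esub> y = J +>\<^bsub>A\<^esub> x"
proof -
  interpret ideal J A by fact
  show "y \<in> carrier A" using assms by (auto simp: a_r_coset_def')
  show "J +>\<^bsub>A\<^esub> y = J +>\<^bsub>A\<^esub> x" using a_repr_independence[OF assms(3,2)] a_subgroup by simp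
qed

lemma coset_self:
  assumes "ideal J A" "x \<in> carrier A" shows "x \<in> J +>\<^bsub>A\<^esub> x"
proof -
  interpret ideal J A by fact
  show ?thesis using assms by (simp add: a_rcos_self)
qed

lemma quot_alg_smult:
  assumes A: "qalg A" and J: "ideal J A" and x: "x \<in> carrier A"
  shows "c \<odot>\<^bsub>quot_alg A J\<^esub> (J +>\<^bsub>A\<^esub> x) = J +>\<^bsub>A\<^esub> (c \<odot>\<^bsub>A\<^esub> x)"
proof -
  interpret ideal J A by fact
  have "J +>\<^bsub>A\<^esub> (c \<odot>\<^bsub>A\<^esub> y) = J +>\<^bsub>A\<^esub> (c \<odot>\<^bsub>A\<^esub> x)" if y: "y \<in> J +>\<^bsub>A\<^esub> x" for y
  proof -
    obtain j where j: "j \<in> J" "y = j \<oplus>\<^bsub>A\<^esub> x" using y by (auto simp: a_r_coset_def')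
    have "c \<odot>\<^bsub>A\<^esub> y = c \<odot>\<^bsub>A\<^esub> j \<oplus>\<^bsub>A\<^esub> c \<odot>\<^bsub>A\<^esub> x" using A x j Icarr by (simp add: qalg_def)
    moreover have "c \<odot>\<^bsub>A\<^esub> j \<in> J" using qalg_ideal_smult[OF A J j(1)] .
    moreover have "c \<odot>\<^bsub>A\<^esub> x \<in> carrier A" using A x by (rule qalg_smult_closed)
    ultimately have "c \<odot>\<^bsub>A\<^esub> y \<in> J +>\<^bsub>A\<^esub> (c \<odot>\<^bsub>A\<^esub> x)" by (auto simp: a_r_coset_def')
    then show ?thesis using coset_memD[OF J] \<open>c \<odot>\<^bsub>A\<^esub> x \<in> carrier A\<close> by blast
  qed
  moreover have "x \<in> J +>\<^bsub>A\<^esub> x" using coset_self[OF J x] .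
  ultimately have "(\<Union>y\<in>J +>\<^bsub>A\<^esub> x. J +>\<^bsub>A\<^esub> (c \<odot>\<^bsub>A\<^esub> y)) = J +>\<^bsub>A\<^esub> (c \<odot>\<^bsub>A\<^esub> x)" by blast
  then show ?thesis by (simp add: quot_alg_def)
qed

lemma qalg_quot_alg:
  assumes A: "qalg A" and J: "ideal J A" shows "qalg (quot_alg A J)"
proof -
  interpret ring A using A by (rule qalg_ring)
  let ?Q = "quot_alg A J"
  note [simp] = quot_alg_smult[OF A J] quot_alg_add[OF J] quot_alg_mult[OF J]
    qalg_smult_closed[OF A] qalg_smult_mult[OF A]
  have rep: "\<exists>x'\<in>carrier A. x = J +>\<^bsub>A\<^esub> x'" if "x \<in> carrier ?Q" for x
    using that by (auto simp: carrier_quot_alg)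
  have cl: "J +>\<^bsub>A\<^esub> x \<in> carrier ?Q" if "x \<in> carrier A" for x
    using that by (simp add: carrier_quot_alg)
  have 1: "c \<odot>\<^bsub>?Q\<^esub> x \<in> carrier ?Q" if "x \<in> carrier ?Q" for c x
    using rep[OF that] cl by auto
  have 2: "c \<odot>\<^bsub>?Q\<^esub> (x \<oplus>\<^bsub>?Q\<^esub> y) = c \<odot>\<^bsub>?Q\<^esub> x \<oplus>\<^bsub>?Q\<^esub> c \<odot>\<^bsub>?Q\<^esub> y"
    "(c \<odot>\<^bsub>?Q\<^esub> x) \<otimes>\<^bsub>?Q\<^esub> y = c \<odot>\<^bsub>?Q\<^esub> (x \<otimes>\<^bsub>?Q\<^esub> y)" "x \<otimes>\<^bsub>?Q\<^esub> (c \<odot>\<^bsub>?Q\<^esub> y) = c \<odot>\<^bsub>?Q\<^esub> (x \<otimes>\<^bsub>?Q\<^esub> y)"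
    if "x \<in> carrier ?Q" "y \<in> carrier ?Q" for c x y
    using rep[OF that(1)] rep[OF that(2)] by auto
  show ?thesis unfolding qalg_def using ring_quot_alg[OF J] by (intro conjI allI ballI 1 2)
qed

lemma coset_hom:
  assumes A: "qalg A" and J: "ideal J A" shows "(\<lambda>x. J +>\<^bsub>A\<^esub> x) \<in> alg_hom A (quot_alg A J)"
proof (rule alg_homI)
  show "J +>\<^bsub>A\<^esub> x \<in> carrier (quot_alg A J)" if "x \<in> carrier A" for x
    unfolding carrier_quot_alg using that by (rule imageI)
qed (simp_all only: quot_alg_smult[OF A J] quot_alg_add[OF J] quot_alg_mult[OF J] quot_alg_simps(2))

lemma subalg_gen_carrier:
  assumes A: "qalg A" and S: "S \<subseteq> carrier A"
  shows "carrier (subalg_gen A S) \<subseteq> carrier A" "S \<subseteq> carrier (subalg_gen A S)"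
    "c \<odot>\<^bsub>A\<^esub> \<one>\<^bsub>A\<^esub> \<in> carrier (subalg_gen A S)"
proof -
  interpret ring A using A by (rule qalg_ring)
  have G: "range (\<lambda>c. c \<odot>\<^bsub>A\<^esub> \<one>\<^bsub>A\<^esub>) \<union> S \<subseteq> carrier A" using S A by (auto simp: qalg_smult_closed)
  show "carrier (subalg_gen A S) \<subseteq> carrier A" using generate_ring_incl[OF G] by (simp add: subalg_gen_def)
  show "S \<subseteq> carrier (subalg_gen A S)" "c \<odot>\<^bsub>A\<^esub> \<one>\<^bsub>A\<^esub> \<in> carrier (subalg_gen A S)"
    by (auto simp: subalg_gen_def intro: generate_ring.incl)
qed

lemma subalg_gen_simps:
  "\<one>\<^bsub>subalg_gen A S\<^esub> = \<one>\<^bsub>A\<^esub>" "\<zero>\<^bsub>subalg_gen A S\<^esub> = \<zero>\<^bsub>A\<^esub>" "x \<oplus>\<^bsub>subalg_gen A S\<^esub> y = x \<oplus>\<^bsub>A\<^esub> y"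
  "x \<otimes>\<^bsub>subalg_gen A S\<^esub> y = x \<otimes>\<^bsub>A\<^esub> y" "c \<odot>\<^bsub>subalg_gen A S\<^esub> x = c \<odot>\<^bsub>A\<^esub> x"
  by (simp_all add: subalg_gen_def)

lemma qalg_subalg_gen:
  assumes A: "qalg A" and S: "S \<subseteq> carrier A"
  shows "qalg (subalg_gen A S)"
proof -
  interpret ring A using A by (rule qalg_ring)
  have G: "range (\<lambda>c. c \<odot>\<^bsub>A\<^esub> \<one>\<^bsub>A\<^esub>) \<union> S \<subseteq> carrier A" using S A by (auto simp: qalg_smult_closed)
  have R: "ring (subalg_gen A S)" using generate_ring_is_ring[OF G] by (simp add: subalg_gen_def)
  have sub: "x \<in> carrier A" if "x \<in> carrier (subalg_gen A S)" for x
    using that subalg_gen_carrier(1)[OF A S] by blast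
  have "c \<odot>\<^bsub>A\<^esub> x \<in> carrier (subalg_gen A S)" if "x \<in> carrier (subalg_gen A S)" for c x
  proof -
    have "(c \<odot>\<^bsub>A\<^esub> \<one>\<^bsub>A\<^esub>) \<otimes>\<^bsub>A\<^esub> x \<in> carrier (subalg_gen A S)"
      using subalg_gen_carrier(3)[OF A S, of c] that
      by (auto simp: subalg_gen_def intro: generate_ring.eng_mult)
    then show ?thesis using qalg_smult_eq[OF A sub[OF that]] by simp
  qed
  then show ?thesis unfolding qalg_def subalg_gen_simps
    using R A sub by (auto simp: qalg_def)
qed

lemma subalg_gen_stable:
  assumes A: "qalg A" and S: "S \<subseteq> carrier A" and T: "T \<in> alg_hom A A"
    and gen: "\<And>x. x \<in> S \<Longrightarrow> T x \<in> carrier (subalg_gen A S)"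
    and x: "x \<in> carrier (subalg_gen A S)"
  shows "T x \<in> carrier (subalg_gen A S)"
proof -
  interpret ring A using A by (rule qalg_ring)
  have G: "range (\<lambda>c. c \<odot>\<^bsub>A\<^esub> \<one>\<^bsub>A\<^esub>) \<union> S \<subseteq> carrier A" using S A by (auto simp: qalg_smult_closed)
  have Th: "T \<in> ring_hom A A" "\<And>c x. x \<in> carrier A \<Longrightarrow> T (c \<odot>\<^bsub>A\<^esub> x) = c \<odot>\<^bsub>A\<^esub> T x"
    using T by (auto simp: alg_hom_def)
  interpret T: ring_hom_ring A A T using Th(1) by (intro ring_hom_ringI2 ring_axioms)
  have "x \<in> generate_ring A (range (\<lambda>c. c \<odot>\<^bsub>A\<^esub> \<one>\<^bsub>A\<^esub>) \<union> S)" using x by (simp add: subalg_gen_def)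
  then show ?thesis
  proof (induction rule: generate_ring.induct)
    case one
    show ?case by (simp add: subalg_gen_def generate_ring.one)
  next
    case (incl h)
    then show ?case
    proof
      assume "h \<in> range (\<lambda>c. c \<odot>\<^bsub>A\<^esub> \<one>\<^bsub>A\<^esub>)"
      then show ?thesis using Th(2)[OF one_closed] subalg_gen_carrier(3)[OF A S] by auto
    qed (rule gen)
  next
    case (a_inv h)
    then have "h \<in> carrier A" by (simp add: generate_ring_in_carrier[OF G])
    then show ?case using a_inv.IH by (simp add: subalg_gen_def generate_ring.a_inv)
  next
    case (eng_add h1 h2)
    then have "h1 \<in> carrier A" "h2 \<in> carrier A" by (simp_all add: generate_ring_in_carrier[OF G])
    then show ?case using eng_add.IH by (simp add: subalg_gen_def generate_ring.eng_add)
  next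
    case (eng_mult h1 h2)
    then have "h1 \<in> carrier A" "h2 \<in> carrier A" by (simp_all add: generate_ring_in_carrier[OF G])
    then show ?case using eng_mult.IH by (simp add: subalg_gen_def generate_ring.eng_mult)
  qed
qed

lemma alg_hom_restrict:
  assumes T: "T \<in> alg_hom A A" and sub: "carrier (subalg_gen A S) \<subseteq> carrier A"
    and stable: "\<And>x. x \<in> carrier (subalg_gen A S) \<Longrightarrow> T x \<in> carrier (subalg_gen A S)"
  shows "T \<in> alg_hom (subalg_gen A S) (subalg_gen A S)"
proof -
  have in_A: "x \<in> carrier A" if "x \<in> carrier (subalg_gen A S)" for x using sub that by blast
  show ?thesis
    by (rule alg_homI) (simp_all add: subalg_gen_simps stable in_A alg_homD[OF T] alg_hom_one[OF T])
qed

lemma alg_hom_compose: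
  assumes f: "f \<in> alg_hom A B" and g: "g \<in> alg_hom B C" shows "g \<circ> f \<in> alg_hom A C"
  by (rule alg_homI) (simp_all add: alg_homD[OF f] alg_homD[OF g] alg_hom_one[OF f] alg_hom_one[OF g])

text \<open>The elements of \<open>A\<close> that \<open>T\<close> maps into the ideal form an ideal themselves.\<close>

lemma genideal_stable:
  assumes A: "ring A" and S: "S \<subseteq> carrier A" and T: "T \<in> ring_hom A A"
    and gen: "\<And>x. x \<in> S \<Longrightarrow> T x \<in> Idl\<^bsub>A\<^esub> S" and x: "x \<in> Idl\<^bsub>A\<^esub> S"
  shows "T x \<in> Idl\<^bsub>A\<^esub> S"
proof -
  interpret ring A by fact
  interpret J: ideal "Idl\<^bsub>A\<^esub> S" A by (rule genideal_ideal[OF S])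
  interpret T: ring_hom_ring A A T using T by (intro ring_hom_ringI2 ring_axioms)
  let ?P = "{y \<in> carrier A. T y \<in> Idl\<^bsub>A\<^esub> S}"
  have "ideal ?P A"
  proof (intro idealI ring_axioms)
    show "subgroup ?P (add_monoid A)"
    proof (rule group.subgroupI[OF a_group])
      show "?P \<noteq> {}" using J.zero_closed by (metis (mono_tags, lifting) T.hom_zero empty_iff mem_Collect_eq zero_closed)
      show "inv\<^bsub>add_monoid A\<^esub> y \<in> ?P" if "y \<in> ?P" for y
        using that J.a_inv_closed by (simp add: a_inv_def[symmetric])
    qed auto
    show "y \<otimes>\<^bsub>A\<^esub> z \<in> ?P" "z \<otimes>\<^bsub>A\<^esub> y \<in> ?P" if "z \<in> ?P" "y \<in> carrier A" for y z
      using that J.I_l_closed J.I_r_closed by simp_all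
  qed
  then have "Idl\<^bsub>A\<^esub> S \<subseteq> ?P"
    by (rule genideal_minimal) (use S gen in auto)
  then show ?thesis using x by auto
qed

lemma induced_coset:
  assumes A: "qalg A" and J: "ideal J A" and T: "T \<in> alg_hom A A"
    and stable: "\<And>x. x \<in> J \<Longrightarrow> T x \<in> J" and x: "x \<in> carrier A"
  shows "induced A J T (J +>\<^bsub>A\<^esub> x) = J +>\<^bsub>A\<^esub> T x"
proof -
  interpret ideal J A by fact
  interpret T: ring_hom_ring A A T using T by (intro ring_hom_ringI2 ring_axioms) (simp add: alg_hom_def)
  have "J +>\<^bsub>A\<^esub> T y = J +>\<^bsub>A\<^esub> T x" if y: "y \<in> J +>\<^bsub>A\<^esub> x" for y
  proof -
    note yc = coset_memD[OF J x y]
    then have "y \<ominus>\<^bsub>A\<^esub> x \<in> J" using coset_eq_iff[OF J _ x] by simp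
    then have "T (y \<ominus>\<^bsub>A\<^esub> x) \<in> J" by (rule stable)
    then have "T y \<ominus>\<^bsub>A\<^esub> T x \<in> J" using x yc(1) by (simp add: a_minus_def)
    then show ?thesis using coset_eq_iff[OF J] x yc(1) by simp
  qed
  then have "(\<lambda>y. J +>\<^bsub>A\<^esub> T y) ` (J +>\<^bsub>A\<^esub> x) = {J +>\<^bsub>A\<^esub> T x}"
    using coset_self[OF J x] by blast
  then show ?thesis by (simp add: induced_def)
qed

lemma induced_hom:
  assumes A: "qalg A" and J: "ideal J A" and T: "T \<in> alg_hom A A"
    and stable: "\<And>x. x \<in> J \<Longrightarrow> T x \<in> J"
  shows "induced A J T \<in> alg_hom (quot_alg A J) (quot_alg A J)"
proof -
  interpret ideal J A by fact
  note [simp] = induced_coset[OF A J T stable] alg_homD[OF T] alg_hom_one[OF T] quot_alg_smult[OF A J]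
    quot_alg_add[OF J] quot_alg_mult[OF J] quot_alg_simps(2) qalg_smult_closed[OF A]
  show ?thesis
    by (rule alg_homI; (unfold carrier_quot_alg)?; (elim imageE)?; simp)
qed

section \<open>Elements of the free algebra read in an algebra\<close>

text \<open>A reading is a set of polynomials together with the map that evaluates them in some algebra. The set is part of
  the data because the class of a polynomial in a subalgebra or in a subquotient makes sense only for some polynomials.\<close>

type_synonym ('i, 'y, 'a) reading = "('i, 'y) free set \<times> (('i, 'y) free \<Rightarrow> 'a)"

definition subalg :: "('i, 'y) free set \<Rightarrow> bool" where
  "subalg C \<longleftrightarrow> 1 \<in> C \<and> (\<forall>p\<in>C. \<forall>q\<in>C. p + q \<in> C \<and> p * q \<in> C) \<and> (\<forall>c. \<forall>p\<in>C. c \<star> p \<in> C)"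

definition rep :: "(qv, 'a) module \<Rightarrow> ('i, 'y, 'a) reading \<Rightarrow> bool" where
  "rep A R \<longleftrightarrow> qalg A \<and> subalg (fst R) \<and> snd R \<in> fst R \<rightarrow> carrier A \<and> snd R 1 = \<one>\<^bsub>A\<^esub> \<and>
     (\<forall>p\<in>fst R. \<forall>q\<in>fst R. snd R (p + q) = snd R p \<oplus>\<^bsub>A\<^esub> snd R q) \<and>
     (\<forall>p\<in>fst R. \<forall>q\<in>fst R. snd R (p * q) = snd R p \<otimes>\<^bsub>A\<^esub> snd R q) \<and>
     (\<forall>c. \<forall>p\<in>fst R. snd R (c \<star> p) = c \<odot>\<^bsub>A\<^esub> snd R p)"

text \<open>The polynomials \<open>p\<close> and \<open>q\<close> have the same value under two readings in one algebra. With \<open>R = S\<close> this is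
  congruence modulo the relations of \<open>A\<close>; with \<open>R\<close> the composition of \<open>S\<close> with a homomorphism it says that the homomorphism
  maps \<open>p\<close> to \<open>q\<close>. Both uses share the closure rules below, and transitivity combines them. The two
  readings may use different index sets, as is needed for the homomorphism from the contracted quantum group.\<close>

definition rel :: "(qv, 'a) module \<Rightarrow> ('i, 'y, 'a) reading \<Rightarrow> ('j, 'z, 'a) reading
    \<Rightarrow> ('i, 'y) free \<Rightarrow> ('j, 'z) free \<Rightarrow> bool" where
  "rel A R S p q \<longleftrightarrow> rep A R \<and> rep A S \<and> p \<in> fst R \<and> q \<in> fst S \<and> snd R p = snd S q"

lemma rel_refl: "rep A R \<Longrightarrow> p \<in> fst R \<Longrightarrow> rel A R R p p"
  by (simp add: rel_def)

lemma rel_sym: "rel A R S p q \<Longrightarrow> rel A S R q p"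
  by (simp add: rel_def)

lemma rel_trans [trans]: "rel A R S p q \<Longrightarrow> rel A S Q q r \<Longrightarrow> rel A R Q p r"
  by (simp add: rel_def)

lemma rel_one: "rep A R \<Longrightarrow> rep A S \<Longrightarrow> rel A R S 1 1"
  by (simp add: rel_def rep_def subalg_def)

lemma rel_add: "rel A R S p p' \<Longrightarrow> rel A R S q q' \<Longrightarrow> rel A R S (p + q) (p' + q')"
  by (simp add: rel_def rep_def subalg_def)

lemma rel_mult: "rel A R S p p' \<Longrightarrow> rel A R S q q' \<Longrightarrow> rel A R S (p * q) (p' * q')"
  by (simp add: rel_def rep_def subalg_def)

lemma rel_star: "rel A R S p p' \<Longrightarrow> rel A R S (c \<star> p) (c \<star> p')"
  by (simp add: rel_def rep_def subalg_def)

lemma rel_minus: "rel A R S p p' \<Longrightarrow> rel A R S (- p) (- p')"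
  using rel_star[of A R S p p' "-1"] by (simp add: minus_star)

lemma rel_diff: "rel A R S p p' \<Longrightarrow> rel A R S q q' \<Longrightarrow> rel A R S (p - q) (p' - q')"
  using rel_add[OF _ rel_minus] by fastforce

lemma rel_zero: "rel A R S p p' \<Longrightarrow> rel A R S 0 0"
  using rel_star[of A R S p p' 0] by simp

lemma rel_power: "rel A R S p p' \<Longrightarrow> rel A R S (p ^ n) (p' ^ n)"
proof (induction n)
  case 0
  then show ?case using rel_one[of A R S] by (simp add: rel_def)
qed (simp add: rel_mult)

lemma rel_sum:
  assumes "finite I" "rep A R" "rep A S" "\<And>x. x \<in> I \<Longrightarrow> rel A R S (f x) (g x)"
  shows "rel A R S (sum f I) (sum g I)"
  using assms(1,4)
proof (induction I rule: finite_induct)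
  case empty
  then show ?case using rel_zero[OF rel_one[OF assms(2,3)]] by simp
qed (simp add: rel_add)

lemma rel_tad:
  assumes "rel A R S x x'" "rel A R S y y'"
  shows "rel A R S (tad q c x y n) (tad q c x' y' n)"
  unfolding tad_def
proof (rule rel_sum)
  show "rep A R" "rep A S" using assms by (simp_all add: rel_def)
qed (use assms in \<open>simp_all add: rel_star rel_mult rel_power\<close>)

lemmas rel_intros = rel_add rel_mult rel_star rel_minus rel_diff rel_power rel_tad

lemma rep_compose:
  assumes R: "rep A R" and T: "T \<in> alg_hom A B" and B: "qalg B"
  shows "rep B (fst R, T \<circ> snd R)"
proof -
  have "snd R p \<in> carrier A" if "p \<in> fst R" for p using R that by (auto simp: rep_def)
  then show ?thesis
    using R B unfolding rep_def by (simp add: Pi_iff alg_homD[OF T] alg_hom_one[OF T])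
qed

section \<open>Congruences in a quotient of the free algebra\<close>

locale congruence =
  fixes A :: "(qv, 'a) module" and R :: "('i, 'y, 'a) reading"
  assumes rep: "rep A R"
begin

abbreviation cong :: "('i, 'y) free \<Rightarrow> ('i, 'y) free \<Rightarrow> bool" (infix \<open>\<approx>\<close> 50)
  where "p \<approx> q \<equiv> rel A R R p q"

lemma cong_iff: "p \<approx> q \<longleftrightarrow> p \<in> fst R \<and> q \<in> fst R \<and> snd R p = snd R q"
  using rep by (simp add: rel_def)

lemma refl_iff: "p \<approx> p \<longleftrightarrow> p \<in> fst R"
  by (simp add: cong_iff)

lemma cong_refl: "p \<in> fst R \<Longrightarrow> p \<approx> p"
  by (simp add: cong_iff)

lemma closed [simp, intro]:
  "1 \<in> fst R" "p \<in> fst R \<Longrightarrow> q \<in> fst R \<Longrightarrow> p + q \<in> fst R"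
  "p \<in> fst R \<Longrightarrow> q \<in> fst R \<Longrightarrow> p * q \<in> fst R" "p \<in> fst R \<Longrightarrow> c \<star> p \<in> fst R"
  using rep by (simp_all add: rep_def subalg_def)

lemma closed' [simp, intro]:
  "0 \<in> fst R" "p \<in> fst R \<Longrightarrow> - p \<in> fst R" "p \<in> fst R \<Longrightarrow> q \<in> fst R \<Longrightarrow> p - q \<in> fst R"
  "p \<in> fst R \<Longrightarrow> p ^ n \<in> fst R"
  "p \<in> fst R \<Longrightarrow> q \<in> fst R \<Longrightarrow> tad a c p q n \<in> fst R"
  using rel_zero[OF cong_refl[OF closed(1)]] rel_minus[of A R R p p] rel_diff[of A R R p p q q]
    rel_power[of A R R p p n] rel_tad[of A R R p p q q a c n] by (simp_all add: refl_iff)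

lemma cong_left: "p \<approx> q \<Longrightarrow> u \<in> fst R \<Longrightarrow> u * p \<approx> u * q"
  and cong_right: "p \<approx> q \<Longrightarrow> w \<in> fst R \<Longrightarrow> p * w \<approx> q * w"
  by (simp_all add: rel_mult cong_refl)

lemma power_commute:
  assumes "x * z \<approx> z * x" "x \<in> fst R" "z \<in> fst R"
  shows "x ^ r * z \<approx> z * x ^ r"
proof (induction r)
  case 0
  then show ?case using assms by (simp add: cong_refl)
next
  case (Suc r)
  have "x ^ Suc r * z = x * (x ^ r * z)" by (simp add: mult.assoc)
  also have "rel A R R \<dots> (x * (z * x ^ r))" by (rule cong_left[OF Suc assms(2)])
  also have "x * (z * x ^ r) = (x * z) * x ^ r" by (simp add: mult.assoc)
  also have "rel A R R \<dots> ((z * x) * x ^ r)" by (rule cong_right[OF assms(1)]) (use assms in simp)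
  also have "(z * x) * x ^ r = z * x ^ Suc r" by (simp add: mult.assoc)
  finally show ?case .
qed

lemma cong_sum: "(\<And>r. r \<le> n \<Longrightarrow> f r \<approx> g r) \<Longrightarrow> (\<Sum>r\<le>n. f r) \<approx> (\<Sum>r\<le>(n::nat). g r)"
  by (rule rel_sum) (simp_all add: rep)

lemma tad_commute_left:
  assumes "x * z \<approx> z * x" "x \<in> fst R" "z \<in> fst R" "w \<in> fst R"
  shows "tad q c x (z * w) n \<approx> z * tad q c x w n"
proof -
  have "x ^ r * (z * w) * x ^ (n - r) \<approx> z * (x ^ r * w * x ^ (n - r))" for r
    using cong_right[OF power_commute[OF assms(1-3), of r], of "w * x ^ (n - r)"] assms
    by (simp add: mult.assoc)
  then show ?thesis unfolding tad_def sum_distrib_left star_mult_right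
    by (intro cong_sum rel_star) 
qed

lemma tad_commute_right:
  assumes "x * z \<approx> z * x" "x \<in> fst R" "z \<in> fst R" "w \<in> fst R"
  shows "tad q c x (w * z) n \<approx> tad q c x w n * z"
proof -
  have "x ^ r * (w * z) * x ^ (n - r) \<approx> (x ^ r * w * x ^ (n - r)) * z" for r
    using cong_left[OF rel_sym[OF power_commute[OF assms(1-3), of "n - r"]], of "x ^ r * w"] assms
    by (simp add: mult.assoc)
  then show ?thesis unfolding tad_def sum_distrib_right star_mult_left
    by (intro cong_sum rel_star) 
qed

end

section \<open>Iterated adjoint sums\<close>

lemma tad_sum: "tad q c x (\<Sum>i\<in>S. f i) n = (\<Sum>i\<in>S. tad q c x (f i) n)"
proof -
  have "tad q c x (u + w) n = tad q c x u n + tad q c x w n" for u w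
    by (simp add: tad_def algebra_simps star_add sum.distrib)
  then show ?thesis by (induction S rule: infinite_finite_induct) simp_all
qed

text \<open>All terms are multiples of \<open>x ^ m\<close>, and their coefficients add up to zero.\<close>

lemma tad_unit:
  assumes "aperiodic q" "m > 0" shows "tad q (q powi (1 - int m)) x 1 m = 0"
proof -
  have "tad q (q powi (1 - int m)) x 1 m =
      (\<Sum>r\<le>m. ((- (q powi (1 - int m))) ^ r / (qfact q r * qfact q (m - r))) \<star> x ^ m)"
    unfolding tad_def by (intro sum.cong refl) (simp flip: power_add)
  then show ?thesis using gauss_alternating_sum[OF assms] by (simp flip: sum_star)
qed

text \<open>Two letters that satisfy one of the quantum Serre relations of a simple edge, in the form of a \<open>q\<close>-commutation of
  \<open>x\<close> with the \<open>q\<close>-commutator \<open>X\<close>.\<close>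

locale q_serre_pair = congruence A R for A :: "(qv, 'a) module" and R :: "('i, 'y, 'a) reading" +
  fixes q :: qv and x y X :: "('i, 'y) free"
  assumes q: "aperiodic q" and x: "x \<in> fst R" and y: "y \<in> fst R"
    and X_def: "X = y * x - q \<star> (x * y)" and serre: "x * X \<approx> q \<star> (X * x)"
begin

lemma X: "X \<in> fst R"
  unfolding X_def using x y by blast

text \<open>Moving one \<open>y\<close> to the left through \<open>x ^ r\<close> creates an \<open>X\<close> for each of the \<open>r\<close> letters. Moving these \<open>X\<close> to the
  left as well costs a power of \<open>q\<close> each, and the powers add up to a quantum integer.\<close>

lemma power_swap:
  "x ^ r * y \<approx> inverse (q ^ r) \<star> (y * x ^ r) - (inverse q * qint q r) \<star> (X * x ^ (r - 1))"
proof (induction r)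
  case 0
  then show ?case using x y by (simp add: qint_eq cong_refl)
next
  case (Suc r)
  have q0: "q \<noteq> 0" using q by (rule aperiodic_nonzero)
  have xy: "x * y = inverse q \<star> (y * x) - inverse q \<star> X"
    using q0 by (simp add: X_def star_diff star_star)
  \<comment> \<open>For \<open>r = 0\<close> there is no \<open>X\<close> to be moved, but then the coefficient is \<open>0\<close>.\<close>
  have swap: "qint q r \<star> (x * X * x ^ (r - 1)) \<approx> (q * qint q r) \<star> (X * x ^ r)"
  proof (cases r)
    case 0
    then show ?thesis using x X by (simp add: qint_eq cong_refl)
  next
    case (Suc k)
    have "qint q r \<star> (x * X * x ^ (r - 1)) \<approx> qint q r \<star> ((q \<star> (X * x)) * x ^ (r - 1))"
      by (intro rel_star cong_right serre) (use x in simp)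
    then show ?thesis by (simp add: Suc star_simps mult_ac)
  qed
  have coeff: "inverse (q ^ r) * inverse q + qint q r = inverse q * qint q (Suc r)"
    using qint_split[OF q, of r "Suc r"] q0 by (simp add: qint_one[OF q] field_simps)
  have "x ^ Suc r * y = x * (x ^ r * y)" by (simp add: mult.assoc)
  also have "rel A R R \<dots> (x * (inverse (q ^ r) \<star> (y * x ^ r) - (inverse q * qint q r) \<star> (X * x ^ (r - 1))))"
    by (rule cong_left[OF Suc x])
  also have "\<dots> = inverse (q ^ r) \<star> ((x * y) * x ^ r) - inverse q \<star> qint q r \<star> (x * X * x ^ (r - 1))"
    by (simp add: right_diff_distrib star_simps mult.assoc)
  also have "\<dots> = (inverse (q ^ r) * inverse q) \<star> (y * x ^ Suc r) - (inverse (q ^ r) * inverse q) \<star> (X * x ^ r)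
      - inverse q \<star> (qint q r \<star> (x * X * x ^ (r - 1)))"
    unfolding xy by (simp add: left_diff_distrib star_simps star_diff mult.assoc)
  also have "rel A R R \<dots> ((inverse (q ^ r) * inverse q) \<star> (y * x ^ Suc r) - (inverse (q ^ r) * inverse q) \<star> (X * x ^ r)
      - inverse q \<star> ((q * qint q r) \<star> (X * x ^ r)))"
    by (intro rel_diff rel_star swap cong_refl) (use x y X in auto)
  also have "\<dots> = inverse (q ^ Suc r) \<star> (y * x ^ Suc r) - (inverse (q ^ r) * inverse q + qint q r) \<star> (X * x ^ r)"
  proof -
    have "inverse q * (q * qint q r) = qint q r" using q0 by simp
    then show ?thesis by (simp only: star_star add_star power_Suc inverse_mult_distrib mult.commute[of _ "inverse q"])
        (simp add: algebra_simps)
  qed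
  finally show ?case unfolding coeff by simp
qed

text \<open>The adjoint sum is a skew derivation: either the letter \<open>y\<close> is left alone, or it is turned into \<open>X\<close> and the order
  of the adjoint sum drops by one.\<close>

lemma tad_leibniz:
  assumes w: "w \<in> fst R"
  shows "tad q c x (y * w) (Suc m) \<approx> y * tad q (c / q) x w (Suc m) + (c / q) \<star> (X * tad q c x w m)"
proof -
  let ?k = "\<lambda>c m r. (- c) ^ r / (qfact q r * qfact q (m - r))"
  have q0: "q \<noteq> 0" and fs: "qint q (Suc r) \<noteq> 0" for r
    using q by (simp_all add: aperiodic_nonzero qint_nonzero)
  have "tad q c x (y * w) (Suc m) = (\<Sum>r\<le>Suc m. ?k c (Suc m) r \<star> ((x ^ r * y) * (w * x ^ (Suc m - r))))"
    unfolding tad_def by (simp only: mult.assoc)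
  also have "rel A R R \<dots> (\<Sum>r\<le>Suc m. ?k c (Suc m) r \<star>
      ((inverse (q ^ r) \<star> (y * x ^ r) - (inverse q * qint q r) \<star> (X * x ^ (r - 1))) * (w * x ^ (Suc m - r))))"
    by (intro cong_sum rel_star cong_right power_swap) (use x w in simp)
  also have "\<dots> = (\<Sum>r\<le>Suc m. ?k (c / q) (Suc m) r \<star> (y * (x ^ r * w * x ^ (Suc m - r))))
      - (\<Sum>r\<le>Suc m. (?k c (Suc m) r * (inverse q * qint q r)) \<star> (X * (x ^ (r - 1) * w * x ^ (Suc m - r))))"
    unfolding sum_subtractf[symmetric]
  proof (intro sum.cong refl)
    fix r
    have "- (c / q) = - c * inverse q" by (simp add: divide_inverse)
    then have e: "(- (c / q)) ^ r = (- c) ^ r * inverse (q ^ r)"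
      by (simp only: power_mult_distrib power_inverse)
    show "?k c (Suc m) r \<star>
        ((inverse (q ^ r) \<star> (y * x ^ r) - (inverse q * qint q r) \<star> (X * x ^ (r - 1))) * (w * x ^ (Suc m - r))) =
      ?k (c / q) (Suc m) r \<star> (y * (x ^ r * w * x ^ (Suc m - r))) -
      (?k c (Suc m) r * (inverse q * qint q r)) \<star> (X * (x ^ (r - 1) * w * x ^ (Suc m - r)))"
      unfolding e by (simp add: left_diff_distrib star_diff star_simps mult.assoc)
  qed
  also have "(\<Sum>r\<le>Suc m. ?k (c / q) (Suc m) r \<star> (y * (x ^ r * w * x ^ (Suc m - r)))) = y * tad q (c / q) x w (Suc m)"
    unfolding tad_def sum_distrib_left star_mult_right ..
  also have "(\<Sum>r\<le>Suc m. (?k c (Suc m) r * (inverse q * qint q r)) \<star> (X * (x ^ (r - 1) * w * x ^ (Suc m - r)))) =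
    (\<Sum>r\<le>m. (- (c / q) * ?k c m r) \<star> (X * (x ^ r * w * x ^ (m - r))))"
    (is "sum ?g _ = sum ?h _")
  proof -
    have "?g (Suc r) = ?h r" for r
    proof -
      have "?k c (Suc m) (Suc r) * (inverse q * qint q (Suc r)) = - (c / q) * ?k c m r"
        using fs[of r] by (simp add: qfact_Suc divide_inverse mult_ac)
      then show ?thesis by (simp only: diff_Suc_1 diff_Suc_Suc)
    qed
    moreover have "?g 0 = 0" by (simp add: qint_eq)
    ultimately show ?thesis by (simp only: sum.atMost_Suc_shift add_0)
  qed
  also have "\<dots> = - ((c / q) \<star> (X * tad q c x w m))"
    unfolding tad_def sum_distrib_left star_sum by (simp add: star_simps minus_star sum_negf)
  finally show ?thesis by simp
qed

text \<open>Here \<open>w\<close> is meant to be a word with \<open>k\<close> letters \<open>y\<close>, and \<open>w'\<close> the word in which all of them are replaced by \<open>X\<close>.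
  As a skew derivation that turns \<open>y\<close> into \<open>X\<close>, the adjoint sum of order \<open>k\<close> performs all \<open>k\<close>
  replacements, and higher orders vanish. The exponent of the twist is the one for which the factors of the adjoint
  sum are \<open>q\<close>-commutators, if \<open>w\<close> has weight \<open>- k\<close> with respect to \<open>x\<close>. It is the vanishing for
  all \<open>m > k\<close>, not only for \<open>m = k + 1\<close>, that makes the induction over the letters go through.\<close>

definition spread :: "('i, 'y) free \<Rightarrow> ('i, 'y) free \<Rightarrow> nat \<Rightarrow> bool" where
  "spread w w' k \<longleftrightarrow> w \<in> fst R \<and> w' \<in> fst R \<and>
     (\<forall>m\<ge>k. tad q (q powi (int k - int m + 1)) x w m \<approx> (if m = k then w' else 0))"

lemma spread_1: "spread 1 1 0"
proof -
  have "tad q (q powi (int 0 - int m + 1)) x 1 m \<approx> (if m = 0 then 1 else 0)" for m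
    using tad_unit[OF q, of m x] by (cases "m = 0") (simp_all add: cong_refl algebra_simps)
  then show ?thesis by (simp add: spread_def)
qed

text \<open>In \<open>tad_leibniz\<close> the first term has too high an order for \<open>w\<close> and vanishes. The twist of the second term is the
  right one for \<open>w\<close>, and its scalar factor is \<open>1\<close> when \<open>m = Suc k\<close>.\<close>

lemma spread_y:
  assumes "spread w w' k" shows "spread (y * w) (X * w') (Suc k)"
  unfolding spread_def
proof (intro conjI allI impI)
  have w: "w \<in> fst R" "w' \<in> fst R" using assms by (simp_all add: spread_def)
  then show "y * w \<in> fst R" "X * w' \<in> fst R" using y X by simp_all
  fix m assume "Suc k \<le> m"
  then obtain l where l: "m = Suc l" "k \<le> l" by (cases m) auto
  have q0: "q \<noteq> 0" using q by (rule aperiodic_nonzero)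
  let ?c = "q powi (int (Suc k) - int m + 1)"
  have c: "?c = q powi (int k - int l + 1)" by (simp add: l)
  have "?c = q powi ((int k - int m + 1) + 1)" by (rule arg_cong[where f = "power_int q"]) simp
  also have "\<dots> = q powi (int k - int m + 1) * q" using q0 by (intro power_int_add_1) simp
  finally have cq: "?c / q = q powi (int k - int m + 1)"
    using q0 by (metis nonzero_mult_div_cancel_right)
  have "tad q ?c x (y * w) m \<approx> y * tad q (?c / q) x w m + (?c / q) \<star> (X * tad q ?c x w l)"
    using tad_leibniz[OF w(1), of ?c l] unfolding l(1) .
  also have "rel A R R \<dots> (y * 0 + (?c / q) \<star> (X * (if l = k then w' else 0)))"
  proof (intro rel_add rel_star cong_left y X)
    have "m \<noteq> k" "k \<le> m" using l by simp_all
    then show "tad q (?c / q) x w m \<approx> 0" using assms unfolding cq spread_def by metis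
    show "tad q ?c x w l \<approx> (if l = k then w' else 0)" using assms l(2) unfolding c spread_def by blast
  qed
  also have "y * 0 + (?c / q) \<star> (X * (if l = k then w' else 0)) = (if m = Suc k then X * w' else 0)"
    unfolding cq by (simp add: l(1))
  finally show "tad q ?c x (y * w) m \<approx> (if m = Suc k then X * w' else 0)" .
qed

lemma spread_z:
  assumes "spread w w' k" "z \<in> fst R" "x * z \<approx> z * x" shows "spread (z * w) (z * w') k"
  unfolding spread_def
proof (intro conjI allI impI)
  have w: "w \<in> fst R" "w' \<in> fst R" using assms by (simp_all add: spread_def)
  then show "z * w \<in> fst R" "z * w' \<in> fst R" using assms by simp_all
  fix m assume m: "k \<le> m"
  let ?c = "q powi (int k - int m + 1)"
  have "tad q ?c x (z * w) m \<approx> z * tad q ?c x w m"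
    by (rule tad_commute_left) (use assms w x in auto)
  also have "rel A R R \<dots> (z * (if m = k then w' else 0))"
    by (rule cong_left) (use assms m in \<open>auto simp: spread_def\<close>)
  finally show "tad q ?c x (z * w) m \<approx> (if m = k then z * w' else 0)" by (simp split: if_splits)
qed

lemma spread_power: "spread w w' k \<Longrightarrow> spread (y ^ i * w) (X ^ i * w') (i + k)"
  by (induction i) (auto dest: spread_y simp: mult.assoc)

text \<open>Each term \<open>y ^ r * z * y ^ (n - r)\<close> of the inner sum has \<open>n\<close> letters \<open>y\<close>, and the outer sum has order \<open>n\<close>. Since
  \<open>x\<close> commutes with \<open>z\<close>, the outer sum turns every \<open>y\<close> into \<open>X\<close> and leaves \<open>z\<close> in its place.\<close>

lemma tad_tad:
  assumes z: "z \<in> fst R" "x * z \<approx> z * x"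
  shows "tad q q x (tad q q y z n) n \<approx> tad q q X z n"
proof -
  have monomial: "tad q q x (y ^ r * z * y ^ (n - r)) n \<approx> X ^ r * z * X ^ (n - r)" if "r \<le> n" for r
  proof -
    have "spread (y ^ r * (z * (y ^ (n - r) * 1))) (X ^ r * (z * (X ^ (n - r) * 1))) (r + (n - r + 0))"
      by (intro spread_power spread_z spread_1 z)
    then have "spread (y ^ r * z * y ^ (n - r)) (X ^ r * z * X ^ (n - r)) n"
      using that by (simp add: mult.assoc)
    then have "tad q (q powi (int n - int n + 1)) x (y ^ r * z * y ^ (n - r)) n
        \<approx> (if n = n then X ^ r * z * X ^ (n - r) else 0)"
      unfolding spread_def by blast
    then show ?thesis by simp
  qed
  show ?thesis
    unfolding tad_def[of q q y] tad_def[of q q X] tad_sum tad_star_right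
    by (intro cong_sum rel_star monomial)
qed

end

section \<open>Integer multiples and root data\<close>

lemma zmul_add_one: "zmul (n + 1) y = zmul n y + y"
proof (cases "n \<ge> 0")
  case True
  then have "nat (n + 1) = Suc (nat n)" by simp
  then show ?thesis using True by (simp add: zmul_def)
next
  case False
  then have "nat (- n) = Suc (nat (- (n + 1)))" "nat n = 0" "nat (n + 1) = 0" by simp_all
  then show ?thesis by (simp only: zmul_def) simp
qed

lemma zmul_0 [simp]: "zmul 0 y = 0"
  by (simp add: zmul_def)

lemma zmul_1 [simp]: "zmul 1 y = y"
  using zmul_add_one[of 0 y] by simp

lemma zmul_diff_one: "zmul (n - 1) y = zmul n y - y"
  using zmul_add_one[of "n - 1" y] by simp

lemma zmul_add: "zmul (m + n) y = zmul m y + zmul n y"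
proof (induction m rule: int_induct[of _ 0])
  case (step1 i)
  then show ?case using zmul_add_one[of "i + n" y] zmul_add_one[of i y] by (simp add: algebra_simps)
next
  case (step2 i)
  have "zmul (i - 1 + n) y = zmul (i + n) y - y"
    using zmul_diff_one[of "i + n" y] by (simp add: algebra_simps)
  also have "\<dots> = zmul i y - y + zmul n y" using step2 by simp
  finally show ?case unfolding zmul_diff_one .
qed simp

lemma zmul_minus: "zmul (- n) y = - zmul n y"
  using zmul_add[of n "- n" y] by (simp add: eq_neg_iff_add_eq_0 add.commute)

lemma zmul_plus: "zmul n (y + z) = zmul n y + zmul n z"
  by (simp add: zmul_def sum.distrib)

lemma additive_zmul:
  fixes f :: "'a::ab_group_add \<Rightarrow> int"
  assumes "additive f" shows "f (zmul n y) = n * f y"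
proof -
  have add: "f (u + w) = f u + f w" for u w using assms by (simp add: additive_def)
  have "f 0 = 0" using add[of 0 0] by simp
  then show ?thesis
  proof (induction n rule: int_induct[of _ 0])
    case (step1 i)
    then show ?case unfolding zmul_add_one add by (simp add: algebra_simps)
  next
    case (step2 i)
    have "f (zmul (i - 1) y) + f y = f (zmul i y)" unfolding add[symmetric] by (simp add: zmul_diff_one)
    then show ?case using step2 by (simp add: algebra_simps)
  qed simp
qed

section \<open>The free algebra and the quantum group as algebras\<close>

lemma free_alg_simps [simp]:
  "mult (free_alg I) = (*)" "one (free_alg I) = 1" "zero (free_alg I) = 0" "add (free_alg I) = (+)"
  "smult (free_alg I) = (\<star>)"
  by (simp_all add: free_alg_def star_def fun_eq_iff)

lemma subalg_free: "subalg (carrier (free_alg I :: (qv, ('i, 'y) free) module))"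
proof -
  have sc: "sc c \<in> carrier (free_alg I :: (qv, ('i, 'y) free) module)" for c
    by (auto simp: free_alg_def sc_def zero_word_def)
  have mult: "p * q \<in> carrier (free_alg I)"
    if "p \<in> carrier (free_alg I)" "q \<in> carrier (free_alg I)" for p q :: "('i, 'y) free"
    using that keys_mult[of p q] by (force simp: free_alg_def plus_word_def)
  have "p + q \<in> carrier (free_alg I)"
    if "p \<in> carrier (free_alg I)" "q \<in> carrier (free_alg I)" for p q :: "('i, 'y) free"
    using that Poly_Mapping.keys_add[of p q] by (force simp: free_alg_def)
  moreover have "(1 :: ('i, 'y) free) \<in> carrier (free_alg I)" using sc[of 1] by (simp add: sc_def)
  ultimately show ?thesis unfolding subalg_def star_def using sc mult by blast
qed

lemma qalg_free: "qalg (free_alg I :: (qv, ('i, 'y) free) module)" (is "qalg ?A")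
proof -
  have "subalg (carrier ?A)" by (rule subalg_free)
  note C = this[unfolded subalg_def]
  have "\<exists>q\<in>carrier ?A. q + p = 0" if "p \<in> carrier ?A" for p
  proof
    show "(- 1) \<star> p \<in> carrier ?A" using C that by blast
  qed (simp add: minus_star)
  moreover have "0 \<star> 1 \<in> carrier ?A" using C by blast
  ultimately have "abelian_group ?A"
    by (intro abelian_groupI) (use C in \<open>auto simp: add_ac\<close>)
  moreover have "Group.monoid ?A"
    by (rule monoidI) (use C in \<open>auto simp: mult.assoc\<close>)
  ultimately have "ring ?A"
    by (intro ringI) (auto simp: algebra_simps)
  then show ?thesis using C by (simp add: qalg_def star_add star_mult_left star_mult_right)
qed

lemma rep_free: "rep (free_alg I) (carrier (free_alg I), \<lambda>p. p)"
  using subalg_free qalg_free by (auto simp: rep_def)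

text \<open>Every polynomial is a combination of words, and every word is a product of generators.\<close>

lemma free_alg_least:
  fixes C :: "('i, 'y) free set"
  assumes C: "subalg C" and gen: "gE ` I \<subseteq> C" "gF ` I \<subseteq> C" "range gK \<subseteq> C"
  shows "carrier (free_alg I) \<subseteq> C"
proof
  fix p :: "('i, 'y) free" assume p: "p \<in> carrier (free_alg I)"
  have word: "Poly_Mapping.single (Word gs) 1 \<in> C" if "set gs \<subseteq> gens I" for gs :: "('i, 'y) gen list"
    using that
  proof (induction gs)
    case Nil
    then show ?case using C by (simp add: subalg_def flip: zero_word_def)
  next
    case (Cons g gs)
    have "Poly_Mapping.single (Word (g # gs)) (1 :: qv) = Poly_Mapping.single (Word [g]) 1 * Poly_Mapping.single (Word gs) 1"
      by (simp add: mult_single plus_word_def)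
    moreover have "Poly_Mapping.single (Word [g]) 1 \<in> C"
      using Cons(2) gen by (auto simp: gens_def gE_def gF_def gK_def)
    ultimately show ?case using Cons C by (simp add: subalg_def)
  qed
  have monomial: "Poly_Mapping.single w (Poly_Mapping.lookup p w) \<in> C" if "w \<in> Poly_Mapping.keys p" for w
  proof -
    have "Poly_Mapping.single w (Poly_Mapping.lookup p w) =
        Poly_Mapping.lookup p w \<star> Poly_Mapping.single (Word (letters w)) 1"
      by (simp add: star_def sc_def mult_single)
    moreover have "Poly_Mapping.single (Word (letters w)) 1 \<in> C"
      using word[of "letters w"] p that by (auto simp: free_alg_def)
    ultimately show ?thesis using C unfolding subalg_def by metis
  qed
  have "(\<Sum>w\<in>K. Poly_Mapping.single w (Poly_Mapping.lookup p w)) \<in> C"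
    if "finite K" "K \<subseteq> Poly_Mapping.keys p" for K
    using that
  proof (induction K rule: finite_induct)
    case empty
    have "0 \<star> 1 \<in> C" using C unfolding subalg_def by blast
    then show ?case by simp
  next
    case (insert w K)
    then show ?case using C monomial by (simp add: subalg_def)
  qed
  then have "(\<Sum>w\<in>Poly_Mapping.keys p. Poly_Mapping.single w (Poly_Mapping.lookup p w)) \<in> C" by simp
  moreover have "(\<Sum>w\<in>Poly_Mapping.keys p. Poly_Mapping.single w (Poly_Mapping.lookup p w)) = p"
    by (rule poly_mapping_eqI) (simp add: lookup_sum lookup_single when_def in_keys_iff)
  ultimately show "p \<in> C" by simp
qed

lemma gen_in_free [simp]:
  "i \<in> I \<Longrightarrow> gE i \<in> carrier (free_alg I)" "i \<in> I \<Longrightarrow> gF i \<in> carrier (free_alg I)" "gK \<mu> \<in> carrier (free_alg I)"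
  by (auto simp: free_alg_def gE_def gF_def gK_def gens_def)

text \<open>The flag selects which generators play the part of \<open>E\<close>: \<open>up s\<close> stands for the raising and \<open>up (\<not> s)\<close> for the
  lowering generators. With \<open>s = False\<close> and inverted torus elements the defining relations of the quantum group keep
  their form, and the two kinds of operators are exchanged.\<close>

definition up :: "bool \<Rightarrow> 'i \<Rightarrow> ('i, 'y) free" where
  "up s i = (if s then gE i else gF i)"

definition tor :: "bool \<Rightarrow> 'y::ab_group_add \<Rightarrow> ('i, 'y) free" where
  "tor s \<mu> = gK (if s then \<mu> else - \<mu>)"

abbreviation ktor :: "bool \<Rightarrow> ('i, 'y::ab_group_add, 'x) root_datum \<Rightarrow> int \<Rightarrow> 'i \<Rightarrow> ('i, 'y) free" where
  "ktor s D e i \<equiv> tor s (zmul (e * (form D i i div 2)) (coroot D i))"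

definition is_T :: "bool \<Rightarrow> ('i, 'y::ab_group_add, 'x) root_datum \<Rightarrow> int \<Rightarrow> 'i
      \<Rightarrow> (('i, 'y) free set \<Rightarrow> ('i, 'y) free set) \<Rightarrow> bool" where
  "is_T s D e i T = (if s then is_T1 D e i T else is_T2 D e i T)"

text \<open>For \<open>s = False\<close> the inversion of the torus elements reverses the sign of the exponent.\<close>

lemma Kt_eq_ktor: "Kt D e i = ktor s D (if s then e else - e) i"
  by (simp add: Kt_def tor_def zmul_minus)

text \<open>The axioms of a root datum that enter the relations of the quantum group and the formulas for its operators. They pass to the
  contracted datum.\<close>

locale quantum_group =
  fixes D :: "('i, 'y::ab_group_add, 'x::ab_group_add) root_datum"
  assumes cartan: "cartan_datum (idx D) (form D)"
    and additive1: "additive (pairing D y)" and additive2: "additive (\<lambda>y. pairing D y x)"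
    and cart_form: "i \<in> idx D \<Longrightarrow> j \<in> idx D \<Longrightarrow> cart D i j = 2 * form D i j div form D i i"
begin

lemma pairing_simps:
  "pairing D (y + z) x = pairing D y x + pairing D z x" "pairing D y (w + x) = pairing D y w + pairing D y x"
  "pairing D (- y) x = - pairing D y x" "pairing D (y - z) x = pairing D y x - pairing D z x"
  "pairing D (zmul n y) x = n * pairing D y x"
  using additive.add[OF additive1] additive.add[OF additive2[of x]] additive.minus[OF additive2[of x]]
    additive.diff[OF additive2[of x]] additive_zmul[OF additive2[of x]] by simp_all

lemma form_pos: "i \<in> idx D \<Longrightarrow> form D i i > 0" and form_even: "i \<in> idx D \<Longrightarrow> even (form D i i)"
  and form_sym: "i \<in> idx D \<Longrightarrow> j \<in> idx D \<Longrightarrow> form D i j = form D j i"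
  using cartan by (auto simp: cartan_datum_def)

lemma cart_self: "i \<in> idx D \<Longrightarrow> cart D i i = 2"
  using form_pos[of i] by (simp add: cart_form)

lemma cart_nonpos: "i \<in> idx D \<Longrightarrow> j \<in> idx D \<Longrightarrow> i \<noteq> j \<Longrightarrow> cart D i j \<le> 0"
  using cartan by (simp add: cart_form cartan_datum_def)

lemma cart_0_iff:
  assumes "i \<in> idx D" "j \<in> idx D" "i \<noteq> j" shows "cart D i j = 0 \<longleftrightarrow> form D i j = 0"
proof -
  have "form D i i dvd 2 * form D i j" using cartan assms by (simp add: cartan_datum_def)
  then show ?thesis using form_pos[OF assms(1)] assms by (auto simp: cart_form dvd_div_eq_0_iff)
qed

lemma aperiodic_vi: "i \<in> idx D \<Longrightarrow> aperiodic (vi D i)"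
  using form_pos[of i] form_even[of i] unfolding vi_def
  by (intro aperiodic_powi aperiodic_vv) (auto elim: evenE)

abbreviation UR where "UR \<equiv> (carrier (free_alg (idx D)), cls D)"

lemma gens_closed [simp]:
  "i \<in> idx D \<Longrightarrow> up s i \<in> carrier (free_alg (idx D))" "tor s \<mu> \<in> carrier (free_alg (idx D))"
  by (simp_all add: up_def tor_def)

lemma ideal_U: "ideal (U_ideal D) (free_alg (idx D))" and U_rels_closed: "U_rels D \<subseteq> carrier (free_alg (idx D))"
proof -
  interpret F: congruence "free_alg (idx D)" "(carrier (free_alg (idx D)), \<lambda>p. p)"
    by unfold_locales (rule rep_free)
  note cl [simp] = F.closed[simplified] F.closed'[simplified]
  have [simp]: "sc c * p \<in> carrier (free_alg (idx D))" if "p \<in> carrier (free_alg (idx D))" for c p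
    using that by (simp add: sc_mult_star)
  have [simp]: "Kt D e i \<in> carrier (free_alg (idx D))" for e i by (simp add: Kt_def)
  show *: "U_rels D \<subseteq> carrier (free_alg (idx D))"
    unfolding U_rels_def by (auto simp: rsum_eq_tad)
  interpret ring "free_alg (idx D)" by (rule qalg_ring[OF qalg_free])
  show "ideal (U_ideal D) (free_alg (idx D))" unfolding U_ideal_def by (rule genideal_ideal[OF *])
qed

lemma qalg_U: "qalg (U D)"
  unfolding U_def by (rule qalg_quot_alg[OF qalg_free ideal_U])

lemma rep_U: "rep (U D) UR"
proof -
  have "rep (U D) (carrier (free_alg (idx D)), (\<lambda>x. U_ideal D +>\<^bsub>free_alg (idx D)\<^esub> x) \<circ> (\<lambda>p. p))"
    using rep_compose[OF rep_free coset_hom[OF qalg_free ideal_U] qalg_U[unfolded U_def]] by (simp add: U_def)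
  moreover have "(\<lambda>x. U_ideal D +>\<^bsub>free_alg (idx D)\<^esub> x) \<circ> (\<lambda>p. p) = cls D"
    by (simp add: fun_eq_iff cls_def)
  ultimately show ?thesis by simp
qed

lemma carrier_U: "carrier (U D) = cls D ` carrier (free_alg (idx D))"
  unfolding U_def carrier_quot_alg cls_def ..

sublocale congruence "U D" UR
  by unfold_locales (rule rep_U)

abbreviation congruent_in_U :: "('i, 'y) free \<Rightarrow> ('i, 'y) free \<Rightarrow> bool" (infix \<open>\<approx>\<close> 50)
  where "p \<approx> q \<equiv> rel (U D) UR UR p q"

lemma relation:
  assumes "p - q \<in> U_rels D" "p \<in> carrier (free_alg (idx D))" "q \<in> carrier (free_alg (idx D))"
  shows "p \<approx> q"
proof -
  interpret F: ring "free_alg (idx D)" by (rule qalg_ring[OF qalg_free])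
  have "p - q \<in> U_ideal D" using assms(1) F.genideal_self[OF U_rels_closed] by (auto simp: U_ideal_def)
  moreover have "p = (p - q) \<oplus>\<^bsub>free_alg (idx D)\<^esub> q" by simp
  then have "p \<ominus>\<^bsub>free_alg (idx D)\<^esub> q = p - q"
    using assms closed' by (metis F.add.inv_closed F.add.m_assoc F.minus_eq F.r_neg F.r_zero closed'(3) fst_conv)
  ultimately have "cls D p = cls D q"
    unfolding cls_def using coset_eq_iff[OF ideal_U assms(2,3)] by simp
  then show ?thesis using assms by (simp add: cong_iff)
qed

lemma tor_add: "tor s \<mu> * tor s \<nu> \<approx> tor s (\<mu> + \<nu>)"
proof -
  have "gK \<mu> * gK \<nu> \<approx> gK (\<mu> + \<nu>)" for \<mu> \<nu>
  proof (rule relation)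
    show "gK \<mu> * gK \<nu> - gK (\<mu> + \<nu>) \<in> U_rels D" unfolding U_rels_def by blast
  qed (use closed in auto)
  from this[of \<mu> \<nu>] this[of "- \<mu>" "- \<nu>"] show ?thesis by (simp add: tor_def)
qed

lemma tor_0: "tor s 0 \<approx> 1"
proof (rule relation)
  have "gK 0 - 1 \<in> U_rels D" unfolding U_rels_def by blast
  then show "tor s 0 - 1 \<in> U_rels D" by (simp add: tor_def)
qed (use closed in auto)

lemma gK_gE: "i \<in> idx D \<Longrightarrow> gK \<mu> * gE i \<approx> (vv powi pairing D \<mu> (root D i)) \<star> (gE i * gK \<mu>)"
proof (rule relation)
  assume "i \<in> idx D"
  then have "gK \<mu> * gE i - sc (vv powi pairing D \<mu> (root D i)) * gE i * gK \<mu> \<in> U_rels D"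
    unfolding U_rels_def by blast
  then show "gK \<mu> * gE i - (vv powi pairing D \<mu> (root D i)) \<star> (gE i * gK \<mu>) \<in> U_rels D"
    by (simp only: star_def mult.assoc)
qed (use closed in auto)

lemma gK_gF: "i \<in> idx D \<Longrightarrow> gK \<mu> * gF i \<approx> (vv powi (- pairing D \<mu> (root D i))) \<star> (gF i * gK \<mu>)"
proof (rule relation)
  assume "i \<in> idx D"
  then have "gK \<mu> * gF i - sc (vv powi (- pairing D \<mu> (root D i))) * gF i * gK \<mu> \<in> U_rels D"
    unfolding U_rels_def by blast
  then show "gK \<mu> * gF i - (vv powi (- pairing D \<mu> (root D i))) \<star> (gF i * gK \<mu>) \<in> U_rels D"
    by (simp only: star_def mult.assoc)
qed (use closed in auto)

lemma tor_up: "i \<in> idx D \<Longrightarrow> tor s \<mu> * up s i \<approx> (vv powi pairing D \<mu> (root D i)) \<star> (up s i * tor s \<mu>)"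
  using gK_gE[of i \<mu>] gK_gF[of i "- \<mu>"] by (simp add: tor_def up_def pairing_simps)

lemma tor_down: "i \<in> idx D \<Longrightarrow> tor s \<mu> * up (\<not> s) i \<approx> (vv powi (- pairing D \<mu> (root D i))) \<star> (up (\<not> s) i * tor s \<mu>)"
  using gK_gE[of i "- \<mu>"] gK_gF[of i "\<mu>"] by (simp add: tor_def up_def pairing_simps)

lemma gE_gF:
  assumes "i \<in> idx D" "j \<in> idx D"
  shows "gE i * gF j - gF j * gE i \<approx>
    (if i = j then inverse (vi D i - inverse (vi D i)) \<star> (Kt D 1 i - Kt D (-1) i) else 0)"
proof (rule relation)
  have "gE i * gF j - gF j * gE i
      - (if i = j then sc (inverse (vi D i - inverse (vi D i))) * (Kt D 1 i - Kt D (-1) i) else 0) \<in> U_rels D"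
    unfolding U_rels_def using assms by blast
  then show "gE i * gF j - gF j * gE i
      - (if i = j then inverse (vi D i - inverse (vi D i)) \<star> (Kt D 1 i - Kt D (-1) i) else 0) \<in> U_rels D"
    by (simp only: star_def)
qed (use assms closed closed' in \<open>auto simp: Kt_def\<close>)

lemma up_down_commute:
  assumes "i \<in> idx D" "j \<in> idx D" "i \<noteq> j" shows "up s i * up (\<not> s) j \<approx> up (\<not> s) j * up s i"
proof -
  have *: "gE i * gF j \<approx> gF j * gE i" if "i \<in> idx D" "j \<in> idx D" "i \<noteq> j" for i j
    using rel_add[OF gE_gF[OF that(1,2)] cong_refl, of "gF j * gE i"] that closed by simp
  show ?thesis using *[of i j] rel_sym[OF *[of j i]] assms by (simp add: up_def)
qed

text \<open>Replacing \<open>v\<^sub>i\<close> by its inverse and exchanging the two torus elements changes the sign twice. In this form the relation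
  depends on \<open>e\<close> only through \<open>v\<^sub>i\<close> to the power \<open>e\<close>.\<close>

lemma up_down_commutator:
  assumes "i \<in> idx D" "e \<in> {1, -1}"
  shows "up s i * up (\<not> s) i - up (\<not> s) i * up s i \<approx>
    inverse (vi D i powi e - inverse (vi D i powi e)) \<star> (ktor s D e i - ktor s D (- e) i)"
proof -
  let ?c = "inverse (vi D i - inverse (vi D i))"
  have neg: "inverse (inverse a - a) \<star> (u - w) = inverse (a - inverse a) \<star> (w - u)" for a and u w :: "('i, 'y) free"
  proof -
    have "inverse (inverse a - a) = - inverse (a - inverse a)" by (metis inverse_minus_eq minus_diff_eq)
    then show ?thesis by (simp add: minus_star star_diff)
  qed
  have "up s i * up (\<not> s) i - up (\<not> s) i * up s i \<approx> ?c \<star> (ktor s D 1 i - ktor s D (- 1) i)"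
  proof (cases s)
    case True
    then show ?thesis using gE_gF[OF assms(1,1)] by (simp add: up_def Kt_eq_ktor[of D _ i True])
  next
    case False
    then show ?thesis using rel_minus[OF gE_gF[OF assms(1,1)]]
      by (simp add: up_def Kt_eq_ktor[of D _ i False] star_diff)
  qed
  then show ?thesis using assms(2) by (auto simp: neg power_int_minus)
qed

lemma serre:
  assumes "i \<in> idx D" "j \<in> idx D" "i \<noteq> j"
  shows "tad (vi D i) 1 (up s i) (up s j) (nat (1 - cart D i j)) \<approx> 0"
proof -
  have eq: "tad (vi D i) 1 x y n = (- 1) ^ n \<star> rsum D i 1 x y n" for x y :: "('i, 'y) free" and n
    by (simp add: rsum_eq_tad star_star flip: power_mult_distrib)
  have "rsum D i 1 (up s i) (up s j) (nat (1 - cart D i j)) \<approx> 0"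
  proof (rule relation)
    have "rsum D i 1 (gE i) (gE j) (nat (1 - cart D i j)) \<in> U_rels D"
      "rsum D i 1 (gF i) (gF j) (nat (1 - cart D i j)) \<in> U_rels D"
      unfolding U_rels_def using assms by blast+
    then show "rsum D i 1 (up s i) (up s j) (nat (1 - cart D i j)) - 0 \<in> U_rels D"
      by (simp add: up_def)
  qed (use assms closed closed' in \<open>simp_all add: rsum_eq_tad\<close>)
  then show ?thesis unfolding eq using rel_star by fastforce
qed

lemma up_commute:
  assumes "i \<in> idx D" "j \<in> idx D" "i \<noteq> j" "cart D i j = 0"
  shows "up s i * up s j \<approx> up s j * up s i"
proof -
  have "up s j * up s i - up s i * up s j \<approx> 0"
    using serre[OF assms(1-3), of s] by (simp add: assms(4) tad_1[OF aperiodic_vi[OF assms(1)]])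
  from rel_add[OF this cong_refl, of "up s i * up s j"] show ?thesis
    using assms closed by (simp add: rel_sym)
qed

context
  fixes e :: int and i :: 'i and T s
  assumes T: "is_T s D e i T" and i: "i \<in> idx D"
begin

abbreviation TR where "TR \<equiv> (carrier (free_alg (idx D)), T \<circ> cls D)"

lemma T_hom: "T \<in> alg_hom (U D) (U D)"
  using T by (auto simp: is_T_def is_T1_def is_T2_def split: if_splits)

lemma rep_T: "rep (U D) TR"
  using rep_compose[OF rep_U T_hom qalg_U] by simp

lemma T_tor: "rel (U D) TR UR (tor s \<mu>) (tor s (refl D i \<mu>))"
proof -
  have "refl D i (- \<mu>) = - refl D i \<mu>"
    by (simp add: refl_def pairing_simps zmul_minus)
  then show ?thesis using T rep_T rep_U 
    by (auto simp: rel_def is_T_def is_T1_def is_T2_def tor_def split: if_splits)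
qed

lemma T_up_self: "rel (U D) TR UR (up s i) (- (ktor s D e i * up (\<not> s) i))"
proof -
  have "T (cls D (up s i)) = cls D (- (ktor s D e i * up (\<not> s) i))"
    using T by (cases s) (simp_all add: is_T_def is_T1_def is_T2_def up_def Kt_eq_ktor[of D _ i s])
  then show ?thesis using rep_T rep_U i closed closed' by (simp add: rel_def)
qed

lemma T_down_self: "rel (U D) TR UR (up (\<not> s) i) (- (up s i * ktor s D (- e) i))"
proof -
  have "T (cls D (up (\<not> s) i)) = cls D (- (up s i * ktor s D (- e) i))"
    using T by (cases s) (simp_all add: is_T_def is_T1_def is_T2_def up_def Kt_eq_ktor[of D _ i s])
  then show ?thesis using rep_T rep_U i closed closed' by (simp add: rel_def)
qed

lemma T_up:
  assumes "j \<in> idx D" "j \<noteq> i"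
  shows "rel (U D) TR UR (up s j) (tad (vi D i) (vi D i powi e) (up s i) (up s j) (nat (- cart D i j)))"
proof -
  have "vi D i powi e \<noteq> 0" using aperiodic_vi[OF i] by (simp add: aperiodic_def)
  then have "T (cls D (up s j)) = cls D (tad (vi D i) (vi D i powi e) (up s i) (up s j) (nat (- cart D i j)))"
    using T assms by (cases s) (simp_all add: is_T_def is_T1_def is_T2_def up_def lsum_eq_tad)
  then show ?thesis using rep_T rep_U i closed closed' assms by (simp add: rel_def)
qed

lemma T_down:
  assumes "j \<in> idx D" "j \<noteq> i"
  shows "rel (U D) TR UR (up (\<not> s) j) ((- inverse (vi D i powi e)) ^ nat (- cart D i j) \<star>
    tad (vi D i) (vi D i powi e) (up (\<not> s) i) (up (\<not> s) j) (nat (- cart D i j)))"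
proof -
  have "vi D i powi e \<noteq> 0" using aperiodic_vi[OF i] by (simp add: aperiodic_def)
  then have "T (cls D (up (\<not> s) j)) = cls D ((- inverse (vi D i powi e)) ^ nat (- cart D i j) \<star>
    tad (vi D i) (vi D i powi e) (up (\<not> s) i) (up (\<not> s) j) (nat (- cart D i j)))"
    using T assms
    by (cases s) (simp_all add: is_T_def is_T1_def is_T2_def up_def rsum_eq_tad power_int_minus)
  then show ?thesis using rep_T rep_U i closed closed' assms by (simp add: rel_def)
qed

end

end

section \<open>Two operators joined by a simple edge\<close>

context congruence
begin

lemma cong_context:
  assumes "p \<approx> q" "u \<in> fst R" "w \<in> fst R" shows "u * p * w \<approx> u * q * w"
  using assms by (simp add: cong_left cong_right)

text \<open>For an edge with ends \<open>a\<close> and \<open>b\<close>, the left-hand side is \<open>T\<^sub>a(E\<^sub>aE\<^sub>b - p E\<^sub>bE\<^sub>a)\<close>, so this is \<open>T\<^sub>aT\<^sub>b(E\<^sub>a) = E\<^sub>b\<close>. Moving \<open>k\<close> to the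
  left turns it into \<open>- k\<close> times the commutator of \<open>F\<^sub>a\<close> and \<open>W\<close>. In this commutator only the bracket of \<open>E\<^sub>a\<close> and
  \<open>F\<^sub>a\<close> contributes, and the coefficient of \<open>k\<close> in it cancels, which leaves a multiple of \<open>E\<^sub>b k'\<close>.\<close>

lemma edge_up:
  assumes in_C: "k \<in> fst R" "k' \<in> fst R" "Ea \<in> fst R" "Eb \<in> fst R" "Fa \<in> fst R"
    and p: "p \<noteq> 0" "p - inverse p \<noteq> 0"
    and kEa: "k * Ea \<approx> (p * p) \<star> (Ea * k)" and kEb: "k * Eb \<approx> inverse p \<star> (Eb * k)"
    and k'Eb: "k' * Eb \<approx> p \<star> (Eb * k')" and kk': "k * k' \<approx> 1"
    and h: "Ea * Fa - Fa * Ea \<approx> inverse (p - inverse p) \<star> (k - k')"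
    and comm: "Eb * Fa \<approx> Fa * Eb"
    and W: "W = Eb * Ea - p \<star> (Ea * Eb)"
  shows "(- (k * Fa)) * W - p \<star> (W * (- (k * Fa))) \<approx> Eb"
proof -
  let ?\<kappa> = "inverse (p - inverse p)"
  let ?H = "Ea * Fa - Fa * Ea"
  note [simp] = in_C
  have [simp]: "W \<in> fst R" by (simp add: W)
  have kW: "k * W \<approx> p \<star> (W * k)"
  proof -
    have 1: "k * (Eb * Ea) \<approx> p \<star> (Eb * Ea * k)"
    proof -
      have "k * (Eb * Ea) \<approx> (inverse p \<star> (Eb * k)) * Ea" using cong_right[OF kEb, of Ea] by (simp add: mult.assoc)
      also have "(inverse p \<star> (Eb * k)) * Ea = inverse p \<star> (Eb * (k * Ea))" by (simp add: star_simps mult.assoc)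
      also have "rel A R R \<dots> (inverse p \<star> (Eb * ((p * p) \<star> (Ea * k))))" by (intro rel_star cong_left kEa) simp
      also have "\<dots> = p \<star> (Eb * Ea * k)" using p by (simp add: star_simps mult.assoc[symmetric])
      finally show ?thesis .
    qed
    have 2: "k * (Ea * Eb) \<approx> p \<star> (Ea * Eb * k)"
    proof -
      have "k * (Ea * Eb) \<approx> ((p * p) \<star> (Ea * k)) * Eb" using cong_right[OF kEa, of Eb] by (simp add: mult.assoc)
      also have "((p * p) \<star> (Ea * k)) * Eb = (p * p) \<star> (Ea * (k * Eb))" by (simp add: star_simps mult.assoc)
      also have "rel A R R \<dots> ((p * p) \<star> (Ea * (inverse p \<star> (Eb * k))))" by (intro rel_star cong_left kEb) simp
      also have "\<dots> = p \<star> (Ea * Eb * k)" using p by (simp add: star_simps mult.assoc)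
      finally show ?thesis .
    qed
    have "k * W = k * (Eb * Ea) - p \<star> (k * (Ea * Eb))" by (simp add: W algebra_simps star_simps)
    also have "rel A R R \<dots> (p \<star> (Eb * Ea * k) - p \<star> p \<star> (Ea * Eb * k))" by (intro rel_diff rel_star 1 2)
    also have "\<dots> = p \<star> (W * k)" by (simp add: W left_diff_distrib star_diff star_simps)
    finally show ?thesis .
  qed
  have HEb: "?H * Eb \<approx> ?\<kappa> \<star> (inverse p \<star> (Eb * k) - p \<star> (Eb * k'))"
  proof -
    have "?H * Eb \<approx> (?\<kappa> \<star> (k - k')) * Eb" by (rule cong_right[OF h]) simp
    also have "\<dots> = ?\<kappa> \<star> (k * Eb - k' * Eb)" by (simp add: star_simps left_diff_distrib)
    also have "rel A R R \<dots> (?\<kappa> \<star> (inverse p \<star> (Eb * k) - p \<star> (Eb * k')))" by (intro rel_star rel_diff kEb k'Eb)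
    finally show ?thesis .
  qed
  have bracket: "Fa * W - W * Fa \<approx> - (p \<star> (Eb * k'))"
  proof -
    have "Fa * W - W * Fa = (Fa * Eb) * Ea - p \<star> (Fa * Ea * Eb) - Eb * Ea * Fa + p \<star> (Ea * (Eb * Fa))"
      by (simp add: W algebra_simps star_simps)
    also have "rel A R R \<dots> ((Eb * Fa) * Ea - p \<star> (Fa * Ea * Eb) - Eb * Ea * Fa + p \<star> (Ea * (Fa * Eb)))"
      by (intro rel_add rel_diff rel_star cong_left cong_right comm rel_sym[OF comm] cong_refl) simp_all
    also have "\<dots> = p \<star> (?H * Eb) - Eb * ?H" by (simp add: algebra_simps star_diff)
    also have "rel A R R \<dots> (p \<star> ?\<kappa> \<star> (inverse p \<star> (Eb * k) - p \<star> (Eb * k')) - Eb * (?\<kappa> \<star> (k - k')))"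
      by (intro rel_diff rel_star HEb cong_left h) simp
    also have "\<dots> = ?\<kappa> \<star> (1 - p * p) \<star> (Eb * k')"
    proof -
      have c: "p * (inverse p * ?\<kappa>) = ?\<kappa>" using p by (simp add: field_simps)
      show ?thesis by (simp add: star_diff star_simps right_diff_distrib diff_star mult_ac, simp only: c)
    qed
    also have "?\<kappa> * (1 - p * p) = - p" using p by (simp add: field_simps)
    then have "?\<kappa> \<star> (1 - p * p) \<star> (Eb * k') = - (p \<star> (Eb * k'))" by (simp add: star_star minus_star)
    finally show ?thesis .
  qed
  have "(- (k * Fa)) * W - p \<star> (W * (- (k * Fa))) = p \<star> (W * k) * Fa - k * (Fa * W)"
    by (simp add: star_simps star_minus mult.assoc)
  also have "rel A R R \<dots> (k * W * Fa - k * (Fa * W))"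
    by (intro rel_diff cong_right rel_sym[OF kW] cong_refl) simp_all
  also have "\<dots> = - (k * (Fa * W - W * Fa))" by (simp add: algebra_simps)
  also have "rel A R R \<dots> (- (k * (- (p \<star> (Eb * k')))))" by (intro rel_minus cong_left bracket) simp
  also have "\<dots> = p \<star> (k * Eb * k')" by (simp add: star_simps mult.assoc)
  also have "rel A R R \<dots> (p \<star> (inverse p \<star> (Eb * k) * k'))" by (intro rel_star cong_right kEb) simp
  also have "\<dots> = Eb * (k * k')" using p by (simp add: star_simps mult.assoc)
  also have "rel A R R \<dots> (Eb * 1)" by (intro cong_left kk') simp
  finally show ?thesis by simp
qed

text \<open>The analogue of \<open>edge_up\<close> for the lowering generators, \<open>T\<^sub>aT\<^sub>b(F\<^sub>a) = F\<^sub>b\<close>. Here the coefficient of \<open>k'\<close> cancels.\<close>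

lemma edge_down:
  assumes in_C: "k \<in> fst R" "k' \<in> fst R" "Fa \<in> fst R" "Fb \<in> fst R" "Ea \<in> fst R"
    and p: "p \<noteq> 0" "p - inverse p \<noteq> 0"
    and k'Fa: "k' * Fa \<approx> (p * p) \<star> (Fa * k')" and k'Fb: "k' * Fb \<approx> inverse p \<star> (Fb * k')"
    and kFb: "k * Fb \<approx> p \<star> (Fb * k)" and kk': "k * k' \<approx> 1"
    and h: "Ea * Fa - Fa * Ea \<approx> inverse (p - inverse p) \<star> (k - k')"
    and comm: "Ea * Fb \<approx> Fb * Ea"
    and V: "V = Fa * Fb - inverse p \<star> (Fb * Fa)"
  shows "V * (- (Ea * k')) - inverse p \<star> ((- (Ea * k')) * V) \<approx> Fb"
proof -
  let ?\<kappa> = "inverse (p - inverse p)"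
  let ?H = "Ea * Fa - Fa * Ea"
  note [simp] = in_C
  have [simp]: "V \<in> fst R" by (simp add: V)
  have kV: "k' * V \<approx> p \<star> (V * k')"
  proof -
    have 1: "k' * (Fb * Fa) \<approx> p \<star> (Fb * Fa * k')"
    proof -
      have "k' * (Fb * Fa) \<approx> (inverse p \<star> (Fb * k')) * Fa" using cong_right[OF k'Fb, of Fa] by (simp add: mult.assoc)
      also have "(inverse p \<star> (Fb * k')) * Fa = inverse p \<star> (Fb * (k' * Fa))" by (simp add: star_simps mult.assoc)
      also have "rel A R R \<dots> (inverse p \<star> (Fb * ((p * p) \<star> (Fa * k'))))" by (intro rel_star cong_left k'Fa) simp
      also have "\<dots> = p \<star> (Fb * Fa * k')" using p by (simp add: star_simps mult.assoc[symmetric])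
      finally show ?thesis .
    qed
    have 2: "k' * (Fa * Fb) \<approx> p \<star> (Fa * Fb * k')"
    proof -
      have "k' * (Fa * Fb) \<approx> ((p * p) \<star> (Fa * k')) * Fb" using cong_right[OF k'Fa, of Fb] by (simp add: mult.assoc)
      also have "((p * p) \<star> (Fa * k')) * Fb = (p * p) \<star> (Fa * (k' * Fb))" by (simp add: star_simps mult.assoc)
      also have "rel A R R \<dots> ((p * p) \<star> (Fa * (inverse p \<star> (Fb * k'))))" by (intro rel_star cong_left k'Fb) simp
      also have "\<dots> = p \<star> (Fa * Fb * k')" using p by (simp add: star_simps mult.assoc)
      finally show ?thesis .
    qed
    have "k' * V = k' * (Fa * Fb) - inverse p \<star> (k' * (Fb * Fa))" by (simp add: V algebra_simps star_simps)
    also have "rel A R R \<dots> (p \<star> (Fa * Fb * k') - inverse p \<star> p \<star> (Fb * Fa * k'))" by (intro rel_diff rel_star 1 2)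
    also have "\<dots> = p \<star> (V * k')" by (simp add: V left_diff_distrib star_diff star_simps mult.commute)
    finally show ?thesis .
  qed
  have HFb: "?H * Fb \<approx> ?\<kappa> \<star> (p \<star> (Fb * k) - inverse p \<star> (Fb * k'))"
  proof -
    have "?H * Fb \<approx> (?\<kappa> \<star> (k - k')) * Fb" by (rule cong_right[OF h]) simp
    also have "\<dots> = ?\<kappa> \<star> (k * Fb - k' * Fb)" by (simp add: star_simps left_diff_distrib)
    also have "rel A R R \<dots> (?\<kappa> \<star> (p \<star> (Fb * k) - inverse p \<star> (Fb * k')))" by (intro rel_star rel_diff kFb k'Fb)
    finally show ?thesis .
  qed
  have bracket: "Ea * V - V * Ea \<approx> Fb * k"
  proof -
    have "Ea * V - V * Ea = Ea * Fa * Fb - inverse p \<star> ((Ea * Fb) * Fa) - Fa * (Fb * Ea) + inverse p \<star> (Fb * Fa * Ea)"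
      by (simp add: V algebra_simps star_simps)
    also have "rel A R R \<dots> (Ea * Fa * Fb - inverse p \<star> ((Fb * Ea) * Fa) - Fa * (Ea * Fb) + inverse p \<star> (Fb * Fa * Ea))"
      by (intro rel_add rel_diff rel_star cong_left cong_right comm rel_sym[OF comm] cong_refl) simp_all
    also have "\<dots> = ?H * Fb - inverse p \<star> (Fb * ?H)" by (simp add: algebra_simps star_diff)
    also have "rel A R R \<dots> (?\<kappa> \<star> (p \<star> (Fb * k) - inverse p \<star> (Fb * k')) - inverse p \<star> (Fb * (?\<kappa> \<star> (k - k'))))"
      by (intro rel_diff rel_star HFb cong_left h) simp
    also have "\<dots> = ?\<kappa> \<star> (p - inverse p) \<star> (Fb * k)"
      by (simp add: star_diff star_simps right_diff_distrib diff_star mult_ac)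
    also have "\<dots> = Fb * k" using p by (simp add: star_star)
    finally show ?thesis .
  qed
  have "V * (- (Ea * k')) - inverse p \<star> ((- (Ea * k')) * V) = inverse p \<star> (Ea * (k' * V)) - V * Ea * k'"
    by (simp add: star_simps star_minus mult.assoc)
  also have "rel A R R \<dots> (inverse p \<star> (Ea * (p \<star> (V * k'))) - V * Ea * k')"
    by (intro rel_diff rel_star cong_left kV cong_refl) simp_all
  also have "\<dots> = (Ea * V - V * Ea) * k'" using p by (simp add: star_simps left_diff_distrib mult.assoc)
  also have "rel A R R \<dots> (Fb * k * k')" by (intro cong_right bracket) simp
  also have "Fb * k * k' = Fb * (k * k')" by (simp add: mult.assoc)
  also have "rel A R R \<dots> (Fb * 1)" by (intro cong_left kk') simp
  finally show ?thesis by simp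
qed

end

context quantum_group
begin

lemma ktor_up:
  assumes "i \<in> idx D" "j \<in> idx D"
  shows "ktor s D e i * up s j \<approx> ((vi D i powi e) powi cart D i j) \<star> (up s j * ktor s D e i)"
  using tor_up[OF assms(2), of s "zmul (e * (form D i i div 2)) (coroot D i)"]
  by (simp add: pairing_simps vi_def mult_ac flip: power_int_mult)

lemma ktor_down:
  assumes "i \<in> idx D" "j \<in> idx D"
  shows "ktor s D e i * up (\<not> s) j \<approx> ((vi D i powi e) powi (- cart D i j)) \<star> (up (\<not> s) j * ktor s D e i)"
  using tor_down[OF assms(2), of s "zmul (e * (form D i i div 2)) (coroot D i)"]
  by (simp add: pairing_simps vi_def mult_ac flip: power_int_mult)

lemma ktor_inverse: "ktor s D e i * ktor s D (- e) i \<approx> 1"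
proof -
  let ?n = "e * (form D i i div 2)"
  have "ktor s D e i * ktor s D (- e) i \<approx> tor s (zmul ?n (coroot D i) + zmul (- e * (form D i i div 2)) (coroot D i))"
    by (rule tor_add)
  also have "zmul ?n (coroot D i) + zmul (- e * (form D i i div 2)) (coroot D i) = 0"
    by (simp add: zmul_minus)
  also have "tor s 0 \<approx> 1" by (rule tor_0)
  finally show ?thesis .
qed

text \<open>Quantum integers do not change when the parameter is inverted. Hence the single parameter \<open>v\<^sub>i\<close> to the power \<open>e\<close> can serve
  both for the divided powers and for the twist.\<close>

lemma tad_vi: "e \<in> {1, -1} \<Longrightarrow> tad (vi D i) c x y n = tad (vi D i powi e) c x y n"
  by (auto simp: power_int_minus tad_inverse)

abbreviation acts where "acts T p q \<equiv> rel (U D) (carrier (free_alg (idx D)), T \<circ> cls D) UR p q"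

lemma acts_compose:
  assumes "acts T p q" "acts T' q r" "T \<in> alg_hom (U D) (U D)" "T' \<in> alg_hom (U D) (U D)"
  shows "acts (T' \<circ> T) p r"
  using assms rep_compose[OF rep_U alg_hom_compose[OF assms(3,4)] qalg_U]
  by (simp add: rel_def)

end

locale braid_pair = quantum_group +
  fixes s :: bool and e :: int and a b :: 'a and Ta Tb :: "('a, 'b) free set \<Rightarrow> ('a, 'b) free set"
  assumes e: "e \<in> {1, -1}" and a: "a \<in> idx D" and b: "b \<in> idx D" and ab: "a \<noteq> b"
    and form_ab: "form D a a = form D b b" and cart_ab: "cart D a b = - 1" and cart_ba: "cart D b a = - 1"
    and Ta: "is_T s D e a Ta" and Tb: "is_T s D e b Tb"
begin

abbreviation p where "p \<equiv> vi D a powi e"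
abbreviation E where "E \<equiv> up s"
abbreviation F where "F \<equiv> up (\<not> s)"
abbreviation X where "X \<equiv> E a * E b - p \<star> (E b * E a)"
abbreviation Y where "Y \<equiv> F b * F a - inverse p \<star> (F a * F b)"

lemma vi_eq: "vi D b = vi D a"
  by (simp add: vi_def form_ab)

lemma swapped: "braid_pair D s e b a Tb Ta"
  by unfold_locales (use e a b ab form_ab cart_ab cart_ba Ta Tb in auto)

lemma aperiodic_p: "aperiodic p"
  using e by (intro aperiodic_powi aperiodic_vi a) auto

lemma p: "p \<noteq> 0" "p - inverse p \<noteq> 0"
  using aperiodic_nonzero[OF aperiodic_p] aperiodic_diff[OF aperiodic_p, of 1] by simp_all

lemma tad_p: "tad (vi D a) = tad p"
  by (intro ext) (rule tad_vi[OF e])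

lemma Ta_E:
  assumes "j \<in> idx D" "j \<noteq> a"
  shows "acts Ta (E j) (tad p p (E a) (E j) (nat (- cart D a j)))"
  using T_up[OF Ta a assms] by (simp only: tad_p)

lemma Ta_F:
  assumes "j \<in> idx D" "j \<noteq> a"
  shows "acts Ta (F j) ((- inverse p) ^ nat (- cart D a j) \<star> tad p p (F a) (F j) (nat (- cart D a j)))"
  using T_down[OF Ta a assms] by (simp only: tad_p)

lemma Ta_Eb: "acts Ta (E b) (E b * E a - p \<star> (E a * E b))"
  using Ta_E[of b] b ab by (simp add: cart_ab tad_1[OF aperiodic_p])

lemma Ta_Fb: "acts Ta (F b) (F a * F b - inverse p \<star> (F b * F a))"
  using Ta_F[of b] b ab p by (simp add: cart_ab tad_1[OF aperiodic_p] star_diff star_star minus_star)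

text \<open>\<open>X\<close> and \<open>Y\<close> are the images of \<open>E a\<close> and \<open>F a\<close> under the operator at \<open>b\<close>, so this and \<open>Ta_Y\<close> are the rank two
  identities in terms of the operators.\<close>

lemma Ta_X: "acts Ta X (E b)"
proof -
  have "acts Ta X ((- (ktor s D e a * F a)) * (E b * E a - p \<star> (E a * E b))
      - p \<star> ((E b * E a - p \<star> (E a * E b)) * (- (ktor s D e a * F a))))"
    by (intro rel_intros Ta_Eb T_up_self[OF Ta a])
  also have "rel (U D) UR UR \<dots> (E b)"
  proof (rule edge_up[OF _ _ _ _ _ p _ _ _ _ _ _ HOL.refl])
    show "ktor s D e a * ktor s D (- e) a \<approx> 1" by (rule ktor_inverse)
    show "E a * F a - F a * E a \<approx> inverse (p - inverse p) \<star> (ktor s D e a - ktor s D (- e) a)"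
      by (rule up_down_commutator[OF a e])
    show "E b * F a \<approx> F a * E b" by (rule up_down_commute[OF b a ab[symmetric]])
    show "ktor s D e a * E a \<approx> (p * p) \<star> (E a * ktor s D e a)"
      using ktor_up[OF a a, of s e] by (simp add: cart_self[OF a] power2_eq_square)
    show "ktor s D e a * E b \<approx> inverse p \<star> (E b * ktor s D e a)"
      using ktor_up[OF a b, of s e] by (simp add: cart_ab power_int_minus)
    show "ktor s D (- e) a * E b \<approx> p \<star> (E b * ktor s D (- e) a)"
      using ktor_up[OF a b, of s "- e"] by (simp add: cart_ab power_int_minus)
  qed (use a b in simp_all)
  finally show ?thesis .
qed

lemma Ta_Y: "acts Ta Y (F b)"
proof -
  have "acts Ta Y ((F a * F b - inverse p \<star> (F b * F a)) * (- (E a * ktor s D (- e) a))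
      - inverse p \<star> ((- (E a * ktor s D (- e) a)) * (F a * F b - inverse p \<star> (F b * F a))))"
    by (intro rel_intros Ta_Fb T_down_self[OF Ta a])
  also have "rel (U D) UR UR \<dots> (F b)"
  proof (rule edge_down[OF _ _ _ _ _ p _ _ _ _ _ _ HOL.refl])
    show "ktor s D e a * ktor s D (- e) a \<approx> 1" by (rule ktor_inverse)
    show "E a * F a - F a * E a \<approx> inverse (p - inverse p) \<star> (ktor s D e a - ktor s D (- e) a)"
      by (rule up_down_commutator[OF a e])
    show "E a * F b \<approx> F b * E a" by (rule up_down_commute[OF a b ab])
    show "ktor s D (- e) a * F a \<approx> (p * p) \<star> (F a * ktor s D (- e) a)"
      using ktor_down[OF a a, of s "- e"] by (simp add: cart_self[OF a] power_int_minus power2_eq_square)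
    show "ktor s D (- e) a * F b \<approx> inverse p \<star> (F b * ktor s D (- e) a)"
      using ktor_down[OF a b, of s "- e"] by (simp add: cart_ab power_int_minus)
    show "ktor s D e a * F b \<approx> p \<star> (F b * ktor s D e a)"
      using ktor_down[OF a b, of s e] by (simp add: cart_ab)
  qed (use a b in simp_all)
  finally show ?thesis .
qed

lemma Tb_Ea: "acts Tb (E a) X"
  using braid_pair.Ta_Eb[OF swapped] by (simp add: vi_eq)

lemma Tb_Fa: "acts Tb (F a) Y"
  using braid_pair.Ta_Fb[OF swapped] by (simp add: vi_eq)

lemma Tb_X': "acts Tb (E b * E a - p \<star> (E a * E b)) (E a)"
  using braid_pair.Ta_X[OF swapped] by (simp add: vi_eq)

lemma Tb_Y': "acts Tb (F a * F b - inverse p \<star> (F b * F a)) (F a)"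
  using braid_pair.Ta_Y[OF swapped] by (simp add: vi_eq)

abbreviation TTT where "TTT \<equiv> Ta \<circ> Tb \<circ> Ta"

lemma TTT_hom: "TTT \<in> alg_hom (U D) (U D)"
  using alg_hom_compose[OF T_hom[OF Ta a] alg_hom_compose[OF T_hom[OF Tb b] T_hom[OF Ta a]]] .

lemma acts_TTT:
  assumes "acts Ta x y" "acts Tb y z" "acts Ta z w" shows "acts TTT x w"
proof -
  note Ta' = T_hom[OF Ta a] and Tb' = T_hom[OF Tb b]
  have "acts (Ta \<circ> (Tb \<circ> Ta)) x w"
    by (rule acts_compose[OF acts_compose[OF assms(1,2) Ta' Tb'] assms(3) alg_hom_compose[OF Ta' Tb'] Ta'])
  then show ?thesis by (simp only: comp_assoc)
qed

lemma refl_coroot: "refl D a (refl D b (zmul n (coroot D a))) = zmul n (coroot D b)"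
proof -
  have "zmul (- n) y = - zmul n y" for y :: 'b by (rule zmul_minus)
  then show ?thesis
    by (simp add: refl_def pairing_simps cart_self a cart_ab cart_ba)
qed

text \<open>The product of the three reflections is the reflection in the sum of the two roots, which is the root of the contracted
  vertex.\<close>

lemma refl_refl_refl:
  "refl D a (refl D b (refl D a \<mu>)) =
    \<mu> - zmul (pairing D \<mu> (root D a) + pairing D \<mu> (root D b)) (coroot D a + coroot D b)"
proof -
  have sub: "zmul (m - n) y = zmul m y - zmul n y" for m n and y :: 'b
    using zmul_add[of m "- n" y] by (simp add: zmul_minus)
  show ?thesis
    by (simp add: refl_def pairing_simps cart_self a cart_ab cart_ba zmul_add sub zmul_plus zmul_minus)
qed

lemma TTT_tor: "acts TTT (tor s \<mu>) (tor s (\<mu> - zmul (pairing D \<mu> (root D a) + pairing D \<mu> (root D b))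
    (coroot D a + coroot D b)))"
  unfolding refl_refl_refl[symmetric]
  by (rule acts_TTT[OF T_tor[OF Ta a] T_tor[OF Tb b] T_tor[OF Ta a]])

lemma TTT_Ea: "acts TTT (E a) (- (ktor s D e b * F b))"
proof (rule acts_TTT[OF T_up_self[OF Ta a]])
  show "acts Tb (- (ktor s D e a * F a)) (- (tor s (refl D b (zmul (e * (form D a a div 2)) (coroot D a))) * Y))"
    by (intro rel_intros T_tor[OF Tb b] Tb_Fa)
  have "acts Ta (- (tor s (refl D b (zmul (e * (form D a a div 2)) (coroot D a))) * Y))
    (- (tor s (refl D a (refl D b (zmul (e * (form D a a div 2)) (coroot D a)))) * F b))"
    by (intro rel_minus rel_mult T_tor[OF Ta a] Ta_Y)
  then show "acts Ta (- (tor s (refl D b (zmul (e * (form D a a div 2)) (coroot D a))) * Y)) (- (ktor s D e b * F b))"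
    unfolding refl_coroot form_ab .
qed

lemma TTT_Eb: "acts TTT (E b) (- (ktor s D e a * F a))"
  by (rule acts_TTT[OF Ta_Eb Tb_X' T_up_self[OF Ta a]])

lemma TTT_Fa: "acts TTT (F a) (- (E b * ktor s D (- e) b))"
proof (rule acts_TTT[OF T_down_self[OF Ta a]])
  show "acts Tb (- (E a * ktor s D (- e) a)) (- (X * tor s (refl D b (zmul (- e * (form D a a div 2)) (coroot D a)))))"
    by (intro rel_intros T_tor[OF Tb b] Tb_Ea)
  have "acts Ta (- (X * tor s (refl D b (zmul (- e * (form D a a div 2)) (coroot D a)))))
    (- (E b * tor s (refl D a (refl D b (zmul (- e * (form D a a div 2)) (coroot D a))))))"
    by (intro rel_minus rel_mult T_tor[OF Ta a] Ta_X)
  then show "acts Ta (- (X * tor s (refl D b (zmul (- e * (form D a a div 2)) (coroot D a))))) (- (E b * ktor s D (- e) b))"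
    unfolding refl_coroot form_ab .
qed

lemma TTT_Fb: "acts TTT (F b) (- (E a * ktor s D (- e) a))"
  by (rule acts_TTT[OF Ta_Fb Tb_Y' T_down_self[OF Ta a]])

text \<open>Expanded, the difference of both sides is the Serre relation of the pair, multiplied by \<open>- p (p + p\<^sup>-\<^sup>1)\<close>.\<close>

lemma q_serre: "up t b * (up t a * up t b - p \<star> (up t b * up t a)) \<approx> p \<star> ((up t a * up t b - p \<star> (up t b * up t a)) * up t b)"
proof -
  let ?x = "up t b" and ?y = "up t a"
  have two: "qint p (Suc (Suc 0)) = p + inverse p" by (rule qint_two[OF aperiodic_p])
  have two0: "qint p (Suc (Suc 0)) \<noteq> 0" by (rule qint_nonzero[OF aperiodic_p]) simp
  have "tad p 1 ?x ?y (Suc (Suc 0)) \<approx> 0"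
    using serre[OF b a ab[symmetric], of t] by (simp add: cart_ba vi_eq tad_p numeral_2_eq_2)
  moreover have "tad p 1 ?x ?y (Suc (Suc 0)) =
      inverse (p + inverse p) \<star> (?y * ?x * ?x) - ?x * ?y * ?x + inverse (p + inverse p) \<star> (?x * ?x * ?y)"
    by (simp add: tad_def qfact_Suc qint_one[OF aperiodic_p] two inverse_eq_divide mult.assoc minus_star)
  ultimately have "inverse (p + inverse p) \<star> (?y * ?x * ?x) - ?x * ?y * ?x + inverse (p + inverse p) \<star> (?x * ?x * ?y) \<approx> 0"
    by metis
  from rel_star[OF this, of "- p * (p + inverse p)"]
  moreover have "- p * (p + inverse p) * inverse (p + inverse p) = - p" "- p * (p + inverse p) = - (p * p + 1)"
  proof -
    have "u * inverse u = 1" if "u \<noteq> 0" for u :: qv using that by simp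
    then have "(p + inverse p) * inverse (p + inverse p) = 1" using two0 unfolding two .
    then show "- p * (p + inverse p) * inverse (p + inverse p) = - p" by (simp only: mult.assoc mult_1_right)
    show "- p * (p + inverse p) = - (p * p + 1)" using p(1) by (simp add: distrib_left)
  qed
  ultimately have 1: "- (p \<star> (?y * ?x * ?x)) + (p * p + 1) \<star> (?x * ?y * ?x) - p \<star> (?x * ?x * ?y) \<approx> 0"
    by (simp only: star_add star_diff star_star minus_star star_zero) (simp add: algebra_simps)
  have "?x * (?y * ?x - p \<star> (?x * ?y)) =
    - (p \<star> (?y * ?x * ?x)) + (p * p + 1) \<star> (?x * ?y * ?x) - p \<star> (?x * ?x * ?y) + p \<star> ((?y * ?x - p \<star> (?x * ?y)) * ?x)"
    by (simp add: algebra_simps star_simps star_diff add_star)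
  also have "rel (U D) UR UR \<dots> (0 + p \<star> ((?y * ?x - p \<star> (?x * ?y)) * ?x))"
    using a b closed closed' by (intro rel_add 1 cong_refl) simp_all
  finally show ?thesis by simp
qed

lemma tad_tad_ab:
  assumes j: "j \<in> idx D" "j \<noteq> b" "cart D b j = 0"
  shows "tad p p (up t b) (tad p p (up t a) (up t j) n) n \<approx> tad p p (up t a * up t b - p \<star> (up t b * up t a)) (up t j) n"
proof -
  interpret q_serre_pair "U D" UR p "up t b" "up t a" "up t a * up t b - p \<star> (up t b * up t a)"
    by unfold_locales (use a b q_serre aperiodic_p in simp_all)
  show ?thesis by (rule tad_tad) (use up_commute[OF b j(1) j(2)[symmetric] j(3)] j in simp_all)
qed

text \<open>The image of \<open>E j\<close> under the first two operators is the adjoint sum of \<open>X\<close>, and by \<open>tad_tad\<close> the third operator fixes it.\<close>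

lemma TTT_Ej_a:
  assumes j: "j \<in> idx D" "j \<noteq> a" "j \<noteq> b" "cart D b j = 0"
  shows "acts TTT (E j) (tad p p X (E j) (nat (- cart D a j)))" (is "acts _ _ (tad p p X _ ?n)")
proof (rule acts_TTT[OF Ta_E[OF j(1,2)]])
  have "acts Tb (E j) (E j)"
    using T_up[OF Tb b j(1,3)] by (simp add: j(4))
  then show "acts Tb (tad p p (E a) (E j) ?n) (tad p p X (E j) ?n)"
    by (intro rel_tad Tb_Ea)
  have "acts Ta (tad p p X (E j) ?n) (tad p p (E b) (tad p p (E a) (E j) ?n) ?n)"
    by (intro rel_tad Ta_X Ta_E j)
  also have "rel (U D) UR UR \<dots> (tad p p X (E j) ?n)"
    by (rule tad_tad_ab[OF j(1,3,4)])
  finally show "acts Ta (tad p p X (E j) ?n) (tad p p X (E j) ?n)" .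
qed

lemma TTT_Ej_b:
  assumes j: "j \<in> idx D" "j \<noteq> a" "j \<noteq> b" "cart D a j = 0"
  shows "acts TTT (E j) (tad p p (E b * E a - p \<star> (E a * E b)) (E j) (nat (- cart D b j)))"
    (is "acts _ _ (tad p p ?W _ ?n)")
proof -
  have 1: "acts Ta (E j) (E j)" using Ta_E[OF j(1,2)] by (simp add: j(4))
  show ?thesis
  proof (rule acts_TTT[OF 1])
    show "acts Tb (E j) (tad p p (E b) (E j) ?n)"
      using T_up[OF Tb b j(1,3)] by (simp only: vi_eq tad_p)
    show "acts Ta (tad p p (E b) (E j) ?n) (tad p p ?W (E j) ?n)"
      by (intro rel_tad Ta_Eb 1)
  qed
qed

text \<open>In terms of \<open>tad\<close> the operators contribute a sign and a power of \<open>p\<close> for each lowering generator, and \<open>Y\<close> is \<open>- p\<^sup>-\<^sup>1\<close>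
  times the \<open>q\<close>-commutator that occurs in \<open>tad_tad\<close>; these scalars cancel in part.\<close>

lemma TTT_Fj_a:
  assumes j: "j \<in> idx D" "j \<noteq> a" "j \<noteq> b" "cart D b j = 0"
  shows "acts TTT (F j) ((- inverse p) ^ nat (- cart D a j) \<star> tad p p Y (F j) (nat (- cart D a j)))"
    (is "acts _ _ (?c ^ ?n \<star> _)")
proof (rule acts_TTT[OF Ta_F[OF j(1,2)]])
  have "acts Tb (F j) (F j)"
    using T_down[OF Tb b j(1,3)] by (simp add: j(4))
  then show "acts Tb (?c ^ ?n \<star> tad p p (F a) (F j) ?n) (?c ^ ?n \<star> tad p p Y (F j) ?n)"
    by (intro rel_star rel_tad Tb_Fa)
  have "acts Ta (?c ^ ?n \<star> tad p p Y (F j) ?n)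
      (?c ^ ?n \<star> tad p p (F b) (?c ^ ?n \<star> tad p p (F a) (F j) ?n) ?n)"
    by (intro rel_star rel_tad Ta_Y Ta_F j)
  also have "\<dots> = (?c ^ ?n * ?c ^ ?n) \<star> tad p p (F b) (tad p p (F a) (F j) ?n) ?n"
    by (simp only: tad_star_right star_star)
  also have "rel (U D) UR UR \<dots> ((?c ^ ?n * ?c ^ ?n) \<star> tad p p (F a * F b - p \<star> (F b * F a)) (F j) ?n)"
    by (intro rel_star tad_tad_ab[OF j(1,3,4)])
  also have "F a * F b - p \<star> (F b * F a) = (- p) \<star> Y"
    using p by (simp add: star_diff star_star minus_star)
  also have "(?c ^ ?n * ?c ^ ?n) \<star> tad p p ((- p) \<star> Y) (F j) ?n = ?c ^ ?n \<star> tad p p Y (F j) ?n"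
  proof -
    have "?c ^ ?n * (- p) ^ ?n = 1" using p by (simp flip: power_mult_distrib)
    then show ?thesis by (simp add: tad_star_left star_star mult.assoc)
  qed
  finally show "acts Ta (?c ^ ?n \<star> tad p p Y (F j) ?n) (?c ^ ?n \<star> tad p p Y (F j) ?n)" .
qed

lemma TTT_Fj_b:
  assumes j: "j \<in> idx D" "j \<noteq> a" "j \<noteq> b" "cart D a j = 0"
  shows "acts TTT (F j) ((- inverse p) ^ nat (- cart D b j) \<star>
      tad p p (F a * F b - inverse p \<star> (F b * F a)) (F j) (nat (- cart D b j)))"
    (is "acts _ _ (?c ^ ?n \<star> tad p p ?W _ ?n)")
proof -
  have 1: "acts Ta (F j) (F j)" using Ta_F[OF j(1,2)] by (simp add: j(4))
  show ?thesis
  proof (rule acts_TTT[OF 1])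
    show "acts Tb (F j) (?c ^ ?n \<star> tad p p (F b) (F j) ?n)"
      using T_down[OF Tb b j(1,3)] by (simp only: vi_eq tad_p)
    show "acts Ta (?c ^ ?n \<star> tad p p (F b) (F j) ?n) (?c ^ ?n \<star> tad p p ?W (F j) ?n)"
      by (intro rel_star rel_tad Ta_Fb 1)
  qed
qed

end

section \<open>Contracting an edge\<close>

text \<open>The edge to be contracted, with its ends named \<open>c\<close> and \<open>d\<close> in such a way that, for either value of the flag, the ideal
  is generated by \<open>E d * E c\<close> and \<open>F c * F d\<close>, and the generators of the contracted vertex correspond to \<open>E c * E d\<close>
  and \<open>F d * F c\<close>. Exchanging raising and lowering generators reverses the edge.\<close>

locale oriented_edge = quantum_group +
  fixes ip im :: 'a and s :: bool and c d :: 'a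
  assumes ip: "ip \<in> idx D" and im: "im \<in> idx D"
    and form_eq: "form D ip ip = form D im im" and form_edge: "form D im im = - 2 * form D ip im"
    and separated: "\<not> (\<exists>j\<in>idx D - {ip, im}. form D j ip \<noteq> 0 \<and> form D j im \<noteq> 0)"
    and orient: "(s \<and> c = ip \<and> d = im) \<or> (\<not> s \<and> c = im \<and> d = ip)"
begin

abbreviation H where "H \<equiv> contract D ip im"
abbreviation I0 where "I0 \<equiv> idx D - {ip, im}"

lemma ip_im: "ip \<noteq> im"
  using form_edge form_pos[OF im] by auto

lemma c: "c \<in> idx D" and d: "d \<in> idx D" and cd: "c \<noteq> d" and cd_set: "{c, d} = {ip, im}"
  using ip im ip_im orient by auto

lemma form_cd: "form D c c = form D d d"
  using orient form_eq by auto

lemma form_dc: "2 * form D c d = - form D c c"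
  using orient form_eq form_edge form_sym[OF ip im] by auto

lemma cart_cd: "cart D c d = - 1" and cart_dc: "cart D d c = - 1"
proof -
  have "- n div n = - 1" if "n > 0" for n :: int using that nonzero_mult_div_cancel_right[of n "- 1"] by simp
  then show "cart D c d = - 1" "cart D d c = - 1"
    using form_pos[OF c] form_dc form_cd form_sym[OF c d] c d by (simp_all add: cart_form)
qed

lemma separated': 
  assumes "j \<in> I0" shows "cart D j c = 0 \<or> cart D j d = 0" "cart D c j = 0 \<or> cart D d j = 0"
proof -
  have *: "form D j c = 0 \<or> form D j d = 0" using separated assms orient by auto
  have j: "j \<in> idx D" "j \<noteq> c" "j \<noteq> d" using assms orient by auto
  show "cart D j c = 0 \<or> cart D j d = 0" using * j c d by (simp add: cart_0_iff)
  show "cart D c j = 0 \<or> cart D d j = 0"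
    using * j c d form_sym[OF c j(1)] form_sym[OF d j(1)] cart_0_iff[OF c j(1)] cart_0_iff[OF d j(1)] by auto
qed

lemma I0: "j \<in> I0 \<Longrightarrow> j \<in> idx D" "j \<in> I0 \<Longrightarrow> j \<noteq> c" "j \<in> I0 \<Longrightarrow> j \<noteq> d"
  using orient by auto

lemma H_simps:
  "idx H = insert None (Some ` I0)" "pairing H = pairing D"
  "coroot H None = coroot D c + coroot D d" "coroot H (Some j) = coroot D j"
  "root H None = root D c + root D d" "root H (Some j) = root D j"
  "form H None None = form D c c" "form H (Some i) (Some j) = form D i j"
  "form H None (Some j) = form D c j + form D d j" "form H (Some j) None = form D j c + form D j d"
proof -
  have *: "form D im ip = form D ip im" by (rule form_sym[OF im ip])
  show "idx H = insert None (Some ` I0)" "pairing H = pairing D" "coroot H (Some j) = coroot D j"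
    "root H (Some j) = root D j" "form H (Some i) (Some j) = form D i j"
    by (simp_all add: contract_def)
  show "coroot H None = coroot D c + coroot D d" "root H None = root D c + root D d"
    "form H None (Some j) = form D c j + form D d j" "form H (Some j) None = form D j c + form D j d"
    using orient ip_im by (auto simp: contract_def add.commute)
  have "form H None None = form D ip ip + form D ip im + (form D im ip + form D im im)"
    using ip_im by (simp add: contract_def)
  then show "form H None None = form D c c"
    using orient form_eq form_edge unfolding * by auto
qed

lemma vi_H: "vi H None = vi D c" "vi H (Some j) = vi D j"
  by (simp_all add: vi_def H_simps)

lemma dvd_form: "i \<in> idx D \<Longrightarrow> j \<in> idx D \<Longrightarrow> i \<noteq> j \<Longrightarrow> form D i i dvd 2 * form D i j"
  using cartan by (simp add: cartan_datum_def)

lemma cart_H: "i \<in> idx H \<Longrightarrow> j \<in> idx H \<Longrightarrow> cart H i j = 2 * form H i j div form H i i"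
  and dvd_H: "i \<in> idx H \<Longrightarrow> j \<in> idx H \<Longrightarrow> i \<noteq> j \<Longrightarrow> form H i i dvd 2 * form H i j"
  and nonpos_H: "i \<in> idx H \<Longrightarrow> j \<in> idx H \<Longrightarrow> i \<noteq> j \<Longrightarrow> cart H i j \<le> 0"
proof -
  have div_add: "(2 * (x + y)) div n = (2 * x) div n + (2 * y) div n" if "n dvd 2 * x" for x y n :: int
    using div_plus_div_distrib_dvd_left[OF that, of "2 * y"] by (simp add: distrib_left)
  have 1: "cart H None (Some j) = 2 * form H None (Some j) div form H None None"
    "form H None None dvd 2 * form H None (Some j)" "cart H None (Some j) \<le> 0" if "j \<in> I0" for j
    using I0[OF that] c d dvd_form[OF c, of j] dvd_form[OF d, of j] form_cd cart_nonpos[OF c, of j] cart_nonpos[OF d, of j]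
    by (auto simp: H_simps pairing_simps cart_form div_add distrib_left)
  have 2: "cart H (Some j) None = 2 * form H (Some j) None div form H (Some j) (Some j)"
    "form H (Some j) (Some j) dvd 2 * form H (Some j) None" "cart H (Some j) None \<le> 0" if "j \<in> I0" for j
    using I0[OF that] c d dvd_form[of j c] dvd_form[of j d] cart_nonpos[of j c] cart_nonpos[of j d]
    by (auto simp: H_simps pairing_simps cart_form div_add distrib_left)
  have 3: "cart H None None = 2 * form H None None div form H None None"
  proof -
    have "cart H None None = 2"
      by (simp only: H_simps pairing_simps cart_self[OF c] cart_self[OF d] cart_cd cart_dc)
    moreover have "2 * form H None None div form H None None = 2"
      using form_pos[OF c] nonzero_mult_div_cancel_right[of "form D c c" 2] by (simp add: H_simps)
    ultimately show ?thesis by simp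
  qed
  have 4: "cart H (Some i) (Some j) = 2 * form H (Some i) (Some j) div form H (Some i) (Some i)"
    if "i \<in> I0" "j \<in> I0" for i j
    using that by (simp add: H_simps cart_form)
  have 5: "form H (Some i) (Some i) dvd 2 * form H (Some i) (Some j)" "cart H (Some i) (Some j) \<le> 0"
    if "i \<in> I0" "j \<in> I0" "i \<noteq> j" for i j
    using that dvd_form[of i j] cart_nonpos[of i j] by (simp_all add: H_simps)
  show "i \<in> idx H \<Longrightarrow> j \<in> idx H \<Longrightarrow> cart H i j = 2 * form H i j div form H i i"
    using 1(1) 2(1) 3 4 by (simp only: H_simps(1)) blast
  show "i \<in> idx H \<Longrightarrow> j \<in> idx H \<Longrightarrow> i \<noteq> j \<Longrightarrow> form H i i dvd 2 * form H i j"
    using 1(2) 2(2) 5(1) by (simp only: H_simps(1)) blast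
  show "i \<in> idx H \<Longrightarrow> j \<in> idx H \<Longrightarrow> i \<noteq> j \<Longrightarrow> cart H i j \<le> 0"
    using 1(3) 2(3) 5(2) by (simp only: H_simps(1)) blast
qed

lemma quantum_group_H: "quantum_group H"
proof -
  have "form H i j = form H j i" if "i \<in> idx H" "j \<in> idx H" for i j
    using that form_sym c d by (auto simp: H_simps)
  moreover have "even (form H i i) \<and> form H i i > 0" if "i \<in> idx H" for i
    using that form_pos form_even c by (auto simp: H_simps)
  moreover have "finite (idx H)" using cartan by (simp add: H_simps cartan_datum_def)
  ultimately have C: "cartan_datum (idx H) (form H)"
    using dvd_H nonpos_H cart_H by (simp add: cartan_datum_def)
  have P: "additive (pairing H y)" "additive (\<lambda>y. pairing H y x)" for x y
    unfolding H_simps(2) by (rule additive1 additive2)+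
  show ?thesis by (rule quantum_group.intro[OF C P cart_H])
qed

lemma refl_H: "refl H (Some j) \<mu> = refl D j \<mu>"
  "refl H None \<mu> = \<mu> - zmul (pairing D \<mu> (root D c) + pairing D \<mu> (root D d)) (coroot D c + coroot D d)"
  by (simp_all add: refl_def H_simps pairing_simps)

section \<open>The subquotient\<close>

abbreviation E where "E \<equiv> up s"
abbreviation F where "F \<equiv> up (\<not> s)"
abbreviation Us where "Us \<equiv> U_sub D ip im"
abbreviation J where "J \<equiv> J_ideal D ip im"
abbreviation Uq where "Uq \<equiv> U_quot D ip im"

definition sub_gens :: "('a, 'b) free set" where
  "sub_gens = E ` I0 \<union> F ` I0 \<union> range (tor s) \<union> {E c * E d, E d * E c, F d * F c, F c * F d}"

lemma sub_gens_eq: "sub_gens = gE ` I0 \<union> gF ` I0 \<union> range gK \<union> {gE ip * gE im, gE im * gE ip, gF im * gF ip, gF ip * gF im}"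
proof -
  have "range (tor s) = (range gK :: ('a, 'b) free set)"
  proof (cases s)
    case False
    have "gK \<mu> \<in> range (tor s)" for \<mu> :: 'b
      using False by (intro range_eqI[of _ _ "- \<mu>"]) (simp add: tor_def)
    then show ?thesis by (auto simp: tor_def)
  qed (auto simp: tor_def)
  moreover have "E ` I0 \<union> F ` I0 = (gE ` I0 \<union> gF ` I0 :: ('a, 'b) free set)" by (cases s) (auto simp: up_def)
  moreover have "{E c * E d, E d * E c, F d * F c, F c * F d} = ({gE ip * gE im, gE im * gE ip, gF im * gF ip, gF ip * gF im} :: ('a, 'b) free set)"
    using orient by (auto simp: up_def)
  ultimately show ?thesis unfolding sub_gens_def by (simp only:)
qed

lemma sub_gens_closed: "sub_gens \<subseteq> carrier (free_alg (idx D))"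
proof
  fix p assume "p \<in> sub_gens"
  then consider j where "j \<in> I0" "p = E j \<or> p = F j" | \<mu> where "p = tor s \<mu>"
    | "p \<in> {E c * E d, E d * E c, F d * F c, F c * F d}"
    unfolding sub_gens_def by blast
  then show "p \<in> carrier (free_alg (idx D))"
  proof cases
    case 1
    then show ?thesis using I0(1)[of j] by (elim disjE) simp_all
  next
    case 2
    then show ?thesis by simp
  next
    case 3
    then show ?thesis using c d by (elim insertE emptyE) (simp_all add: closed(3)[unfolded fst_conv])
  qed
qed

lemma Us_eq: "Us = subalg_gen (U D) (cls D ` sub_gens)"
  unfolding U_sub_def sub_gens_eq by (simp only: Un_assoc)

lemma gens_U: "cls D ` sub_gens \<subseteq> carrier (U D)"
  using sub_gens_closed unfolding carrier_U by blast

lemma qalg_Us: "qalg Us"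
  unfolding Us_eq by (rule qalg_subalg_gen[OF qalg_U gens_U])

text \<open>The polynomials whose class lies in the subalgebra; only these have a class in the subquotient.\<close>

definition CS :: "('a, 'b) free set" where
  "CS = {p \<in> carrier (free_alg (idx D)). cls D p \<in> carrier Us}"

abbreviation SR where "SR \<equiv> (CS, cls D)"
abbreviation QR where "QR \<equiv> (CS, qcls D ip im)"

lemma rep_Us: "rep Us SR"
proof -
  interpret ring Us by (rule qalg_ring[OF qalg_Us])
  have R: "rep (U D) UR" by (rule rep_U)
  have ops: "\<one>\<^bsub>Us\<^esub> = \<one>\<^bsub>U D\<^esub>" "x \<oplus>\<^bsub>Us\<^esub> y = x \<oplus>\<^bsub>U D\<^esub> y" "x \<otimes>\<^bsub>Us\<^esub> y = x \<otimes>\<^bsub>U D\<^esub> y" "q \<odot>\<^bsub>Us\<^esub> x = q \<odot>\<^bsub>U D\<^esub> x" for x y q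
    unfolding Us_eq by (simp_all add: subalg_gen_simps)
  have cl: "x \<oplus>\<^bsub>U D\<^esub> y \<in> carrier Us" "x \<otimes>\<^bsub>U D\<^esub> y \<in> carrier Us" "q \<odot>\<^bsub>U D\<^esub> x \<in> carrier Us"
    if "x \<in> carrier Us" "y \<in> carrier Us" for x y q
    using a_closed[OF that] m_closed[OF that] qalg_smult_closed[OF qalg_Us that(1), of q] by (simp_all only: ops)
  have "\<one>\<^bsub>U D\<^esub> \<in> carrier Us" using one_closed by (simp only: ops)
  then show ?thesis using R qalg_Us cl unfolding rep_def subalg_def by (simp add: ops CS_def)
qed

lemma J_gens: "{cls D (E d * E c), cls D (F c * F d)} = {cls D (gE im * gE ip), cls D (gF ip * gF im)}"
  using orient by (auto simp: up_def)

lemma gens_CS: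
  "tor s \<mu> \<in> CS" "E c * E d \<in> CS" "E d * E c \<in> CS" "F d * F c \<in> CS" "F c * F d \<in> CS"
  "j \<in> I0 \<Longrightarrow> E j \<in> CS" "j \<in> I0 \<Longrightarrow> F j \<in> CS"
proof -
  have sub: "sub_gens \<subseteq> CS"
    using sub_gens_closed subalg_gen_carrier(2)[OF qalg_U gens_U] unfolding CS_def Us_eq by blast
  show "tor s \<mu> \<in> CS" "E c * E d \<in> CS" "E d * E c \<in> CS" "F d * F c \<in> CS" "F c * F d \<in> CS"
    "j \<in> I0 \<Longrightarrow> E j \<in> CS" "j \<in> I0 \<Longrightarrow> F j \<in> CS"
    by (rule subsetD[OF sub], simp add: sub_gens_def)+
qed

lemma J_eq: "J = Idl\<^bsub>Us\<^esub> {cls D (E d * E c), cls D (F c * F d)}"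
  unfolding J_ideal_def J_gens ..

lemma J_gens_Us: "{cls D (E d * E c), cls D (F c * F d)} \<subseteq> carrier Us"
  using gens_CS(3,5) by (auto simp: CS_def)

lemma ideal_J: "ideal J Us"
  unfolding J_eq by (rule ring.genideal_ideal[OF qalg_ring[OF qalg_Us] J_gens_Us])

lemma qalg_Uq: "qalg Uq"
  unfolding U_quot_def by (rule qalg_quot_alg[OF qalg_Us ideal_J])

lemma rep_Uq: "rep Uq QR"
proof -
  have "rep Uq (CS, (\<lambda>x. J +>\<^bsub>Us\<^esub> x) \<circ> cls D)"
    using rep_compose[OF rep_Us coset_hom[OF qalg_Us ideal_J] qalg_Uq[unfolded U_quot_def]] by (simp add: U_quot_def)
  moreover have "(\<lambda>x. J +>\<^bsub>Us\<^esub> x) \<circ> cls D = qcls D ip im"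
    by (simp add: fun_eq_iff qcls_def)
  ultimately show ?thesis by simp
qed

sublocale Q: congruence Uq QR
  by unfold_locales (rule rep_Uq)

text \<open>The ideal is the coset of \<open>0\<close>.\<close>

lemma zero_iff:
  assumes p: "p \<in> CS" shows "rel Uq QR QR p 0 \<longleftrightarrow> cls D p \<in> J"
proof -
  interpret ideal J Us by (rule ideal_J)
  have "cls D (E d * E c) \<in> J" unfolding J_eq using ring.genideal_self[OF qalg_ring[OF qalg_Us] J_gens_Us] by simp
  \<comment> \<open>The polynomial \<open>0\<close> is a scalar multiple of a generator of the ideal.\<close>
  from qalg_ideal_smult[OF qalg_Us ideal_J this, of 0]
  have "cls D (0 \<star> (E d * E c)) \<in> J" using rep_Us gens_CS(3) by (simp only: rep_def fst_conv snd_conv)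
  then have z: "cls D 0 \<in> J" by simp
  have J0: "qcls D ip im 0 = J" using a_rcos_const[OF z] by (simp add: qcls_def)
  have "qcls D ip im p = J \<longleftrightarrow> cls D p \<in> J"
    using coset_self[OF ideal_J, of "cls D p"] a_rcos_const[of "cls D p"] p by (auto simp: qcls_def CS_def)
  then show ?thesis using p J0 Q.closed'(1) by (simp add: Q.cong_iff)
qed

lemma killed: "rel Uq QR QR (E d * E c) 0" "rel Uq QR QR (F c * F d) 0"
  using ring.genideal_self[OF qalg_ring[OF qalg_Us] J_gens_Us] zero_iff[OF gens_CS(3)] zero_iff[OF gens_CS(5)]
  unfolding J_eq by auto

abbreviation sacts where "sacts T p q \<equiv> rel Us (CS, T \<circ> cls D) SR p q"

definition descends :: "(('a, 'b) free set \<Rightarrow> ('a, 'b) free set) \<Rightarrow> bool" where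
  "descends T \<longleftrightarrow> T \<in> alg_hom Us Us \<and> (\<forall>x\<in>J. T x \<in> J)"

lemma descendsI:
  assumes T: "T \<in> alg_hom Us Us"
    and "sacts T (E d * E c) p" "rel Uq QR QR p 0" "sacts T (F c * F d) q" "rel Uq QR QR q 0"
  shows "descends T"
proof -
  have R: "T \<in> ring_hom Us Us" using T by (simp add: alg_hom_def)
  have "T (cls D (E d * E c)) = cls D p" "T (cls D (F c * F d)) = cls D q" "p \<in> CS" "q \<in> CS"
    using assms(2,4) unfolding rel_def by simp_all
  then have "T x \<in> Idl\<^bsub>Us\<^esub> {cls D (E d * E c), cls D (F c * F d)}" if "x \<in> {cls D (E d * E c), cls D (F c * F d)}" for x
    using that zero_iff assms(3,5) unfolding J_eq by auto
  from genideal_stable[OF qalg_ring[OF qalg_Us] J_gens_Us R this] show ?thesis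
    unfolding descends_def J_eq using T by blast
qed

lemma descends_hom: "descends T \<Longrightarrow> induced Us J T \<in> alg_hom Uq Uq"
  unfolding descends_def U_quot_def using induced_hom[OF qalg_Us ideal_J] by blast

lemma descends_acts:
  assumes T: "descends T" and pq: "sacts T p q"
  shows "induced Us J T (qcls D ip im p) = qcls D ip im q"
proof -
  have "induced Us J T (J +>\<^bsub>Us\<^esub> cls D p) = J +>\<^bsub>Us\<^esub> T (cls D p)"
    by (rule induced_coset[OF qalg_Us ideal_J]) (use T pq in \<open>auto simp: descends_def rel_def CS_def\<close>)
  then show ?thesis using pq by (simp add: qcls_def rel_def)
qed

lemma stable_on_sub:
  assumes T: "T \<in> alg_hom (U D) (U D)"
    and gen: "\<And>p. p \<in> sub_gens \<Longrightarrow> \<exists>q\<in>CS. acts T p q"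
  shows "T \<in> alg_hom Us Us"
proof -
  have "T x \<in> carrier (subalg_gen (U D) (cls D ` sub_gens))" if "x \<in> cls D ` sub_gens" for x
    using that gen unfolding Us_eq[symmetric] by (force simp: rel_def CS_def)
  then have "T x \<in> carrier (subalg_gen (U D) (cls D ` sub_gens))" if "x \<in> carrier (subalg_gen (U D) (cls D ` sub_gens))" for x
    using subalg_gen_stable[OF qalg_U gens_U T] that by blast
  then show ?thesis unfolding Us_eq
    by (rule alg_hom_restrict[OF T subalg_gen_carrier(1)[OF qalg_U gens_U]])
qed

lemma acts_sub:
  assumes "T \<in> alg_hom Us Us" "acts T p q" "p \<in> CS" shows "sacts T p q" "q \<in> CS"
proof -
  have eq: "T (cls D p) = cls D q" using assms(2) by (simp add: rel_def)
  moreover have "T (cls D p) \<in> carrier Us" using alg_homD(1)[OF assms(1)] assms(3) unfolding CS_def by blast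
  ultimately show q: "q \<in> CS" using assms(2) by (auto simp: rel_def CS_def)
  have "rep Us (CS, T \<circ> cls D)" using rep_compose[OF rep_Us assms(1) qalg_Us] by simp
  then show "sacts T p q" using rep_Us assms(3) q eq by (simp add: rel_def)
qed

end

section \<open>Operators at vertices away from the edge\<close>

context quantum_group
begin

text \<open>One of the two factors commutes with \<open>up s i\<close> and is fixed by the operator; it can be moved inside the adjoint sum that the
  other factor becomes.\<close>

lemma T_pair_up:
  assumes T: "is_T s D e i T" and i: "i \<in> idx D"
    and x: "x \<in> idx D" "x \<noteq> i" and y: "y \<in> idx D" "y \<noteq> i"
    and zero: "cart D i x = 0 \<or> cart D i y = 0"
  shows "acts T (up s x * up s y)
    (tad (vi D i) (vi D i powi e) (up s i) (up s x * up s y) (nat (- (cart D i x + cart D i y))))"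
proof -
  have "acts T (up s x * up s y) (tad (vi D i) (vi D i powi e) (up s i) (up s x) (nat (- cart D i x)) *
      tad (vi D i) (vi D i powi e) (up s i) (up s y) (nat (- cart D i y)))" (is "acts _ _ ?rhs")
    by (intro rel_mult T_up[OF T i x] T_up[OF T i y])
  also have "rel (U D) UR UR ?rhs
      (tad (vi D i) (vi D i powi e) (up s i) (up s x * up s y) (nat (- (cart D i x + cart D i y))))"
  proof (cases "cart D i x = 0")
    case True
    then show ?thesis
      using rel_sym[OF tad_commute_left[OF up_commute[OF i x(1) x(2)[symmetric] True]]] i x(1) y(1) by simp
  next
    case False
    then have 0: "cart D i y = 0" using zero by simp
    then show ?thesis
      using rel_sym[OF tad_commute_right[OF up_commute[OF i y(1) y(2)[symmetric] 0]]] i x(1) y(1) by simp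
  qed
  finally show ?thesis .
qed

lemma T_pair_down:
  assumes T: "is_T s D e i T" and i: "i \<in> idx D"
    and x: "x \<in> idx D" "x \<noteq> i" and y: "y \<in> idx D" "y \<noteq> i"
    and zero: "cart D i x = 0 \<or> cart D i y = 0"
  shows "acts T (up (\<not> s) x * up (\<not> s) y) ((- inverse (vi D i powi e)) ^ nat (- (cart D i x + cart D i y)) \<star>
    tad (vi D i) (vi D i powi e) (up (\<not> s) i) (up (\<not> s) x * up (\<not> s) y) (nat (- (cart D i x + cart D i y))))"
proof -
  let ?z = "- inverse (vi D i powi e)"
  have "acts T (up (\<not> s) x * up (\<not> s) y)
      ((?z ^ nat (- cart D i x) \<star> tad (vi D i) (vi D i powi e) (up (\<not> s) i) (up (\<not> s) x) (nat (- cart D i x))) *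
      (?z ^ nat (- cart D i y) \<star> tad (vi D i) (vi D i powi e) (up (\<not> s) i) (up (\<not> s) y) (nat (- cart D i y))))"
    (is "acts _ _ ?rhs")
    by (intro rel_mult T_down[OF T i x] T_down[OF T i y])
  also have "rel (U D) UR UR ?rhs (?z ^ nat (- (cart D i x + cart D i y)) \<star>
      tad (vi D i) (vi D i powi e) (up (\<not> s) i) (up (\<not> s) x * up (\<not> s) y) (nat (- (cart D i x + cart D i y))))"
  proof (cases "cart D i x = 0")
    case True
    then show ?thesis
      using rel_star[OF rel_sym[OF tad_commute_left[OF up_commute[OF i x(1) x(2)[symmetric] True]]]] i x(1) y(1)
      by (simp add: star_simps)
  next
    case False
    then have 0: "cart D i y = 0" using zero by simp
    then show ?thesis
      using rel_star[OF rel_sym[OF tad_commute_right[OF up_commute[OF i y(1) y(2)[symmetric] 0]]]] i x(1) y(1)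
      by (simp add: star_simps)
  qed
  finally show ?thesis .
qed

end

context oriented_edge
begin

lemma CS_closed:
  "p \<in> CS \<Longrightarrow> q \<in> CS \<Longrightarrow> p * q \<in> CS" "p \<in> CS \<Longrightarrow> q \<in> CS \<Longrightarrow> p - q \<in> CS"
  "p \<in> CS \<Longrightarrow> - p \<in> CS" "p \<in> CS \<Longrightarrow> a \<star> p \<in> CS" "p \<in> CS \<Longrightarrow> q \<in> CS \<Longrightarrow> tad a b p q n \<in> CS"
  by (rule Q.closed(3,4)[unfolded fst_conv] Q.closed'(2,3,5)[unfolded fst_conv]; assumption)+

lemma kill_tad:
  assumes "rel Uq QR QR y 0" "x \<in> CS" shows "rel Uq QR QR (tad a b x y n) 0"
  using rel_tad[OF Q.cong_refl assms(1), of x a b n] assms(2) by simp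

lemma kill_star: "rel Uq QR QR y 0 \<Longrightarrow> rel Uq QR QR (a \<star> y) 0"
  using rel_star[of Uq QR QR y 0 a] by simp

lemma kill_left:
  assumes "rel Uq QR QR y 0" "x \<in> CS" shows "rel Uq QR QR (x * y) 0"
  using rel_mult[OF Q.cong_refl assms(1), of x] assms(2) by simp

lemma kill_right:
  assumes "rel Uq QR QR y 0" "x \<in> CS" shows "rel Uq QR QR (y * x) 0"
  using rel_mult[OF assms(1) Q.cong_refl, of x] assms(2) by simp

lemma sub_gens_cases [consumes 1, case_names tor E F edge]:
  assumes "p \<in> sub_gens"
  obtains (tor) \<mu> where "p = tor s \<mu>" | (E) j where "j \<in> I0" "p = E j" | (F) j where "j \<in> I0" "p = F j"
    | (edge) x y where "(x, y) \<in> {(c, d), (d, c)}" "p = E x * E y \<or> p = F x * F y"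
  using assms unfolding sub_gens_def by blast

lemma actsI: "acts T p q \<Longrightarrow> q \<in> CS \<Longrightarrow> \<exists>q\<in>CS. acts T p q"
  by blast

lemma gens_edge: "(x, y) \<in> {(c, d), (d, c)} \<Longrightarrow> E x * E y \<in> CS" "(x, y) \<in> {(c, d), (d, c)} \<Longrightarrow> F x * F y \<in> CS"
  using gens_CS(2-5) by auto

section \<open>The homomorphism \<open>\<Phi>\<close>\<close>

abbreviation phi where "phi \<Phi> g p \<equiv> rel Uq (carrier (free_alg (idx H)), \<Phi> \<circ> cls H) QR g p"

lemma phi_gens:
  assumes "is_Phi D ip im \<Phi>"
  shows "phi \<Phi> (tor s \<mu>) (tor s \<mu>)" "j \<in> I0 \<Longrightarrow> phi \<Phi> (up s (Some j)) (E j)"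
    "j \<in> I0 \<Longrightarrow> phi \<Phi> (up (\<not> s) (Some j)) (F j)"
    "phi \<Phi> (up s None) (E c * E d)" "phi \<Phi> (up (\<not> s) None) (F d * F c)"
proof -
  interpret H: quantum_group H by (rule quantum_group_H)
  have hom: "\<Phi> \<in> alg_hom (U H) Uq" using assms by (simp add: is_Phi_def Let_def)
  have rep: "rep Uq (carrier (free_alg (idx H)), \<Phi> \<circ> cls H)"
    using rep_compose[OF H.rep_U hom qalg_Uq] by simp
  have phiI: "phi \<Phi> g p" if "g \<in> carrier (free_alg (idx H))" "p \<in> CS" "\<Phi> (cls H g) = qcls D ip im p" for g p
    using rep rep_Uq that by (simp add: rel_def)
  have P: "\<Phi> (cls H (gE (Some j))) = qcls D ip im (gE j)" "\<Phi> (cls H (gF (Some j))) = qcls D ip im (gF j)" if "j \<in> I0" for j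
    using assms that by (simp_all add: is_Phi_def Let_def)
  have K: "\<Phi> (cls H (gK \<mu>)) = qcls D ip im (gK \<mu>)" for \<mu>
    using assms by (simp add: is_Phi_def Let_def)
  have N: "\<Phi> (cls H (gE None)) = qcls D ip im (gE ip * gE im)" "\<Phi> (cls H (gF None)) = qcls D ip im (gF im * gF ip)"
    using assms by (simp_all add: is_Phi_def Let_def)
  have None: "None \<in> idx H" by (simp add: H_simps)
  show "phi \<Phi> (tor s \<mu>) (tor s \<mu>)"
    by (rule phiI) (use gens_CS(1) K in \<open>simp_all add: tor_def\<close>)
  show "phi \<Phi> (up s (Some j)) (E j)" if "j \<in> I0"
    by (rule phiI) (use gens_CS(6)[OF that] P[OF that] that in \<open>simp_all add: up_def H_simps\<close>)
  show "phi \<Phi> (up (\<not> s) (Some j)) (F j)" if "j \<in> I0"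
    by (rule phiI) (use gens_CS(7)[OF that] P[OF that] that in \<open>simp_all add: up_def H_simps\<close>)
  show "phi \<Phi> (up s None) (E c * E d)"
  proof (rule phiI)
    show "\<Phi> (cls H (up s None)) = qcls D ip im (E c * E d)" using N orient by (auto simp: up_def)
  qed (use None gens_CS(2) H.gens_closed in simp_all)
  show "phi \<Phi> (up (\<not> s) None) (F d * F c)"
  proof (rule phiI)
    show "\<Phi> (cls H (up (\<not> s) None)) = qcls D ip im (F d * F c)" using N orient by (auto simp: up_def)
  qed (use None gens_CS(4) H.gens_closed in simp_all)
qed

abbreviation hacts where "hacts T g g' \<equiv> rel (U H) (carrier (free_alg (idx H)), T \<circ> cls H) (carrier (free_alg (idx H)), cls H) g g'"

lemma compatible_on_generator:
  assumes "phi \<Phi> g p" "hacts hT g g'" "phi \<Phi> g' p'" "f (qcls D ip im p) = qcls D ip im p'"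
  shows "\<Phi> (hT (cls H g)) = f (\<Phi> (cls H g))"
  using assms by (simp add: rel_def)

text \<open>The polynomials on whose classes the two homomorphisms agree form a subalgebra.\<close>

lemma compatible_everywhere:
  assumes Phi: "\<Phi> \<in> alg_hom (U H) Uq" and hT: "hT \<in> alg_hom (U H) (U H)" and f: "f \<in> alg_hom Uq Uq"
    and gen: "\<And>i. i \<in> idx H \<Longrightarrow> \<Phi> (hT (cls H (up s i))) = f (\<Phi> (cls H (up s i)))"
      "\<And>i. i \<in> idx H \<Longrightarrow> \<Phi> (hT (cls H (up (\<not> s) i))) = f (\<Phi> (cls H (up (\<not> s) i)))"
      "\<And>\<mu>. \<Phi> (hT (cls H (tor s \<mu>))) = f (\<Phi> (cls H (tor s \<mu>)))"
    and x: "x \<in> carrier (U H)"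
  shows "\<Phi> (hT x) = f (\<Phi> x)"
proof -
  interpret H: quantum_group H by (rule quantum_group_H)
  let ?G = "carrier (free_alg (idx H))"
  let ?C = "{p \<in> ?G. \<Phi> (hT (cls H p)) = f (\<Phi> (cls H p))}"
  have 1: "rep Uq (?G, (\<Phi> \<circ> hT) \<circ> cls H)"
    using rep_compose[OF H.rep_U alg_hom_compose[OF hT Phi] qalg_Uq] by simp
  have 2: "rep Uq (?G, (f \<circ> \<Phi>) \<circ> cls H)"
    using rep_compose[OF H.rep_U alg_hom_compose[OF Phi f] qalg_Uq] by simp
  have "subalg ?C"
    using 1 2 unfolding rep_def subalg_def by simp
  moreover have "gE i \<in> ?C" "gF i \<in> ?C" if "i \<in> idx H" for i
    using gen(1,2)[OF that] that by (cases s; simp add: up_def)+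
  moreover have "gK \<mu> \<in> ?C" for \<mu>
    using gen(3)[of \<mu>] gen(3)[of "- \<mu>"] by (cases s; simp add: tor_def)
  ultimately have "?G \<subseteq> ?C"
    by (intro free_alg_least) blast+
  then show ?thesis using x unfolding H.carrier_U by blast
qed

section \<open>Compatibility away from the contracted vertex\<close>

context
  fixes e :: int and j and T
  assumes j: "j \<in> I0" and T: "is_T s D e j T"
begin

lemma T_gen_E: 
  assumes "k \<in> I0" shows "\<exists>q\<in>CS. acts T (E k) q"
proof (cases "k = j")
  case True
  have "- (ktor s D e j * F j) \<in> CS" by (intro CS_closed gens_CS j)
  then show ?thesis unfolding True by (rule actsI[OF T_up_self[OF T I0(1)[OF j]]])
next
  case False
  show ?thesis
    by (rule actsI[OF T_up[OF T I0(1)[OF j] I0(1)[OF assms] False]]) (intro CS_closed gens_CS j assms)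
qed

lemma T_gen_F: 
  assumes "k \<in> I0" shows "\<exists>q\<in>CS. acts T (F k) q"
proof (cases "k = j")
  case True
  have 1: "E j \<in> CS" by (rule gens_CS(6)[OF j])
  have 2: "ktor s D (- e) j \<in> CS" by (rule gens_CS(1))
  have "- (E j * ktor s D (- e) j) \<in> CS" by (rule CS_closed(3)[OF CS_closed(1)[OF 1 2]])
  then show ?thesis unfolding True by (rule actsI[OF T_down_self[OF T I0(1)[OF j]]])
next
  case False
  show ?thesis
    by (rule actsI[OF T_down[OF T I0(1)[OF j] I0(1)[OF assms] False]]) (intro CS_closed gens_CS j assms)
qed

lemma T_edge:
  assumes "(x, y) \<in> {(c, d), (d, c)}"
  shows "acts T (E x * E y) (tad (vi D j) (vi D j powi e) (E j) (E x * E y) (nat (- (cart D j x + cart D j y))))"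
    "acts T (F x * F y) ((- inverse (vi D j powi e)) ^ nat (- (cart D j x + cart D j y)) \<star>
      tad (vi D j) (vi D j powi e) (F j) (F x * F y) (nat (- (cart D j x + cart D j y))))"
proof -
  have "x = c \<and> y = d \<or> x = d \<and> y = c" using assms by simp
  moreover note c d I0(2,3)[OF j] separated'(1)[OF j]
  ultimately have *: "x \<in> idx D" "x \<noteq> j" "y \<in> idx D" "y \<noteq> j" "cart D j x = 0 \<or> cart D j y = 0"
    by metis+
  show "acts T (E x * E y) (tad (vi D j) (vi D j powi e) (E j) (E x * E y) (nat (- (cart D j x + cart D j y))))"
    by (rule T_pair_up[OF T I0(1)[OF j] *])
  show "acts T (F x * F y) ((- inverse (vi D j powi e)) ^ nat (- (cart D j x + cart D j y)) \<star>
      tad (vi D j) (vi D j powi e) (F j) (F x * F y) (nat (- (cart D j x + cart D j y))))"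
    by (rule T_pair_down[OF T I0(1)[OF j] *])
qed

lemma T_sub: "T \<in> alg_hom Us Us"
proof (rule stable_on_sub[OF T_hom[OF T I0(1)[OF j]]])
  fix p assume "p \<in> sub_gens"
  then show "\<exists>q\<in>CS. acts T p q"
  proof (cases rule: sub_gens_cases)
    case (tor \<mu>)
    show ?thesis unfolding tor by (rule actsI[OF T_tor[OF T I0(1)[OF j]]]) (rule gens_CS)
  next
    case (E k)
    then show ?thesis using T_gen_E by simp
  next
    case (F k)
    then show ?thesis using T_gen_F by simp
  next
    case (edge x y)
    have 1: "\<exists>q\<in>CS. acts T (E x * E y) q"
      by (rule actsI[OF T_edge(1)[OF edge(1)]]) (intro CS_closed gens_CS j gens_edge edge(1))
    have 2: "\<exists>q\<in>CS. acts T (F x * F y) q"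
      by (rule actsI[OF T_edge(2)[OF edge(1)]]) (intro CS_closed gens_CS j gens_edge edge(1))
    show ?thesis using edge(2) 1 2 by auto
  qed
qed

lemma T_descends: "descends T"
proof (rule descendsI[OF T_sub])
  show "sacts T (E d * E c) (tad (vi D j) (vi D j powi e) (E j) (E d * E c) (nat (- (cart D j d + cart D j c))))"
    by (rule acts_sub(1)[OF T_sub T_edge(1) gens_CS(3)]) simp
  show "rel Uq QR QR (tad (vi D j) (vi D j powi e) (E j) (E d * E c) (nat (- (cart D j d + cart D j c)))) 0"
    by (intro kill_tad killed gens_CS j)
  show "sacts T (F c * F d) ((- inverse (vi D j powi e)) ^ nat (- (cart D j c + cart D j d)) \<star>
      tad (vi D j) (vi D j powi e) (F j) (F c * F d) (nat (- (cart D j c + cart D j d))))"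
    by (rule acts_sub(1)[OF T_sub T_edge(2) gens_CS(5)]) simp
  show "rel Uq QR QR ((- inverse (vi D j powi e)) ^ nat (- (cart D j c + cart D j d)) \<star>
      tad (vi D j) (vi D j powi e) (F j) (F c * F d) (nat (- (cart D j c + cart D j d)))) 0"
    by (intro kill_star kill_tad killed gens_CS j)
qed

lemma T_on_quotient:
  assumes "acts T p q" "p \<in> CS" shows "induced Us J T (qcls D ip im p) = qcls D ip im q"
  by (rule descends_acts[OF T_descends acts_sub(1)[OF T_sub assms]])

lemma compatible_away:
  assumes hT: "is_T s H e (Some j) hT" and Phi: "is_Phi D ip im \<Phi>" and x: "x \<in> carrier (U H)"
  shows "\<Phi> (hT x) = induced Us J T (\<Phi> x)"
proof -
  interpret H: quantum_group H by (rule quantum_group_H)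
  have jH: "Some j \<in> idx H" using j by (simp add: H_simps)
  note jD = I0(1)[OF j]
  note P = phi_gens[OF Phi]
  have kt: "ktor s H n (Some j) = tor s (zmul (n * (form D j j div 2)) (coroot D j))" for n
    by (simp add: H_simps)
  have cart_SS: "cart H (Some j) (Some k) = cart D j k" for k by (simp add: H_simps)
  have cart_SN: "cart H (Some j) None = cart D j c + cart D j d" by (simp add: H_simps pairing_simps)
  show ?thesis
  proof (rule compatible_everywhere[OF _ H.T_hom[OF hT jH] descends_hom[OF T_descends] _ _ _ x])
    show "\<Phi> \<in> alg_hom (U H) Uq" using Phi by (simp add: is_Phi_def Let_def)
  next
    fix \<mu>
    show "\<Phi> (hT (cls H (tor s \<mu>))) = induced Us J T (\<Phi> (cls H (tor s \<mu>)))"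
      by (rule compatible_on_generator[OF P(1) H.T_tor[OF hT jH] P(1)], unfold refl_H)
        (rule T_on_quotient[OF T_tor[OF T jD] gens_CS(1)])
  next
    fix i assume "i \<in> idx H"
    then consider "i = None" | "i = Some j" | k where "i = Some k" "k \<in> I0" "k \<noteq> j"
      by (auto simp: H_simps)
    then show "\<Phi> (hT (cls H (up s i))) = induced Us J T (\<Phi> (cls H (up s i)))"
    proof cases
      case 1
      have N: "None \<in> idx H" by (simp add: H_simps)
      have "hacts hT (up s None) (tad (vi D j) (vi D j powi e) (up s (Some j)) (up s None) (nat (- (cart D j c + cart D j d))))"
        using H.T_up[OF hT jH N] by (simp only: vi_H cart_SN) simp
      then show ?thesis unfolding 1
        by (rule compatible_on_generator[OF P(4)])
          (rule rel_tad[OF P(2)[OF j] P(4)], rule T_on_quotient[OF T_edge(1) gens_CS(2)], simp)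
    next
      case 2
      show ?thesis unfolding 2
        by (rule compatible_on_generator[OF P(2)[OF j] H.T_up_self[OF hT jH]], unfold kt,
            rule rel_minus[OF rel_mult[OF P(1) P(3)[OF j]]])
          (rule T_on_quotient[OF T_up_self[OF T jD] gens_CS(6)[OF j]])
    next
      case (3 k)
      have kH: "Some k \<in> idx H" "Some k \<noteq> Some j" using 3 by (simp_all add: H_simps)
      show ?thesis unfolding 3(1)
        by (rule compatible_on_generator[OF P(2)[OF 3(2)] H.T_up[OF hT jH kH]], unfold vi_H cart_SS,
            rule rel_tad[OF P(2)[OF j] P(2)[OF 3(2)]])
          (rule T_on_quotient[OF T_up[OF T jD I0(1)[OF 3(2)] 3(3)] gens_CS(6)[OF 3(2)]])
    qed
  next
    fix i assume "i \<in> idx H"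
    then consider "i = None" | "i = Some j" | k where "i = Some k" "k \<in> I0" "k \<noteq> j"
      by (auto simp: H_simps)
    then show "\<Phi> (hT (cls H (up (\<not> s) i))) = induced Us J T (\<Phi> (cls H (up (\<not> s) i)))"
    proof cases
      case 1
      have N: "None \<in> idx H" by (simp add: H_simps)
      have "hacts hT (up (\<not> s) None) ((- inverse (vi D j powi e)) ^ nat (- (cart D j d + cart D j c)) \<star>
          tad (vi D j) (vi D j powi e) (up (\<not> s) (Some j)) (up (\<not> s) None) (nat (- (cart D j d + cart D j c))))"
        using H.T_down[OF hT jH N] by (simp only: vi_H cart_SN add.commute[of "cart D j c"]) simp
      then show ?thesis unfolding 1
        by (rule compatible_on_generator[OF P(5)])
          (rule rel_star[OF rel_tad[OF P(3)[OF j] P(5)]], rule T_on_quotient[OF T_edge(2) gens_CS(4)], simp)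
    next
      case 2
      show ?thesis unfolding 2
        by (rule compatible_on_generator[OF P(3)[OF j] H.T_down_self[OF hT jH]], unfold kt,
            rule rel_minus[OF rel_mult[OF P(2)[OF j] P(1)]])
          (rule T_on_quotient[OF T_down_self[OF T jD] gens_CS(7)[OF j]])
    next
      case (3 k)
      have kH: "Some k \<in> idx H" "Some k \<noteq> Some j" using 3 by (simp_all add: H_simps)
      show ?thesis unfolding 3(1)
        by (rule compatible_on_generator[OF P(3)[OF 3(2)] H.T_down[OF hT jH kH]], unfold vi_H cart_SS,
            rule rel_star[OF rel_tad[OF P(3)[OF j] P(3)[OF 3(2)]]])
          (rule T_on_quotient[OF T_down[OF T jD I0(1)[OF 3(2)] 3(3)] gens_CS(7)[OF 3(2)]])
    qed
  qed
qed

end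

end

section \<open>Compatibility at the contracted vertex\<close>

context oriented_edge
begin

context
  fixes e :: int and T :: "'a \<Rightarrow> ('a, 'b) free set \<Rightarrow> ('a, 'b) free set"
  assumes e: "e \<in> {1, -1}" and T: "\<And>k. k \<in> idx D \<Longrightarrow> is_T s D e k (T k)"
begin

abbreviation (input) p where "p \<equiv> vi D c powi e"
abbreviation (input) Tt where "Tt \<equiv> T ip \<circ> T im \<circ> T ip"

lemma braid: "braid_pair D s e ip im (T ip) (T im)"
  using orient cart_cd cart_dc by unfold_locales (use e ip im ip_im form_eq T in auto)

lemma vi_edge: "vi D ip = vi D c" "vi D d = vi D c"
  using orient form_eq by (auto simp: vi_def)

lemma Tt_hom: "Tt \<in> alg_hom (U D) (U D)"
  by (rule braid_pair.TTT_hom[OF braid])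

lemma Tt_tor: "acts Tt (tor s \<mu>)
    (tor s (\<mu> - zmul (pairing D \<mu> (root D c) + pairing D \<mu> (root D d)) (coroot D c + coroot D d)))"
  using braid_pair.TTT_tor[OF braid, of \<mu>] orient by (auto simp: add.commute)

text \<open>The images under the triple composite are symmetric in the two ends. This is needed because, for \<open>s = False\<close>, the ends
  \<open>c\<close> and \<open>d\<close> are exchanged while the composite still starts and ends with the operator at \<open>ip\<close>.\<close>

lemma Tt_edge:
  assumes "(x, y) \<in> {(c, d), (d, c)}"
  shows "acts Tt (E x) (- (ktor s D e y * F y))" "acts Tt (F x) (- (E y * ktor s D (- e) y))"
proof -
  have "x = ip \<and> y = im \<or> x = im \<and> y = ip" using assms orient by auto
  then show "acts Tt (E x) (- (ktor s D e y * F y))" "acts Tt (F x) (- (E y * ktor s D (- e) y))"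
    using braid_pair.TTT_Ea[OF braid] braid_pair.TTT_Eb[OF braid]
      braid_pair.TTT_Fa[OF braid] braid_pair.TTT_Fb[OF braid] by (elim disjE conjE; simp only:)+
qed

lemma Tt_Ej:
  assumes j: "j \<in> I0" and xy: "(x, y) \<in> {(c, d), (d, c)}" and zero: "cart D y j = 0"
  shows "acts Tt (E j) (tad p p (E x * E y - p \<star> (E y * E x)) (E j) (nat (- cart D x j)))"
proof -
  have j': "j \<in> idx D" "j \<noteq> ip" "j \<noteq> im" using j by auto
  have "x = ip \<and> y = im \<or> x = im \<and> y = ip" using xy orient by auto
  then show ?thesis
  proof (elim disjE conjE)
    assume [simp]: "x = ip" "y = im"
    show ?thesis using braid_pair.TTT_Ej_a[OF braid j'] zero by (simp add: vi_edge)
  next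
    assume [simp]: "x = im" "y = ip"
    show ?thesis using braid_pair.TTT_Ej_b[OF braid j'] zero by (simp add: vi_edge)
  qed
qed

lemma Tt_Fj:
  assumes j: "j \<in> I0" and xy: "(x, y) \<in> {(c, d), (d, c)}" and zero: "cart D y j = 0"
  shows "acts Tt (F j) ((- inverse p) ^ nat (- cart D x j) \<star>
    tad p p (F y * F x - inverse p \<star> (F x * F y)) (F j) (nat (- cart D x j)))"
proof -
  have j': "j \<in> idx D" "j \<noteq> ip" "j \<noteq> im" using j by auto
  have "x = ip \<and> y = im \<or> x = im \<and> y = ip" using xy orient by auto
  then show ?thesis
  proof (elim disjE conjE)
    assume [simp]: "x = ip" "y = im"
    show ?thesis using braid_pair.TTT_Fj_a[OF braid j'] zero by (simp add: vi_edge)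
  next
    assume [simp]: "x = im" "y = ip"
    show ?thesis using braid_pair.TTT_Fj_b[OF braid j'] zero by (simp add: vi_edge)
  qed
qed

abbreviation (input) kedge where "kedge n \<equiv> tor s (zmul (n * (form D c c div 2)) (coroot D c + coroot D d))"

text \<open>Collecting the torus elements on one side contributes the factor \<open>p\<close> or its inverse, which the rescaling has to remove.\<close>

lemma Tt_pair:
  assumes xy: "(x, y) \<in> {(c, d), (d, c)}"
  shows "acts Tt (E x * E y) (inverse p \<star> (kedge e * (F y * F x)))"
    "acts Tt (F y * F x) (p \<star> ((E x * E y) * kedge (- e)))"
proof -
  have yx: "(y, x) \<in> {(c, d), (d, c)}" using xy by auto
  have x: "x \<in> idx D" and y: "y \<in> idx D" and cxy: "cart D x y = - 1" "cart D y x = - 1"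
    and vx: "vi D x = vi D c" "vi D y = vi D c" and fx: "form D x x = form D c c" "form D y y = form D c c"
    using xy c d cart_cd cart_dc vi_edge form_cd by auto
  have p0: "p \<noteq> 0" using aperiodic_nonzero[OF aperiodic_vi[OF c]] by simp
  have sum: "zmul (n * (form D y y div 2)) (coroot D y) + zmul (n * (form D x x div 2)) (coroot D x) =
      zmul (n * (form D c c div 2)) (coroot D c + coroot D d)" for n
    using xy by (auto simp: fx zmul_plus form_cd add.commute)
  have kt: "ktor s D n y * ktor s D n x \<approx> kedge n" "ktor s D n x * ktor s D n y \<approx> kedge n" for n
    using tor_add[of s "zmul (n * (form D y y div 2)) (coroot D y)" "zmul (n * (form D x x div 2)) (coroot D x)"]
      tor_add[of s "zmul (n * (form D x x div 2)) (coroot D x)" "zmul (n * (form D y y div 2)) (coroot D y)"]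
    by (simp_all only: sum sum[of n, unfolded add.commute[of "zmul (n * (form D y y div 2)) (coroot D y)"]])
  note cl = x y closed(3)[unfolded fst_conv]
  have Fk: "F y * ktor s D e x \<approx> inverse p \<star> (ktor s D e x * F y)"
  proof -
    have "ktor s D e x * F y \<approx> p \<star> (F y * ktor s D e x)"
      using ktor_down[OF x y, of s e] by (simp add: cxy vx)
    from rel_star[OF rel_sym[OF this], of "inverse p"] show ?thesis using p0 by (simp add: star_star)
  qed
  have "acts Tt (E x * E y) ((- (ktor s D e y * F y)) * (- (ktor s D e x * F x)))"
    by (intro rel_mult Tt_edge(1) xy yx)
  also have "(- (ktor s D e y * F y)) * (- (ktor s D e x * F x)) = ktor s D e y * (F y * ktor s D e x) * F x"
    by (simp add: mult.assoc)
  also have "rel (U D) UR UR \<dots> (ktor s D e y * (inverse p \<star> (ktor s D e x * F y)) * F x)"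
    by (rule cong_context[OF Fk]) (simp_all add: x)
  also have "\<dots> = inverse p \<star> ((ktor s D e y * ktor s D e x) * (F y * F x))"
    by (simp add: star_simps mult.assoc)
  also have "rel (U D) UR UR \<dots> (inverse p \<star> (kedge e * (F y * F x)))"
    by (intro rel_star cong_right kt) (simp add: cl)
  finally show "acts Tt (E x * E y) (inverse p \<star> (kedge e * (F y * F x)))" .
  have "acts Tt (F y * F x) ((- (E x * ktor s D (- e) x)) * (- (E y * ktor s D (- e) y)))"
    by (intro rel_mult Tt_edge(2) xy yx)
  also have "(- (E x * ktor s D (- e) x)) * (- (E y * ktor s D (- e) y)) =
      E x * (ktor s D (- e) x * E y) * ktor s D (- e) y"
    by (simp add: mult.assoc)
  also have "rel (U D) UR UR \<dots> (E x * (p \<star> (E y * ktor s D (- e) x)) * ktor s D (- e) y)"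
  proof (rule cong_context)
    show "ktor s D (- e) x * E y \<approx> p \<star> (E y * ktor s D (- e) x)"
      using ktor_up[OF x y, of s "- e"] by (simp add: cxy vx power_int_minus)
  qed (simp_all add: x)
  also have "\<dots> = p \<star> ((E x * E y) * (ktor s D (- e) x * ktor s D (- e) y))"
    by (simp add: star_simps mult.assoc)
  also have "rel (U D) UR UR \<dots> (p \<star> ((E x * E y) * kedge (- e)))"
    by (intro rel_star cong_left kt) (simp add: cl)
  finally show "acts Tt (F y * F x) (p \<star> ((E x * E y) * kedge (- e)))" .
qed

lemma gens_CS_edge: 
  assumes "(x, y) \<in> {(c, d), (d, c)}"
  shows "E x * E y \<in> CS" "F x * F y \<in> CS" "E y * E x \<in> CS" "F y * F x \<in> CS"
  using assms gens_CS(2-5) by auto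

lemma zero_side:
  assumes "j \<in> I0" obtains x y where "(x, y) \<in> {(c, d), (d, c)}" "cart D y j = 0"
  using separated'(2)[OF assms] that by blast

lemma Tt_sub: "Tt \<in> alg_hom Us Us"
proof (rule stable_on_sub[OF Tt_hom])
  fix u assume "u \<in> sub_gens"
  then show "\<exists>q\<in>CS. acts Tt u q"
  proof (cases rule: sub_gens_cases)
    case (tor \<mu>)
    show ?thesis unfolding tor by (rule actsI[OF Tt_tor]) (rule gens_CS)
  next
    case (E j)
    obtain x y where xy: "(x, y) \<in> {(c, d), (d, c)}" "cart D y j = 0" using zero_side[OF E(1)] .
    show ?thesis unfolding E(2)
      by (rule actsI[OF Tt_Ej[OF E(1) xy]]) (intro CS_closed gens_CS(6) E(1) gens_CS_edge[OF xy(1)])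
  next
    case (F j)
    obtain x y where xy: "(x, y) \<in> {(c, d), (d, c)}" "cart D y j = 0" using zero_side[OF F(1)] .
    show ?thesis unfolding F(2)
      by (rule actsI[OF Tt_Fj[OF F(1) xy]]) (intro CS_closed gens_CS(7) F(1) gens_CS_edge[OF xy(1)])
  next
    case (edge x y)
    have 1: "\<exists>q\<in>CS. acts Tt (E x * E y) q"
      by (rule actsI[OF Tt_pair(1)[OF edge(1)]]) (intro CS_closed gens_CS(1) gens_CS_edge[OF edge(1)])
    have yx: "(y, x) \<in> {(c, d), (d, c)}" using edge(1) by auto
    have 2: "\<exists>q\<in>CS. acts Tt (F x * F y) q"
      by (rule actsI[OF Tt_pair(2)[OF yx]]) (intro CS_closed gens_CS(1) gens_CS_edge[OF edge(1)])
    show ?thesis using edge(2) 1 2 by auto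
  qed
qed

lemma dc: "(d, c) \<in> {(c, d), (d, c)}" and cd': "(c, d) \<in> {(c, d), (d, c)}"
  by simp_all

lemma Tt_descends: "descends Tt"
proof (rule descendsI[OF Tt_sub])
  show "sacts Tt (E d * E c) (inverse p \<star> (kedge e * (F c * F d)))"
    by (rule acts_sub(1)[OF Tt_sub Tt_pair(1)[OF dc] gens_CS(3)])
  show "rel Uq QR QR (inverse p \<star> (kedge e * (F c * F d))) 0"
    by (intro kill_star kill_left killed gens_CS(1))
  show "sacts Tt (F c * F d) (p \<star> ((E d * E c) * kedge (- e)))"
    by (rule acts_sub(1)[OF Tt_sub Tt_pair(2)[OF dc] gens_CS(5)])
  show "rel Uq QR QR (p \<star> ((E d * E c) * kedge (- e))) 0"
    by (intro kill_star kill_right killed gens_CS(1))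
qed

context
  fixes \<chi>
  assumes chi: "is_chi D ip im d (if s then - inverse p else - p) \<chi>"
begin

abbreviation (input) z where "z \<equiv> - inverse p"
abbreviation (input) m where "m j \<equiv> (if cart D d j = 0 then cart D c j + cart D d j else 0)"

lemma chi_hom: "\<chi> \<in> alg_hom Us Us"
  using chi by (simp add: is_chi_def)

text \<open>With \<open>z\<close> as the scalar of \<open>E c * E d\<close>, the rescaling takes the same form for both values of the flag.\<close>

lemma chi_acts:
  "sacts \<chi> (tor s \<mu>) (tor s \<mu>)"
  "(x, y) \<in> {(c, d), (d, c)} \<Longrightarrow> sacts \<chi> (E x * E y) (z \<star> (E x * E y))"
  "(x, y) \<in> {(c, d), (d, c)} \<Longrightarrow> sacts \<chi> (F x * F y) (inverse z \<star> (F x * F y))"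
  "j \<in> I0 \<Longrightarrow> sacts \<chi> (E j) (z powi m j \<star> E j)"
  "j \<in> I0 \<Longrightarrow> sacts \<chi> (F j) (z powi (- m j) \<star> F j)"
proof -
  have rep: "rep Us (CS, \<chi> \<circ> cls D)" using rep_compose[OF rep_Us chi_hom qalg_Us] by simp
  have I: "sacts \<chi> u w" if "\<chi> (cls D u) = cls D w" "u \<in> CS" "w \<in> CS" for u w
    using rep rep_Us that by (simp add: rel_def)
  define q where "q = (if s then - inverse p else - p)"
  have q: "is_chi D ip im d q \<chi>" using chi unfolding q_def .
  have qz: "q = (if s then z else inverse z)" by (simp add: q_def)
  have inv: "(inverse z) powi (- n) = z powi n" "(inverse z) powi n = z powi (- n)" for n
    by (simp_all only: power_int_inverse power_int_minus inverse_inverse_eq)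
  have K: "\<chi> (cls D (gK \<nu>)) = cls D (gK \<nu>)" for \<nu>
    using q by (simp add: is_chi_def)
  have G: "\<chi> (cls D (gE ip * gE im)) = cls D (q \<star> (gE ip * gE im))"
    "\<chi> (cls D (gE im * gE ip)) = cls D (q \<star> (gE im * gE ip))"
    "\<chi> (cls D (gF im * gF ip)) = cls D (inverse q \<star> (gF im * gF ip))"
    "\<chi> (cls D (gF ip * gF im)) = cls D (inverse q \<star> (gF ip * gF im))"
    using q unfolding is_chi_def sc_mult_star by blast+
  have M: "\<chi> (cls D (gE j)) = cls D (q powi m j \<star> gE j)" "\<chi> (cls D (gF j)) = cls D (q powi (- m j) \<star> gF j)"
    if "j \<in> I0" for j
    using q that unfolding is_chi_def sc_mult_star Let_def H_simps pairing_simps by blast+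
  show "sacts \<chi> (tor s \<mu>) (tor s \<mu>)"
    by (rule I[OF _ gens_CS(1) gens_CS(1)]) (simp add: tor_def K)
  show "sacts \<chi> (E x * E y) (z \<star> (E x * E y))" if "(x, y) \<in> {(c, d), (d, c)}"
  proof (rule I)
    show "\<chi> (cls D (E x * E y)) = cls D (z \<star> (E x * E y))"
      using that orient G by (auto simp: up_def qz)
  qed (intro CS_closed gens_CS_edge[OF that])+
  show "sacts \<chi> (F x * F y) (inverse z \<star> (F x * F y))" if "(x, y) \<in> {(c, d), (d, c)}"
  proof (rule I)
    show "\<chi> (cls D (F x * F y)) = cls D (inverse z \<star> (F x * F y))"
      using that orient G by (auto simp: up_def qz)
  qed (intro CS_closed gens_CS_edge[OF that])+
  show "sacts \<chi> (E j) (z powi m j \<star> E j)" if "j \<in> I0"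
  proof (rule I)
    show "\<chi> (cls D (E j)) = cls D (z powi m j \<star> E j)"
      using M[OF that] unfolding qz by (cases s) (simp_all only: up_def if_True if_False simp_thms inv minus_minus)
  qed (intro CS_closed gens_CS(6)[OF that])+
  show "sacts \<chi> (F j) (z powi (- m j) \<star> F j)" if "j \<in> I0"
  proof (rule I)
    show "\<chi> (cls D (F j)) = cls D (z powi (- m j) \<star> F j)"
      using M[OF that] unfolding qz by (cases s) (simp_all only: up_def if_True if_False simp_thms inv minus_minus)
  qed (intro CS_closed gens_CS(7)[OF that])+
qed

lemma chi_descends: "descends \<chi>"
  by (rule descendsI[OF chi_hom chi_acts(2)[OF dc] _ chi_acts(3)[OF cd']]) (intro kill_star killed)+

abbreviation (input) op0 where "op0 \<equiv> induced Us J \<chi> \<circ> induced Us J Tt"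

lemma op0_acts:
  assumes "acts Tt u w" "u \<in> CS" "rel Uq QR QR w w'" "sacts \<chi> w' w''"
  shows "op0 (qcls D ip im u) = qcls D ip im w''"
  using descends_acts[OF Tt_descends acts_sub(1)[OF Tt_sub assms(1,2)]] descends_acts[OF chi_descends assms(4)] assms(3)
  by (simp add: rel_def)

lemma p_nonzero: "p \<noteq> 0"
  using aperiodic_nonzero[OF aperiodic_vi[OF c]] by simp

text \<open>If \<open>j\<close> is orthogonal to \<open>d\<close>, the adjoint sum comes out right modulo the ideal, and the factors by which the rescaling multiplies its \<open>n\<close>
  letters \<open>E c * E d\<close> and the letter \<open>E j\<close> cancel. If \<open>j\<close> is orthogonal to \<open>c\<close>, each of the \<open>n\<close> letters carries a factor \<open>- p\<close> modulo
  the ideal, which the rescaling of the letters alone removes. This explains why \<open>E j\<close> is rescaled in the first case only.\<close>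

lemma op0_E:
  assumes j: "j \<in> I0"
  shows "op0 (qcls D ip im (E j)) = qcls D ip im (tad p p (E c * E d) (E j) (nat (- (cart D c j + cart D d j))))"
proof -
  note p0 = p_nonzero
  note EE = gens_CS(2) and Ej = gens_CS(6)[OF j]
  have cancel: "z ^ n * z powi (- int n) = 1" "z powi (- int n) * z ^ n = 1" "z ^ n * (- p) ^ n = 1" for n
    using p0 by (simp_all add: power_int_minus flip: power_mult_distrib)
  show ?thesis
  proof (cases "cart D d j = 0")
    case True
    let ?n = "nat (- cart D c j)"
    have n: "m j = - int ?n" using True cart_nonpos[OF c I0(1)[OF j]] I0(2)[OF j] by auto
    have "rel Uq QR QR (E c * E d - p \<star> (E d * E c)) (E c * E d - 0)"
      by (intro rel_diff kill_star killed Q.cong_refl) (simp add: EE)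
    then have 1: "rel Uq QR QR (tad p p (E c * E d - p \<star> (E d * E c)) (E j) ?n) (tad p p (E c * E d) (E j) ?n)"
      by (intro rel_tad Q.cong_refl) (simp_all add: Ej)
    have "sacts \<chi> (tad p p (E c * E d) (E j) ?n) (tad p p (z \<star> (E c * E d)) (z powi (m j) \<star> E j) ?n)"
      by (intro rel_tad chi_acts(2)[OF cd'] chi_acts(4)[OF j])
    also have "tad p p (z \<star> (E c * E d)) (z powi (m j) \<star> E j) ?n = tad p p (E c * E d) (E j) ?n"
      unfolding tad_star_left tad_star_right star_star n cancel by simp
    finally have 2: "sacts \<chi> (tad p p (E c * E d) (E j) ?n) (tad p p (E c * E d) (E j) ?n)" .
    show ?thesis unfolding True add_0_right by (rule op0_acts[OF Tt_Ej[OF j cd' True] Ej 1 2])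
  next
    case False
    then have cj: "cart D c j = 0" using separated'(2)[OF j] by simp
    let ?n = "nat (- cart D d j)"
    have "rel Uq QR QR (E d * E c - p \<star> (E c * E d)) (0 - p \<star> (E c * E d))"
      by (intro rel_diff rel_star killed Q.cong_refl) (simp add: EE)
    then have "rel Uq QR QR (tad p p (E d * E c - p \<star> (E c * E d)) (E j) ?n) (tad p p ((- p) \<star> (E c * E d)) (E j) ?n)"
      by (intro rel_tad Q.cong_refl) (simp_all add: Ej minus_star)
    then have 1: "rel Uq QR QR (tad p p (E d * E c - p \<star> (E c * E d)) (E j) ?n) ((- p) ^ ?n \<star> tad p p (E c * E d) (E j) ?n)"
      unfolding tad_star_left .
    have mj: "m j = 0" using False by simp
    have "sacts \<chi> ((- p) ^ ?n \<star> tad p p (E c * E d) (E j) ?n)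
        ((- p) ^ ?n \<star> tad p p (z \<star> (E c * E d)) (z powi (m j) \<star> E j) ?n)"
      by (intro rel_star rel_tad chi_acts(2)[OF cd'] chi_acts(4)[OF j])
    also have "(- p) ^ ?n \<star> tad p p (z \<star> (E c * E d)) (z powi (m j) \<star> E j) ?n = tad p p (E c * E d) (E j) ?n"
      unfolding mj tad_star_left star_star mult.commute[of "(- p) ^ _"] cancel power_int_0_right one_star ..
    finally have 2: "sacts \<chi> ((- p) ^ ?n \<star> tad p p (E c * E d) (E j) ?n) (tad p p (E c * E d) (E j) ?n)" .
    show ?thesis unfolding cj add_0_left by (rule op0_acts[OF Tt_Ej[OF j dc cj] Ej 1 2])
  qed
qed

lemma op0_F:
  assumes j: "j \<in> I0"
  shows "op0 (qcls D ip im (F j)) =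
    qcls D ip im (z ^ nat (- (cart D c j + cart D d j)) \<star> tad p p (F d * F c) (F j) (nat (- (cart D c j + cart D d j))))"
proof -
  note p0 = p_nonzero
  note FF = gens_CS(4) and Fj = gens_CS(7)[OF j]
  have zz: "inverse z * z = 1" "z * inverse z = 1" using p0 by simp_all
  have cancel: "inverse z ^ n * z powi int n = 1" "z powi int n * inverse z ^ n = 1" "inverse z ^ n * z ^ n = 1" for n
    unfolding power_int_of_nat power_mult_distrib[symmetric] zz by simp_all
  show ?thesis
  proof (cases "cart D d j = 0")
    case True
    let ?n = "nat (- cart D c j)"
    have n: "- m j = int ?n" using True cart_nonpos[OF c I0(1)[OF j]] I0(2)[OF j] by auto
    have "rel Uq QR QR (F d * F c - inverse p \<star> (F c * F d)) (F d * F c - 0)"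
      by (intro rel_diff kill_star killed Q.cong_refl) (simp add: FF)
    then have 1: "rel Uq QR QR (z ^ ?n \<star> tad p p (F d * F c - inverse p \<star> (F c * F d)) (F j) ?n)
        (z ^ ?n \<star> tad p p (F d * F c) (F j) ?n)"
      by (intro rel_star rel_tad Q.cong_refl) (simp_all add: Fj)
    have "sacts \<chi> (z ^ ?n \<star> tad p p (F d * F c) (F j) ?n)
        (z ^ ?n \<star> tad p p (inverse z \<star> (F d * F c)) (z powi (- m j) \<star> F j) ?n)"
      by (intro rel_star rel_tad chi_acts(3)[OF dc] chi_acts(5)[OF j])
    also have "tad p p (inverse z \<star> (F d * F c)) (z powi (- m j) \<star> F j) ?n = tad p p (F d * F c) (F j) ?n"
      unfolding tad_star_left tad_star_right star_star n cancel by simp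
    finally have 2: "sacts \<chi> (z ^ ?n \<star> tad p p (F d * F c) (F j) ?n) (z ^ ?n \<star> tad p p (F d * F c) (F j) ?n)" .
    show ?thesis unfolding True add_0_right by (rule op0_acts[OF Tt_Fj[OF j cd' True] Fj 1 2])
  next
    case False
    then have cj: "cart D c j = 0" using separated'(2)[OF j] by simp
    let ?n = "nat (- cart D d j)"
    have "rel Uq QR QR (F c * F d - inverse p \<star> (F d * F c)) (0 - inverse p \<star> (F d * F c))"
      by (intro rel_diff rel_star killed Q.cong_refl) (simp add: FF)
    then have "rel Uq QR QR (F c * F d - inverse p \<star> (F d * F c)) (z \<star> (F d * F c))"
      by (simp add: minus_star)
    then have "rel Uq QR QR (z ^ ?n \<star> tad p p (F c * F d - inverse p \<star> (F d * F c)) (F j) ?n)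
        (z ^ ?n \<star> tad p p (z \<star> (F d * F c)) (F j) ?n)"
      by (intro rel_star rel_tad Q.cong_refl) (simp_all add: Fj)
    then have 1: "rel Uq QR QR (z ^ ?n \<star> tad p p (F c * F d - inverse p \<star> (F d * F c)) (F j) ?n)
        (z ^ ?n \<star> z ^ ?n \<star> tad p p (F d * F c) (F j) ?n)"
      unfolding tad_star_left .
    have mj: "- m j = 0" using False by simp
    have "sacts \<chi> (z ^ ?n \<star> z ^ ?n \<star> tad p p (F d * F c) (F j) ?n)
        (z ^ ?n \<star> z ^ ?n \<star> tad p p (inverse z \<star> (F d * F c)) (z powi (- m j) \<star> F j) ?n)"
      by (intro rel_star rel_tad chi_acts(3)[OF dc] chi_acts(5)[OF j])
    also have "z ^ ?n \<star> tad p p (inverse z \<star> (F d * F c)) (z powi (- m j) \<star> F j) ?n = tad p p (F d * F c) (F j) ?n"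
      unfolding mj tad_star_left star_star mult.commute[of "z ^ _"] cancel power_int_0_right one_star ..
    finally have 2: "sacts \<chi> (z ^ ?n \<star> z ^ ?n \<star> tad p p (F d * F c) (F j) ?n) (z ^ ?n \<star> tad p p (F d * F c) (F j) ?n)" .
    show ?thesis unfolding cj add_0_left by (rule op0_acts[OF Tt_Fj[OF j dc cj] Fj 1 2])
  qed
qed

lemma op0_edge:
  "op0 (qcls D ip im (E c * E d)) = qcls D ip im (- (kedge e * (F d * F c)))"
  "op0 (qcls D ip im (F d * F c)) = qcls D ip im (- ((E c * E d) * kedge (- e)))"
proof -
  note p0 = p_nonzero
  have "sacts \<chi> (inverse p \<star> (kedge e * (F d * F c))) (inverse p \<star> (kedge e * (inverse z \<star> (F d * F c))))"
    by (intro rel_star rel_mult chi_acts(1) chi_acts(3)[OF dc])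
  also have "inverse p \<star> (kedge e * (inverse z \<star> (F d * F c))) = - (kedge e * (F d * F c))"
    using p0 by (simp add: star_simps minus_star star_minus)
  finally have 1: "sacts \<chi> (inverse p \<star> (kedge e * (F d * F c))) (- (kedge e * (F d * F c)))" .
  show "op0 (qcls D ip im (E c * E d)) = qcls D ip im (- (kedge e * (F d * F c)))"
    by (rule op0_acts[OF Tt_pair(1)[OF cd'] gens_CS(2) Q.cong_refl 1])
      (unfold fst_conv, intro CS_closed gens_CS(1) gens_CS(4))
  have "sacts \<chi> (p \<star> ((E c * E d) * kedge (- e))) (p \<star> ((z \<star> (E c * E d)) * kedge (- e)))"
    by (intro rel_star rel_mult chi_acts(1) chi_acts(2)[OF cd'])
  also have "p \<star> ((z \<star> (E c * E d)) * kedge (- e)) = - ((E c * E d) * kedge (- e))"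
    using p0 by (simp add: star_simps minus_star star_minus)
  finally have 2: "sacts \<chi> (p \<star> ((E c * E d) * kedge (- e))) (- ((E c * E d) * kedge (- e)))" .
  show "op0 (qcls D ip im (F d * F c)) = qcls D ip im (- ((E c * E d) * kedge (- e)))"
    by (rule op0_acts[OF Tt_pair(2)[OF cd'] gens_CS(4) Q.cong_refl 2])
      (unfold fst_conv, intro CS_closed gens_CS(1) gens_CS(2))
qed

lemma compatible_contracted:
  assumes hT: "is_T s H e None hT" and Phi: "is_Phi D ip im \<Phi>" and x: "x \<in> carrier (U H)"
  shows "\<Phi> (hT x) = op0 (\<Phi> x)"
proof -
  interpret H: quantum_group H by (rule quantum_group_H)
  have NH: "None \<in> idx H" by (simp add: H_simps)
  note P = phi_gens[OF Phi]
  have kt: "ktor s H n None = tor s (zmul (n * (form D c c div 2)) (coroot D c + coroot D d))" for n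
    by (simp add: H_simps)
  have cart_NS: "cart H None (Some k) = cart D c k + cart D d k" for k by (simp add: H_simps pairing_simps)
  have tadH: "tad (vi D c) = tad p" by (intro ext) (rule tad_vi[OF e])
  show ?thesis
  proof (rule compatible_everywhere[OF _ H.T_hom[OF hT NH]
        alg_hom_compose[OF descends_hom[OF Tt_descends] descends_hom[OF chi_descends]] _ _ _ x])
    show "\<Phi> \<in> alg_hom (U H) Uq" using Phi by (simp add: is_Phi_def Let_def)
  next
    fix \<mu>
    show "\<Phi> (hT (cls H (tor s \<mu>))) = op0 (\<Phi> (cls H (tor s \<mu>)))"
      by (rule compatible_on_generator[OF P(1) H.T_tor[OF hT NH] P(1)], unfold refl_H)
        (rule op0_acts[OF Tt_tor gens_CS(1) Q.cong_refl chi_acts(1)], simp add: gens_CS(1))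
  next
    fix i assume "i \<in> idx H"
    then consider "i = None" | k where "i = Some k" "k \<in> I0"
      by (auto simp: H_simps)
    then show "\<Phi> (hT (cls H (up s i))) = op0 (\<Phi> (cls H (up s i)))"
    proof cases
      case 1
      show ?thesis unfolding 1
        by (rule compatible_on_generator[OF P(4) H.T_up_self[OF hT NH]], unfold kt,
            rule rel_minus[OF rel_mult[OF P(1) P(5)]]) (rule op0_edge)
    next
      case (2 k)
      have kH: "Some k \<in> idx H" "Some k \<noteq> None" using 2 by (simp_all add: H_simps)
      show ?thesis unfolding 2(1)
        by (rule compatible_on_generator[OF P(2)[OF 2(2)] H.T_up[OF hT NH kH]], unfold vi_H cart_NS tadH,
            rule rel_tad[OF P(4) P(2)[OF 2(2)]]) (rule op0_E[OF 2(2)])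
    qed
  next
    fix i assume "i \<in> idx H"
    then consider "i = None" | k where "i = Some k" "k \<in> I0"
      by (auto simp: H_simps)
    then show "\<Phi> (hT (cls H (up (\<not> s) i))) = op0 (\<Phi> (cls H (up (\<not> s) i)))"
    proof cases
      case 1
      show ?thesis unfolding 1
        by (rule compatible_on_generator[OF P(5) H.T_down_self[OF hT NH]], unfold kt,
            rule rel_minus[OF rel_mult[OF P(4) P(1)]]) (rule op0_edge)
    next
      case (2 k)
      have kH: "Some k \<in> idx H" "Some k \<noteq> None" using 2 by (simp_all add: H_simps)
      show ?thesis unfolding 2(1)
        by (rule compatible_on_generator[OF P(3)[OF 2(2)] H.T_down[OF hT NH kH]], unfold vi_H cart_NS tadH,
            rule rel_star[OF rel_tad[OF P(5) P(3)[OF 2(2)]]]) (rule op0_F[OF 2(2)])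
    qed
  qed
qed

end

end

lemma compatible:
  assumes e: "e \<in> {1, -1}" and T: "\<And>k. k \<in> idx D \<Longrightarrow> is_T s D e k (T k)"
    and hT: "is_T s H e i hT" and i: "i \<in> idx H"
    and chi: "is_chi D ip im d (if s then - inverse (vi D c powi e) else - (vi D c powi e)) \<chi>"
    and Phi: "is_Phi D ip im \<Phi>" and x: "x \<in> carrier (U H)"
  shows "\<Phi> (hT x) = quot_op D ip im T \<chi> i (\<Phi> x)"
proof (cases i)
  case None
  show ?thesis using compatible_contracted[OF e T chi _ Phi x] hT unfolding None by simp
next
  case (Some j)
  then have j: "j \<in> I0" using i by (auto simp: H_simps)
  show ?thesis using compatible_away[OF j T[OF I0(1)[OF j]] _ Phi x] hT unfolding Some by simp
qed

end

lemma quantum_group_of_root_datum: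
  assumes "is_root_datum D" shows "quantum_group D"
proof -
  have "cartan_datum (idx D) (form D)" "perfect_pairing (pairing D)"
    "\<And>i j. i \<in> idx D \<Longrightarrow> j \<in> idx D \<Longrightarrow> cart D i j = 2 * form D i j div form D i i"
    using assms unfolding is_root_datum_def by blast+
  moreover have "\<And>y. additive (pairing D y)" "\<And>x. additive (\<lambda>y. pairing D y x)"
    using \<open>perfect_pairing (pairing D)\<close> unfolding perfect_pairing_def by blast+
  ultimately show ?thesis by (intro quantum_group.intro)
qed

theorem theorem5p3p1:
  fixes D :: "('i, 'y::ab_group_add, 'x::ab_group_add) root_datum"
    and ip im :: 'i and e :: int and i :: "'i option"
    and T1 T2 :: "'i \<Rightarrow> ('i, 'y) free set \<Rightarrow> ('i, 'y) free set"
    and hT1 hT2 :: "'i option \<Rightarrow> ('i option, 'y) free set \<Rightarrow> ('i option, 'y) free set"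
    and \<chi>1 \<chi>2 :: "('i, 'y) free set \<Rightarrow> ('i, 'y) free set"
    and \<Phi> :: "('i option, 'y) free set \<Rightarrow> ('i, 'y) free set set"
  assumes "is_root_datum D"
    and "ip \<in> idx D" and "im \<in> idx D"
    and "form D ip ip = form D im im" and "form D im im = - 2 * form D ip im"
    and "\<not> (\<exists>j\<in>idx D - {ip, im}. form D j ip \<noteq> 0 \<and> form D j im \<noteq> 0)"
    and "e \<in> {1, -1}"
    and "\<And>k. k \<in> idx D \<Longrightarrow> is_T1 D e k (T1 k)"
    and "\<And>k. k \<in> idx D \<Longrightarrow> is_T2 D e k (T2 k)"
    and "\<And>k. k \<in> idx (contract D ip im) \<Longrightarrow> is_T1 (contract D ip im) e k (hT1 k)"
    and "\<And>k. k \<in> idx (contract D ip im) \<Longrightarrow> is_T2 (contract D ip im) e k (hT2 k)"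
    and "is_chi1 D ip im e \<chi>1" and "is_chi2 D ip im e \<chi>2"
    and "is_Phi D ip im \<Phi>"
    and "i \<in> idx (contract D ip im)"
  shows "(\<forall>x\<in>carrier (U (contract D ip im)).
            \<Phi> (hT1 i x) = quot_op D ip im T1 \<chi>1 i (\<Phi> x)) \<and>
         (\<forall>x\<in>carrier (U (contract D ip im)).
            \<Phi> (hT2 i x) = quot_op D ip im T2 \<chi>2 i (\<Phi> x))"
proof -
  interpret quantum_group D by (rule quantum_group_of_root_datum[OF assms(1)])
  interpret one: oriented_edge D ip im True ip im
    by unfold_locales (use assms(2-6) in simp_all)
  interpret two: oriented_edge D ip im False im ip
    by unfold_locales (use assms(2-6) in simp_all)
  have c1: "is_chi D ip im im (if True then - inverse (vi D ip powi e) else - (vi D ip powi e)) \<chi>1"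
    using assms(12) by (simp add: is_chi1_def one.vi_H power_int_minus)
  have c2: "is_chi D ip im ip (if False then - inverse (vi D im powi e) else - (vi D im powi e)) \<chi>2"
    using assms(13) by (simp add: is_chi2_def two.vi_H)
  have T1: "is_T True D e k (T1 k)" and T2: "is_T False D e k (T2 k)" if "k \<in> idx D" for k
    using assms(8,9)[OF that] by (simp_all add: is_T_def)
  have hT1: "is_T True (contract D ip im) e i (hT1 i)" and hT2: "is_T False (contract D ip im) e i (hT2 i)"
    using assms(10,11)[OF assms(15)] by (simp_all add: is_T_def)
  show ?thesis
    using one.compatible[OF assms(7) T1 hT1 assms(15) c1 assms(14)]
      two.compatible[OF assms(7) T2 hT2 assms(15) c2 assms(14)] by blast
qed

end
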